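(* Let $|q|<1$ and let $k\ge 2$ be an integer. Then for each $i=1,\dots,k$, \[ \sum_{r^{(1)},\dots,r^{(k-1)}\in\mathbb Z^2} \frac{q^{\frac12\sum_{j=1}^{k-1}r^{(j)}Cr^{(j)}+\sum_{j=i}^{k-1}|r^{(j)}|+2r^{(k-1)}_1r^{(k-1)}_2}\,(1-q^{|r^{(i-1)}|+1})} {(q)_{r^{(1)}-r^{(2)}}\cdots(q)_{r^{(k-2)}-r^{(k-1)}}(q)_{r^{(k-1)}}(q)_{|r^{(k-1)}|+1}} =\frac{(q^i,q^i,q^{2i},q^{3k-2i-1},q^{3k-i-1},q^{3k-i-1},q^{3k-1},q^{3k-1};q^{3k-1})_\infty}{(q)_\infty^3}, \] where for $i=1$ the factor $(1-q^{|r^{(0)}|+1})$ is interpreted as $1$. Moreover, for $\sigma\in\{0,1\}$, \[ \sum_{r^{(1)},\dots,r^{(k-1)}\in\mathbb Z^2} \frac{q^{\sum_{j=1}^{k-1}(\frac12 r^{(j)}Cr^{(j)}+r^{(j)}_1)+2r^{(k-1)}_1r^{(k-1)}_2+\sigma r^{(k-1)}_2}} {(q)_{r^{(1)}-r^{(2)}}\cdots(q)_{r^{(k-2)}-r^{(k-1)}}(q)_{r^{(k-1)}}(q)_{|r^{(k-1)}|+1}} =\frac{(q,q^{k-\sigma},q^{k+1-\sigma},q^{2k-2+\sigma},q^{2k-1+\sigma},q^{3k-2},q^{3k-1},q^{3k-1};q^{3k-1})_\infty}{(q)_\infty^3}. \]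
   Context: $(x;q)_n=\prod_{j=0}^{n-1}(1-xq^j)$ for $n\ge0$, $(x;q)_\infty=\prod_{j\ge0}(1-xq^j)$, $(x_1,\dots,x_m;q)_\infty=\prod_l(x_l;q)_\infty$, and $(q)_n=(q;q)_n$ with the convention $1/(q)_n=0$ for $n<0$. For $v=(v_1,v_2)\in\mathbb Z^2$: $|v|=v_1+v_2$, $(q)_v=(q)_{v_1}(q)_{v_2}$, and $vCv=\sum_{i,j=1}^2v_iC_{ij}v_j$ with $C=\begin{pmatrix}2&-1\\-1&2\end{pmatrix}$, so $\frac12 vCv=v_1^2-v_1v_2+v_2^2$. Differences $r^{(j)}-r^{(j+1)}$ are componentwise. When $k=2$ the chain $(q)_{r^{(1)}-r^{(2)}}\cdots(q)_{r^{(k-2)}-r^{(k-1)}}$ is empty. *)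

theory Defs
  imports "HOL-Analysis.Analysis"
begin

definition qpoch :: "complex \<Rightarrow> complex \<Rightarrow> nat \<Rightarrow> complex" where
  "qpoch x q n = (\<Prod>j<n. 1 - x * q ^ j)"

definition qinv :: "complex \<Rightarrow> int \<Rightarrow> complex" where
  "qinv q n = (if n < 0 then 0 else 1 / qpoch q q (nat n))"

definition qpinf :: "complex \<Rightarrow> complex \<Rightarrow> complex" where
  "qpinf x q = (\<Prod>j. 1 - x * q ^ j)"

definition absv :: "int \<times> int \<Rightarrow> int" where
  "absv v = fst v + snd v"

definition halfvCv :: "int \<times> int \<Rightarrow> int" where
  "halfvCv v = fst v ^ 2 - fst v * snd v + snd v ^ 2"

definition recden :: "complex \<Rightarrow> nat \<Rightarrow> (nat \<Rightarrow> int \<times> int) \<Rightarrow> complex" where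
  "recden q k r =
     (\<Prod>j\<in>{1..k-2}. qinv q (fst (r j) - fst (r (j+1))) * qinv q (snd (r j) - snd (r (j+1))))
     * qinv q (fst (r (k-1))) * qinv q (snd (r (k-1))) * qinv q (absv (r (k-1)) + 1)"

definition summand1 :: "complex \<Rightarrow> nat \<Rightarrow> nat \<Rightarrow> (nat \<Rightarrow> int \<times> int) \<Rightarrow> complex" where
  "summand1 q k i r =
     q powi ((\<Sum>j=1..k-1. halfvCv (r j)) + (\<Sum>j=i..k-1. absv (r j))
             + 2 * fst (r (k-1)) * snd (r (k-1)))
     * (if i = 1 then 1 else 1 - q powi (absv (r (i-1)) + 1))
     * recden q k r"

definition summand2 :: "complex \<Rightarrow> nat \<Rightarrow> nat \<Rightarrow> (nat \<Rightarrow> int \<times> int) \<Rightarrow> complex" where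
  "summand2 q k \<sigma> r =
     q powi ((\<Sum>j=1..k-1. halfvCv (r j) + fst (r j))
             + 2 * fst (r (k-1)) * snd (r (k-1)) + int \<sigma> * snd (r (k-1)))
     * recden q k r"

end

(*
The weights K(M, N; x) = (q)_(M+N) / prod_i (q)_(M-x_i) (q)_(N+x_i), with x = (x_1, x_2, x_3), are
reproduced up to a power of q by summation against a quadratic power of q divided by
(q)_(M-r) (q)_(N-s): this is an A2 Bailey lemma, and it follows from two applications of
q-Vandermonde. Every summation variable r^(j) of the theorem is one Bailey step. The innermost factor
q^(2 r_1 r_2) / ((q)_(r_1) (q)_(r_2) (q)_(r_1+r_2+1)) is an alternating sum of weights K over the root
lattice (the seed), proved by a recurrence in (M, N) that comes from a reflection of the lattice.
The factor 1 - q^(|r^(i-1)|+1) replaces K(M+1, N+1; y) by K(M, N; y + (1,0,-1)) inside such an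
alternating sum, and from then on each step also multiplies by q^(y_1-y_3). After all steps
M, N -> infinity leaves the sum side of the A2 Macdonald identity with base q^(3k-1), which is
obtained from three Jacobi triple products and the pentagonal number theorem.
*)

theory Submission
  imports Defs
begin

section \<open>Bailey lemma for the root system of type A2\<close>

text \<open>The base comes from \<open>hq\<close>, half the squared length of a lattice vector, and
  \<open>gq\<close>: hq = 3 gq + 1 wherever \<open>chi\<close> is nonzero. The seed weight is q^(2
  gq) and each step adds hq, so after k - 1 steps the exponent is (k - 1) + (3k - 1) gq. All changes
  of kernel have one source. With X, Y, Z the powers q^(y_i), so that XYZ = 1, lowering M or N, with
  or without a shift of y, multiplies K by a polynomial in X, Y, Z up to a constant. The
  coefficients are antisymmetric under the Weyl group and K is symmetric, so only the alternant of
  the polynomial counts: a symmetric factor times the Vandermonde determinant, whose leading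
  monomial is X^2 Y = q^(y_1 - y_3). In low degree the factor is a constant; for the seed it is not,
  and splitting it into factors that lower M or N gives the recurrence. The second family uses
  K(M+1, N; y + (0,0,1)): its coordinate sum 1 produces the linear term r_1 of the exponent. Given
  the outer variables each inner sum is finite, so exchanges are harmless; only r^(1) runs over an
  infinite range, and there dominated convergence needs absolute summability of the whole multiple
  sum.\<close>

lemma has_sum_bij:
  assumes "bij g" "(f has_sum S) UNIV" shows "((\<lambda>x. f (g x)) has_sum S) UNIV"
  using has_sum_reindex_bij_betw[OF assms(1), of f S] assms(2) by simp

lemma has_sum_shift_int:
  fixes f :: "int \<Rightarrow> complex"
  assumes "(f has_sum S) UNIV" shows "((\<lambda>j. f (j + c)) has_sum S) UNIV"
  using assms by (rule has_sum_bij[rotated]) (rule bijI', auto, metis diff_add_cancel)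

lemma has_sum_fubini:
  fixes f :: "'a \<Rightarrow> 'b \<Rightarrow> complex"
  assumes "(\<lambda>(x, y). f x y) summable_on UNIV"
    and "\<And>x. (f x has_sum g x) UNIV"
    and "\<And>y. ((\<lambda>x. f x y) has_sum h y) UNIV"
    and "(h has_sum S) UNIV"
  shows "(g has_sum S) UNIV"
proof -
  obtain T where T: "((\<lambda>(x, y). f x y) has_sum T) (UNIV \<times> UNIV)"
    using assms(1) by (auto simp: summable_on_def)
  have 1: "(g has_sum T) UNIV"
    using has_sum_SigmaD[OF T] assms(2) by auto
  have "((\<lambda>(y, x). f x y) has_sum T) (UNIV \<times> UNIV)"
    using T by (subst has_sum_swap) (simp add: case_prod_unfold)
  hence "(h has_sum T) UNIV"
    using has_sum_SigmaD assms(3) by fastforce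
  hence "T = S" using assms(4) has_sum_unique by blast
  thus ?thesis using 1 by simp
qed

lemma finite_supp_summable:
  fixes f :: "'a \<Rightarrow> complex"
  assumes "finite B" "\<And>x. x \<notin> B \<Longrightarrow> f x = 0" shows "f summable_on UNIV"
  by (rule finite_nonzero_values_imp_summable_on) (rule finite_subset[OF _ assms(1)], use assms(2) in blast)

section \<open>Shifted factorials and the q-Vandermonde sums\<close>

locale qbase =
  fixes q :: complex
  assumes q_nz: "q \<noteq> 0" and q_lt1: "norm q < 1"
begin

lemma qpow_neq_1: "n > 0 \<Longrightarrow> q ^ n \<noteq> 1"
proof
  assume n: "n > 0" "q ^ n = 1"
  have "norm q ^ n < 1" using n q_lt1 by (simp add: power_less_one_iff)
  thus False using n by (metis norm_one norm_power less_irrefl)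
qed

lemma qpowi_neq_1: "n > 0 \<Longrightarrow> q powi n \<noteq> 1"
  using qpow_neq_1[of "nat n"] by (simp add: power_int_def)

lemma qpoch_nz: "qpoch q q n \<noteq> 0"
  unfolding qpoch_def using qpow_neq_1[of "Suc j" for j] by auto

text \<open>At negative arguments the value is 1, so \<open>fq\<close> never vanishes; truncation is
  the task of \<open>iq\<close> alone.\<close>

definition fq :: "int \<Rightarrow> complex" where "fq n = qpoch q q (nat n)"

abbreviation iq :: "int \<Rightarrow> complex" where "iq \<equiv> qinv q"

lemma fq_nz: "fq n \<noteq> 0"
  by (simp add: fq_def qpoch_nz)

lemma iq_neg: "n < 0 \<Longrightarrow> iq n = 0"
  by (simp add: qinv_def)

lemma iq_eq: "n \<ge> 0 \<Longrightarrow> iq n = 1 / fq n"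
  by (simp add: qinv_def fq_def)

lemma fq_0: "fq 0 = 1"
  by (simp add: fq_def qpoch_def)

lemma iq_0: "iq 0 = 1"
  by (simp add: qinv_def qpoch_def)

lemma fq_rec: assumes "n \<ge> 1" shows "fq n = (1 - q powi n) * fq (n - 1)"
proof -
  obtain m where m: "n = int (Suc m)" using assms by (metis Suc_le_D int_nat_eq nat_le_iff nat_int of_nat_Suc One_nat_def int_one_le_iff_zero_less zero_less_imp_eq_int gr0_conv_Suc of_nat_0_less_iff)
  show ?thesis unfolding m fq_def by (simp add: qpoch_def power_int_def nat_add_distrib)
qed

text \<open>At n = 0 the factor 1 - q^0 vanishes together with \<open>iq (- 1)\<close>, so the
  relation crosses the truncation point and the recurrences below run over the integers without
  boundary cases.\<close>

lemma iq_pred: "iq (n - 1) = (1 - q powi n) * iq n"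
proof -
  consider "n < 0" | "n = 0" | "n \<ge> 1" by linarith
  thus ?thesis
  proof cases
    case 3
    have "1 - q powi n \<noteq> 0" using qpowi_neq_1[of n] 3 by auto
    thus ?thesis using 3 fq_rec[of n] fq_nz[of "n - 1"] by (simp add: iq_eq)
  qed (auto simp: iq_neg)
qed

lemma qpi_add: "q powi (m + n) = q powi m * q powi n"
  using q_nz by (simp add: power_int_add)

text \<open>This is the limit n -> infinity of \<open>q_vandermonde_nat\<close>. The parameter
  \<open>d\<close> stays arbitrary in the induction because the Pascal-type rule combines the term
  at (d, j) with the one at (d + 1, j - 1).\<close>

lemma q_vandermonde_limit_nat:
  "((\<lambda>j. q powi (j * (j + d)) * iq j * iq (j + d) * iq (int m - j)) has_sum iq (int m) * iq (int m + d)) UNIV"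
proof (induction m arbitrary: d)
  case 0
  show ?case
  proof (rule has_sum_finite_neutralI[of "{0}"])
    fix j :: int assume "j \<in> UNIV - {0}"
    hence "j < 0 \<or> int 0 - j < 0" by auto
    thus "q powi (j * (j + d)) * iq j * iq (j + d) * iq (int 0 - j) = 0" by (auto simp: iq_neg)
  qed (auto simp: iq_0)
next
  case (Suc m)
  let ?M = "int (Suc m)"
  define t where "t = (\<lambda>d m j. q powi (j * (j + d)) * iq j * iq (j + d) * iq (m - j))"
  have A: "(t d (int m) has_sum iq (int m) * iq (int m + d)) UNIV" for d
    using Suc.IH[of d] by (simp add: t_def)
  have "((\<lambda>j. t (d+1) (int m) (j - 1)) has_sum iq (int m) * iq (int m + (d+1))) UNIV"
    using has_sum_shift_int[OF A[of "d+1"], of "- 1"] by simp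
  from has_sum_add[OF A[of d] has_sum_cmult_right[OF this, of "q powi (?M + d)"]]
  have B: "((\<lambda>j. t d (int m) j + q powi (?M + d) * t (d+1) (int m) (j - 1)) has_sum
     iq (int m) * iq (int m + d) + q powi (?M + d) * (iq (int m) * iq (int m + (d+1)))) UNIV" .
  have C: "t d (int m) j + q powi (?M + d) * t (d+1) (int m) (j - 1) = (1 - q powi ?M) * t d ?M j" for j
  proof -
    have e1: "iq (int m - j) = (1 - q powi (?M - j)) * iq (?M - j)" using iq_pred[of "?M - j"] by (simp add: algebra_simps)
    have e2: "iq (j - 1) = (1 - q powi j) * iq j" by (rule iq_pred)
    have e3: "?M + d + (j - 1) * (j - 1 + (d + 1)) = (?M - j) + j * (j + d)" by (simp add: algebra_simps)
    have e4: "q powi (?M + d) * t (d+1) (int m) (j - 1) = q powi ((?M - j) + j * (j + d)) * iq (j-1) * iq (j + d) * iq (?M - j)"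
      unfolding t_def e3[symmetric] qpi_add by (simp add: algebra_simps)
    have e5: "q powi ?M = q powi (?M - j) * q powi j" by (simp add: qpi_add[symmetric])
    show ?thesis unfolding e4 unfolding e2 qpi_add t_def e1 e5 by (simp add: algebra_simps)
  qed
  have D: "iq (int m) * iq (int m + d) + q powi (?M + d) * (iq (int m) * iq (int m + (d+1))) = (1 - q powi ?M) * (iq ?M * iq (?M + d))"
  proof -
    have 1: "iq (int m) = (1 - q powi ?M) * iq ?M" "iq (int m + d) = (1 - q powi (?M + d)) * iq (?M + d)"
      using iq_pred[of ?M] iq_pred[of "?M + d"] by (simp_all add: algebra_simps)
    have i: "int m + (d + 1) = ?M + d" by auto
    show ?thesis unfolding i 1 by (simp add: algebra_simps)
  qed
  have nz: "1 - q powi ?M \<noteq> 0" using qpowi_neq_1[of ?M] by auto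
  from B[unfolded C D] nz have "(t d ?M has_sum iq ?M * iq (?M + d)) UNIV"
    by (simp add: has_sum_cmult_right_iff)
  thus ?case by (simp add: t_def)
qed

lemma q_vandermonde_limit:
  "((\<lambda>r. q powi ((r - a) * (r - b)) * iq (M - r) * iq (r - a) * iq (r - b)) has_sum iq (M - a) * iq (M - b)) UNIV"
proof (cases "M - a \<ge> 0")
  case True
  have "((\<lambda>r. q powi ((r + - a) * ((r + - a) + (a - b))) * iq (r + - a) * iq ((r + - a) + (a - b)) * iq (int (nat (M - a)) - (r + - a)))
     has_sum iq (int (nat (M - a))) * iq (int (nat (M - a)) + (a - b))) UNIV"
    by (rule has_sum_shift_int[OF q_vandermonde_limit_nat])
  thus ?thesis using True by (simp add: mult_ac)
next
  case False
  hence "iq (M - r) * iq (r - a) = 0" for r by (cases "M - r < 0") (auto simp: iq_neg)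
  hence *: "q powi ((r - a) * (r - b)) * iq (M - r) * iq (r - a) * iq (r - b) = 0" for r
    by (metis mult.assoc mult_zero_left mult_zero_right)
  show ?thesis unfolding * using False by (simp add: iq_neg)
qed

text \<open>The induction is the one used for the limiting case; the shifted term now also takes n -
  1 for n, so that both terms share the factor \<open>iq (n - j)\<close>.\<close>

lemma q_vandermonde_nat:
  "((\<lambda>j. q powi (j * (j + d)) * iq j * iq (j + d) * iq (int m - j) * iq (n - j)) has_sum
     fq (int m + n + d) * iq (int m) * iq (int m + d) * iq n * iq (n + d)) UNIV"
proof (induction m arbitrary: d n)
  case 0
  have "((\<lambda>j. q powi (j * (j + d)) * iq j * iq (j + d) * iq (int 0 - j) * iq (n - j)) has_sum
     (\<Sum>j\<in>{0}. q powi (j * (j + d)) * iq j * iq (j + d) * iq (int 0 - j) * iq (n - j))) UNIV"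
  proof (rule has_sum_finite_neutralI[of "{0}"])
    fix j :: int assume "j \<in> UNIV - {0}"
    hence "j < 0 \<or> int 0 - j < 0" by auto
    thus "q powi (j * (j + d)) * iq j * iq (j + d) * iq (int 0 - j) * iq (n - j) = 0" by (auto simp: iq_neg)
  qed auto
  moreover have "iq d * iq n = fq (n + d) * iq d * iq n * iq (n + d)"
    by (cases "d < 0"; cases "n < 0") (auto simp: iq_neg iq_eq fq_nz)
  ultimately show ?case by (simp add: iq_0)
next
  case (Suc m)
  let ?M = "int (Suc m)"
  define t where "t = (\<lambda>d m n j. q powi (j * (j + d)) * iq j * iq (j + d) * iq (m - j) * iq (n - j))"
  define R where "R = (\<lambda>d m n. fq (m + n + d) * iq m * iq (m + d) * iq n * iq (n + d))"
  have A: "(t d (int m) n has_sum R d (int m) n) UNIV" for d n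
    using Suc.IH[of d n] by (simp add: t_def R_def)
  have "((\<lambda>j. t (d+1) (int m) (n - 1) (j - 1)) has_sum R (d+1) (int m) (n - 1)) UNIV"
    using has_sum_shift_int[OF A[of "d+1" "n - 1"], of "- 1"] by simp
  from has_sum_add[OF A[of d] has_sum_cmult_right[OF this, of "q powi (?M + d)"]]
  have B: "((\<lambda>j. t d (int m) n j + q powi (?M + d) * t (d+1) (int m) (n - 1) (j - 1)) has_sum
     R d (int m) n + q powi (?M + d) * R (d+1) (int m) (n - 1)) UNIV" .
  have C: "t d (int m) n j + q powi (?M + d) * t (d+1) (int m) (n - 1) (j - 1) = (1 - q powi ?M) * t d ?M n j" for j
  proof -
    have e1: "iq (int m - j) = (1 - q powi (?M - j)) * iq (?M - j)" using iq_pred[of "?M - j"] by (simp add: algebra_simps)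
    have e2: "iq (j - 1) = (1 - q powi j) * iq j" by (rule iq_pred)
    have e3: "?M + d + (j - 1) * (j - 1 + (d + 1)) = (?M - j) + j * (j + d)" by (simp add: algebra_simps)
    have e4: "q powi (?M + d) * t (d+1) (int m) (n - 1) (j - 1) = q powi ((?M - j) + j * (j + d)) * iq (j-1) * iq (j + d) * iq (?M - j) * iq (n - j)"
      unfolding t_def e3[symmetric] qpi_add by (simp add: algebra_simps)
    have e5: "q powi ?M = q powi (?M - j) * q powi j" by (simp add: qpi_add[symmetric])
    show ?thesis unfolding e4 unfolding e2 qpi_add t_def e1 e5 by (simp add: algebra_simps)
  qed
  have D: "R d (int m) n + q powi (?M + d) * R (d+1) (int m) (n - 1) = (1 - q powi ?M) * R d ?M n"
  proof -
    define c where "c = fq (int m + n + d) * iq ?M * iq (?M + d) * iq n * iq (n + d)"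
    have 1: "iq (int m) = (1 - q powi ?M) * iq ?M" "iq (int m + d) = (1 - q powi (?M + d)) * iq (?M + d)"
      "iq (n - 1) = (1 - q powi n) * iq n"
      using iq_pred[of ?M] iq_pred[of "?M + d"] iq_pred[of n] by (simp_all add: algebra_simps)
    have i: "int m + (n - 1) + (d + 1) = int m + n + d" "int m + (d + 1) = ?M + d" "n - 1 + (d + 1) = n + d" by auto
    have "R d (int m) n + q powi (?M + d) * R (d+1) (int m) (n - 1) = (1 - q powi ?M) * ((1 - q powi (?M + d)) + q powi (?M + d) * (1 - q powi n)) * c"
      unfolding R_def i 1 c_def by (simp add: algebra_simps)
    also have "(1 - q powi (?M + d)) + q powi (?M + d) * (1 - q powi n) = 1 - q powi (?M + n + d)"
      unfolding qpi_add by (simp add: algebra_simps)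
    \<comment> \<open>For n + d < 0 both sides vanish through \<open>iq (n + d)\<close>; otherwise
      the argument of \<open>fq\<close> is at least 1 and its recurrence applies.\<close>
    also have "(1 - q powi ?M) * (1 - q powi (?M + n + d)) * c = (1 - q powi ?M) * R d ?M n"
    proof (cases "n + d < 0")
      case True thus ?thesis by (simp add: c_def R_def iq_neg)
    next
      case False
      hence "fq (?M + n + d) = (1 - q powi (?M + n + d)) * fq (?M + n + d - 1)" by (intro fq_rec) simp
      moreover have "?M + n + d - 1 = int m + n + d" by simp
      ultimately have f: "fq (?M + n + d) = (1 - q powi (?M + n + d)) * fq (int m + n + d)" by metis
      show ?thesis unfolding c_def R_def f by (simp only: mult_ac)
    qed
    finally show ?thesis .
  qed
  have nz: "1 - q powi ?M \<noteq> 0" using qpowi_neq_1[of ?M] by auto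
  from B[unfolded C D] nz have "(t d ?M n has_sum R d ?M n) UNIV"
    by (simp add: has_sum_cmult_right_iff)
  thus ?case by (simp add: t_def R_def)
qed

text \<open>Normalised so that x, y are the lower and M, N + x + y the upper bounds of summation;
  the right side then consists of the numerator and two of the three pairs of factors of the
  kernel.\<close>

lemma q_vandermonde:
  "((\<lambda>j. q powi ((j - x) * (j - y)) * iq (j - x) * iq (j - y) * iq (M - j) * iq (N + x + y - j)) has_sum
     fq (M + N) * iq (M - x) * iq (N + x) * iq (M - y) * iq (N + y)) UNIV"
proof (cases "M - x \<ge> 0")
  case True
  have "((\<lambda>j. q powi ((j + - x) * ((j + - x) + (x - y))) * iq (j + - x) * iq ((j + - x) + (x - y)) * iq (int (nat (M - x)) - (j + - x)) * iq (N + y - (j + - x)))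
     has_sum fq (int (nat (M - x)) + (N + y) + (x - y)) * iq (int (nat (M - x))) * iq (int (nat (M - x)) + (x - y)) * iq (N + y) * iq (N + y + (x - y))) UNIV"
    by (rule has_sum_shift_int[OF q_vandermonde_nat])
  moreover have "int (nat (M - x)) = M - x" "\<And>j. M - x - (j + - x) = M - j" "\<And>j. N + y - (j + - x) = N + x + y - j"
    "\<And>j. (j + - x) + (x - y) = j - y" "\<And>j. j + - x = j - x" "M - x + (N + y) + (x - y) = M + N" "M - x + (x - y) = M - y"
    "N + y + (x - y) = N + x" using True by auto
  ultimately show ?thesis by (simp only: mult_ac)
next
  case False
  hence "iq (j - x) * iq (M - j) = 0" for j by (cases "M - j < 0") (auto simp: iq_neg)
  hence *: "q powi ((j - x) * (j - y)) * iq (j - x) * iq (j - y) * iq (M - j) * iq (N + x + y - j) = 0" for j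
    by (metis mult.assoc mult.commute mult_zero_left mult_zero_right)
  show ?thesis unfolding * using False by (simp add: iq_neg)
qed

text \<open>The substitution j -> -j exchanges lower and upper bounds, which moves the quadratic
  exponent to the upper pair.\<close>

lemma q_vandermonde_reversed:
  "((\<lambda>j. q powi ((M - j) * (N + x + y - j)) * iq (j - x) * iq (j - y) * iq (M - j) * iq (N + x + y - j)) has_sum
     fq (M + N) * iq (M - x) * iq (N + x) * iq (M - y) * iq (N + y)) UNIV"
proof -
  have b: "bij (\<lambda>j::int. - j)" by (rule bijI') (auto intro: exI[of _ "- x" for x])
  have "((\<lambda>j. q powi ((- j - - M) * (- j - - (N + x + y))) * iq (- j - - M) * iq (- j - - (N + x + y)) * iq (- x - - j) *
      iq ((M + N + x) + - M + - (N + x + y) - - j)) has_sum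
     fq (- x + (M + N + x)) * iq (- x - - M) * iq ((M + N + x) + - M) * iq (- x - - (N + x + y)) * iq ((M + N + x) + - (N + x + y))) UNIV"
    using has_sum_bij[OF b q_vandermonde[of "- M" "- (N + x + y)" "- x" "M + N + x"]] .
  thus ?thesis by (simp add: mult_ac add_ac algebra_simps)
qed

section \<open>The kernel and its Bailey lemma\<close>

definition K :: "int \<Rightarrow> int \<Rightarrow> int \<Rightarrow> int \<Rightarrow> int \<Rightarrow> complex" where
  "K M N x y z = fq (M + N) * (iq (M - x) * iq (N + x)) * (iq (M - y) * iq (N + y)) * (iq (M - z) * iq (N + z))"

lemma K_0:
  assumes "\<not> (- N \<le> x \<and> x \<le> M \<and> - N \<le> y \<and> y \<le> M \<and> - N \<le> z \<and> z \<le> M)"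
  shows "K M N x y z = 0"
  using assms by (auto simp: K_def iq_neg not_le)

text \<open>One factor of the kernel is expanded by \<open>q_vandermonde_reversed\<close>, whose exponent cancels the cross term
  \<open>- r * s\<close>; the sums over \<open>r\<close> and \<open>s\<close> then decouple.\<close>

theorem bailey_kernel:
  "((\<lambda>(r, s). q powi (r\<^sup>2 - r * s + s\<^sup>2 - (x + y + z) * (r - s)) * iq (M - r) * iq (N - s) * K r s x y z)
     has_sum q powi (- (x * y + y * z + z * x)) * K M N x y z) UNIV"
proof -
  define f where "f = (\<lambda>r s j. q powi (r\<^sup>2 - r * s + s\<^sup>2 - (x + y + z) * (r - s)) * iq (M - r) * iq (N - s) *
     (iq (r - z) * iq (s + z)) * (q powi ((r - j) * (s + x + y - j)) * iq (j - x) * iq (j - y) * iq (r - j) * iq (s + x + y - j)))"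
  define F where "F = (\<lambda>(r, s) j. f r s j)"
  define G where "G = (\<lambda>j. q powi (- (x * y + y * z + z * x)) * (q powi ((j - x) * (j - y)) * iq (j - x) * iq (j - y) * iq (M - j) * iq (N + x + y - j))
     * (iq (M - z) * iq (N + z)))"
  \<comment> \<open>Each of r, s, j is bounded on both sides by factors \<open>iq\<close>, so the
    triple sum is finite and may be taken in any order.\<close>
  have f0: "f r s j = 0" if "\<not> (x \<le> j \<and> j \<le> r \<and> r \<le> M \<and> j - x - y \<le> s \<and> s \<le> N)" for r s j
  proof -
    have "j - x < 0 \<or> r - j < 0 \<or> M - r < 0 \<or> s + x + y - j < 0 \<or> N - s < 0" using that by linarith
    thus ?thesis by (auto simp: f_def iq_neg)
  qed
  have summ: "(\<lambda>(p, j). F p j) summable_on UNIV"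
  proof (rule finite_supp_summable)
    show "finite (({x..M} \<times> {x - x - y..N}) \<times> {x..M})" by auto
    fix p assume p: "p \<notin> ({x..M} \<times> {x - x - y..N}) \<times> {x..M}"
    obtain r s j where [simp]: "p = ((r, s), j)" by (metis prod.exhaust)
    show "(\<lambda>(p, j). F p j) p = 0" using p by (auto simp: F_def intro!: f0)
  qed
  have 1: "(F p has_sum (\<lambda>(r, s). q powi (r\<^sup>2 - r * s + s\<^sup>2 - (x + y + z) * (r - s)) * iq (M - r) * iq (N - s) * K r s x y z) p) UNIV" for p
  proof (cases p)
    case (Pair r s)
    show ?thesis unfolding Pair F_def f_def split K_def
      using has_sum_cmult_right[OF q_vandermonde_reversed[of r s x y], of "q powi (r\<^sup>2 - r * s + s\<^sup>2 - (x + y + z) * (r - s)) * iq (M - r) * iq (N - s) * (iq (r - z) * iq (s + z))"]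
      by (simp add: mult_ac)
  qed
  have 2: "((\<lambda>p. F p j) has_sum G j) UNIV" for j
  proof -
    define c where "c = q powi ((j - x) * (j - y) - (x * y + y * z + z * x)) * iq (j - x) * iq (j - y)"
    define u where "u = (\<lambda>r. q powi ((r - j) * (r - z)) * iq (M - r) * iq (r - j) * iq (r - z))"
    define v where "v = (\<lambda>s. q powi ((s - (j - x - y)) * (s - (- z))) * iq (N - s) * iq (s - (j - x - y)) * iq (s - (- z)))"
    have u: "(u has_sum iq (M - j) * iq (M - z)) UNIV" unfolding u_def by (rule q_vandermonde_limit)
    have v: "(v has_sum iq (N - (j - x - y)) * iq (N - (- z))) UNIV" unfolding v_def by (rule q_vandermonde_limit)
    have e: "f r s j = c * (u r * v s)" for r s
    proof -
      have "(r\<^sup>2 - r * s + s\<^sup>2 - (x + y + z) * (r - s)) + (r - j) * (s + x + y - j)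
         = ((j - x) * (j - y) - (x * y + y * z + z * x)) + ((r - j) * (r - z)) + ((s - (j - x - y)) * (s - (- z)))"
        by (simp add: algebra_simps power2_eq_square)
      hence "q powi (r\<^sup>2 - r * s + s\<^sup>2 - (x + y + z) * (r - s)) * q powi ((r - j) * (s + x + y - j))
         = q powi ((j - x) * (j - y) - (x * y + y * z + z * x)) * q powi ((r - j) * (r - z)) * q powi ((s - (j - x - y)) * (s - (- z)))"
        by (metis qpi_add)
      thus ?thesis unfolding f_def c_def u_def v_def by (simp add: mult_ac add_ac algebra_simps)
    qed
    have s: "(\<lambda>p. F p j) summable_on UNIV"
    proof (rule finite_supp_summable)
      show "finite ({x..M} \<times> {j - x - y..N})" by auto
      fix p assume "p \<notin> {x..M} \<times> {j - x - y..N}"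
      thus "F p j = 0" by (cases p) (auto simp: F_def intro!: f0)
    qed
    then obtain T where T: "((\<lambda>p. F p j) has_sum T) (UNIV \<times> UNIV)" by (auto simp: summable_on_def)
    have "((\<lambda>r. c * u r * (iq (N - (j - x - y)) * iq (N - (- z)))) has_sum T) UNIV"
    proof (rule has_sum_SigmaD[OF T])
      fix r show "((\<lambda>s. F (r, s) j) has_sum c * u r * (iq (N - (j - x - y)) * iq (N - (- z)))) UNIV"
        using has_sum_cmult_right[OF v, of "c * u r"] by (simp add: F_def e mult_ac)
    qed
    moreover have "((\<lambda>r. c * u r * (iq (N - (j - x - y)) * iq (N - (- z)))) has_sum
         c * (iq (M - j) * iq (M - z)) * (iq (N - (j - x - y)) * iq (N - (- z)))) UNIV"
      using has_sum_cmult_right[OF u, of "c * (iq (N - (j - x - y)) * iq (N - (- z)))"] by (simp add: mult_ac)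
    ultimately have "T = c * (iq (M - j) * iq (M - z)) * (iq (N - (j - x - y)) * iq (N - (- z)))"
      using has_sum_unique by blast
    also have "\<dots> = G j" unfolding c_def G_def
      by (simp add: qpi_add[symmetric] mult_ac add_ac algebra_simps)
    finally show ?thesis using T by simp
  qed
  \<comment> \<open>What is left over j is the unreversed sum with (M, N) in place of (r, s); it
    reassembles the kernel.\<close>
  have 3: "(G has_sum q powi (- (x * y + y * z + z * x)) * K M N x y z) UNIV"
    using has_sum_cmult_right[OF q_vandermonde[of x y M N], of "q powi (- (x * y + y * z + z * x)) * (iq (M - z) * iq (N + z))"]
    unfolding G_def K_def by (simp add: mult_ac)
  show ?thesis using has_sum_fubini[OF summ 1 2 3] by (simp add: case_prod_unfold)
qed

end

section \<open>The seed identity and changes of kernel\<close>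

definition alt :: "(complex \<Rightarrow> complex \<Rightarrow> complex \<Rightarrow> complex) \<Rightarrow> complex \<Rightarrow> complex \<Rightarrow> complex \<Rightarrow> complex" where
  "alt P X Y Z = P X Y Z + P Y Z X + P Z X Y - P Y X Z - P X Z Y - P Z Y X"

text \<open>Only monomials with distinct exponents survive antisymmetrisation, and in degree at most
  2 these are the permutations of X^2 Y. The factor is the determinant of the 3 x 3 coefficient
  matrix, and the alternant of X^2 Y is the Vandermonde determinant.\<close>

lemma alt_quadratic:
  "alt (\<lambda>X Y Z. (a0 + a1 * X + a2 * X^2) * (b0 + b1 * Y + b2 * Y^2) * (c0 + c1 * Z + c2 * Z^2)) X Y Z
   = (a2 * (b1 * c0 - b0 * c1) - a1 * (b2 * c0 - b0 * c2) + a0 * (b2 * c1 - b1 * c2)) * alt (\<lambda>X Y Z. X^2 * Y) X Y Z"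
  by (simp add: alt_def algebra_simps power2_eq_square)

text \<open>Each surviving monomial contributes a Schur polynomial times the Vandermonde
  determinant, written in elementary symmetric polynomials; for instance Y^4 Z gives e1^2 - e2 and
  Y^4 Z^3 gives e2^2 - e1 e3. The shape of the first factor is that of the seed polynomial after
  reduction by XYZ = 1.\<close>

lemma alt_cubic:
  "alt (\<lambda>X Y Z. (a0 * X^2 + a1 * X + a2 + a3 * (Y * Z)) * (b0 + b1 * Y + b2 * Y^2 + b3 * Y^3) * (c0 + c1 * Z + c2 * Z^2)) X Y Z
   = ((- a0*b0*c1 + a0*b1*c0 - a0*b3*c1*(X*Y*Z) + a1*b0*c2 - a1*b2*c0 + a1*b3*c2*(X*Y*Z) - a2*b1*c2 + a2*b2*c1 - a3*b0*c1 + a3*b1*c0) * 1 + (- a0*b3*c0 + a2*b3*c2 - a3*b1*c2 + a3*b2*c1) * (X*Y+Y*Z+Z*X) + (- a1*b3*c0 + a2*b3*c1 - a3*b0*c2 + a3*b2*c0) * (X+Y+Z) + (a3*b3*c0) * ((X+Y+Z)^2-(X*Y+Y*Z+Z*X)) + (a3*b3*c1) * ((X+Y+Z)*(X*Y+Y*Z+Z*X)-X*Y*Z) + (a3*b3*c2) * ((X*Y+Y*Z+Z*X)^2-(X+Y+Z)*(X*Y*Z))) * alt (\<lambda>X Y Z. X^2 * Y) X Y Z"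
  unfolding alt_def by algebra

section \<open>The quadratic form of the root lattice and the Weyl group\<close>

definition chi :: "int \<Rightarrow> complex" where
  "chi n = (if n mod 3 = 1 then 1 else if n mod 3 = 2 then - 1 else 0)"

lemma chi_minus: "chi (- n) = - chi n"
proof -
  have "n mod 3 = 0 \<or> n mod 3 = 1 \<or> n mod 3 = 2" by presburger
  moreover have "(- n) mod 3 = (if n mod 3 = 0 then 0 else 3 - n mod 3)" by (simp add: zmod_zminus1_eq_if)
  ultimately show ?thesis by (auto simp: chi_def)
qed

lemma chi_add3: "chi (n + 3 * k) = chi n"
  by (simp add: chi_def)

text \<open>Half the squared length of the vector (\<xi>, \<eta> - \<xi>, - \<eta>). The same form
  is the exponent \<open>halfvCv\<close> of the theorem.\<close>

definition hq :: "int \<Rightarrow> int \<Rightarrow> int" where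
  "hq \<xi> \<eta> = \<xi>\<^sup>2 - \<xi> * \<eta> + \<eta>\<^sup>2"

definition gq :: "int \<Rightarrow> int \<Rightarrow> int" where
  "gq \<xi> \<eta> = (hq \<xi> \<eta> - 1) div 3"

text \<open>The form equals (\<xi> + \<eta>)^2 - 3 \<xi> \<eta>, hence is 1 modulo 3 unless 3
  divides \<xi> + \<eta>; only there is the division in \<open>gq\<close> exact.\<close>

lemma hq_gq: assumes "chi (\<xi> + \<eta>) \<noteq> 0" shows "hq \<xi> \<eta> = 3 * gq \<xi> \<eta> + 1"
proof -
  have "(\<xi> + \<eta>) mod 3 = 1 \<or> (\<xi> + \<eta>) mod 3 = 2" using assms by (auto simp: chi_def split: if_splits)
  then obtain k c where c: "\<xi> + \<eta> = 3 * k + c" "c = 1 \<or> c = 2"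
    by (metis mult_div_mod_eq)
  have "\<xi> = 3 * k + c - \<eta>" using c by simp
  hence "hq \<xi> \<eta> - 1 = 3 * (3 * k\<^sup>2 + 2 * k * c - 3 * k * \<eta> - c * \<eta> + \<eta>\<^sup>2) + (c\<^sup>2 - 1)"
    unfolding hq_def \<open>\<xi> = _\<close> by (simp add: power2_eq_square algebra_simps)
  moreover have "3 dvd (c\<^sup>2 - 1)" using c(2) by auto
  ultimately have "3 dvd (hq \<xi> \<eta> - 1)" by (metis dvd_add dvd_triv_left)
  thus ?thesis by (simp add: gq_def)
qed

text \<open>The index \<open>(\<xi>, \<eta>)\<close> stands for the vector \<open>(\<xi>, \<eta> - \<xi>, - \<eta>)\<close> of the root lattice;
  the two conditions express antisymmetry under the Weyl group.\<close>

definition antisymw :: "(int \<Rightarrow> int \<Rightarrow> complex) \<Rightarrow> bool" where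
  "antisymw w \<longleftrightarrow> (\<forall>\<xi> \<eta>. w (\<eta> - \<xi>) \<eta> = - w \<xi> \<eta> \<and> w (\<eta> - \<xi>) (- \<xi>) = w \<xi> \<eta>)"

lemma antisymw_0: "antisymw w \<Longrightarrow> w 0 0 = 0"
proof -
  assume "antisymw w"
  hence "w (0 - 0) 0 = - w 0 0" unfolding antisymw_def by blast
  thus ?thesis by (simp add: eq_neg_iff_add_eq_0)
qed

lemma hq_sw: "hq (\<eta> - \<xi>) \<eta> = hq \<xi> \<eta>" "hq (\<eta> - \<xi>) (- \<xi>) = hq \<xi> \<eta>"
  by (simp_all add: hq_def power2_eq_square algebra_simps)

lemma chi_sw: "chi ((\<eta> - \<xi>) + \<eta>) = - chi (\<xi> + \<eta>)" "chi ((\<eta> - \<xi>) + - \<xi>) = chi (\<xi> + \<eta>)"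
proof -
  show "chi ((\<eta> - \<xi>) + \<eta>) = - chi (\<xi> + \<eta>)"
    using chi_add3[of "- (\<xi> + \<eta>)" \<eta>] chi_minus[of "\<xi> + \<eta>"] by (simp add: algebra_simps)
  show "chi ((\<eta> - \<xi>) + - \<xi>) = chi (\<xi> + \<eta>)"
    using chi_add3[of "\<xi> + \<eta>" "- \<xi>"] by (simp add: algebra_simps)
qed

lemma bij_swap: "bij (\<lambda>(\<xi>, \<eta>). (\<eta> - \<xi>, \<eta>) :: int \<times> int)"
  by (rule bij_betw_byWitness[where f' = "\<lambda>(\<xi>, \<eta>). (\<eta> - \<xi>, \<eta>)"]) auto

lemma bij_cyc: "bij (\<lambda>(\<xi>, \<eta>). (\<eta> - \<xi>, - \<xi>) :: int \<times> int)"
  by (rule bij_betw_byWitness[where f' = "\<lambda>(\<xi>, \<eta>). (- \<eta>, \<xi> - \<eta>)"]) auto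

section \<open>Lattice sums against antisymmetric weights\<close>

context qbase begin

text \<open>The coefficient after n Bailey steps. Where \<open>chi\<close> is nonzero the exponent
  is n + (3 n + 2) \<open>gq\<close>, so the weight belongs to the Macdonald identity with base q^(3
  n + 2).\<close>

definition cw :: "int \<Rightarrow> int \<Rightarrow> int \<Rightarrow> complex" where
  "cw n \<xi> \<eta> = chi (\<xi> + \<eta>) * q powi (n * hq \<xi> \<eta> + 2 * gq \<xi> \<eta>)"

lemma antisymw_cw: "antisymw (cw n)"
  unfolding antisymw_def cw_def gq_def chi_sw hq_sw by simp

abbreviation KY :: "int \<Rightarrow> int \<Rightarrow> int \<Rightarrow> int \<Rightarrow> complex" where
  "KY M N \<xi> \<eta> \<equiv> K M N \<xi> (\<eta> - \<xi>) (- \<eta>)"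

definition Sm :: "(int \<Rightarrow> int \<Rightarrow> complex) \<Rightarrow> (complex \<Rightarrow> complex \<Rightarrow> complex \<Rightarrow> complex) \<Rightarrow> complex" where
  "Sm \<phi> P = (\<Sum>\<^sub>\<infinity>(\<xi>, \<eta>). \<phi> \<xi> \<eta> * P (q powi \<xi>) (q powi (\<eta> - \<xi>)) (q powi (- \<eta>)))"

definition fsw :: "(int \<Rightarrow> int \<Rightarrow> complex) \<Rightarrow> bool" where
  "fsw \<phi> \<longleftrightarrow> finite {(\<xi>, \<eta>). \<phi> \<xi> \<eta> \<noteq> 0}"

lemma fsw_summable:
  assumes "fsw \<phi>" shows "(\<lambda>(\<xi>, \<eta>). \<phi> \<xi> \<eta> * f \<xi> \<eta>) summable_on UNIV"
  by (rule finite_supp_summable[OF assms[unfolded fsw_def]]) auto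

lemma XYZ: "q powi \<xi> * q powi (\<eta> - \<xi>) * q powi (- \<eta>) = 1"
  by (simp add: qpi_add[symmetric])

lemma Sm_cong:
  assumes "\<And>X Y Z. X * Y * Z = 1 \<Longrightarrow> P X Y Z = P' X Y Z" shows "Sm \<phi> P = Sm \<phi> P'"
  unfolding Sm_def using assms[OF XYZ] by simp

lemma Sm_cmult: "Sm \<phi> (\<lambda>X Y Z. c * P X Y Z) = c * Sm \<phi> P"
proof -
  have "Sm \<phi> (\<lambda>X Y Z. c * P X Y Z) = (\<Sum>\<^sub>\<infinity>p. c * (case p of (\<xi>, \<eta>) \<Rightarrow> \<phi> \<xi> \<eta> * P (q powi \<xi>) (q powi (\<eta> - \<xi>)) (q powi (- \<eta>))))"
    unfolding Sm_def by (intro infsum_cong) (auto simp: mult_ac)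
  thus ?thesis by (simp add: infsum_cmult_right' Sm_def)
qed

lemma Sm_add:
  assumes "fsw \<phi>" shows "Sm \<phi> (\<lambda>X Y Z. P X Y Z + P' X Y Z) = Sm \<phi> P + Sm \<phi> P'"
proof -
  have "Sm \<phi> (\<lambda>X Y Z. P X Y Z + P' X Y Z) = (\<Sum>\<^sub>\<infinity>p. (case p of (\<xi>, \<eta>) \<Rightarrow> \<phi> \<xi> \<eta> * P (q powi \<xi>) (q powi (\<eta> - \<xi>)) (q powi (- \<eta>)))
     + (case p of (\<xi>, \<eta>) \<Rightarrow> \<phi> \<xi> \<eta> * P' (q powi \<xi>) (q powi (\<eta> - \<xi>)) (q powi (- \<eta>))))"
    unfolding Sm_def by (intro infsum_cong) (auto simp: algebra_simps)
  thus ?thesis unfolding Sm_def by (simp add: infsum_add fsw_summable[OF assms])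
qed

lemma Sm_cyc: assumes "antisymw \<phi>" shows "Sm \<phi> (\<lambda>X Y Z. P Y Z X) = Sm \<phi> P"
proof -
  have "Sm \<phi> P = (\<Sum>\<^sub>\<infinity>p. (\<lambda>(\<xi>, \<eta>). \<phi> \<xi> \<eta> * P (q powi \<xi>) (q powi (\<eta> - \<xi>)) (q powi (- \<eta>))) ((\<lambda>(\<xi>, \<eta>). (\<eta> - \<xi>, - \<xi>)) p))"
    unfolding Sm_def by (rule infsum_reindex_bij_betw[OF bij_cyc, symmetric])
  also have "\<dots> = Sm \<phi> (\<lambda>X Y Z. P Y Z X)"
    unfolding Sm_def using assms by (intro infsum_cong) (auto simp: antisymw_def)
  finally show ?thesis by simp
qed

lemma Sm_swap: assumes "antisymw \<phi>" shows "Sm \<phi> (\<lambda>X Y Z. P Y X Z) = - Sm \<phi> P"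
proof -
  have "Sm \<phi> P = (\<Sum>\<^sub>\<infinity>p. (\<lambda>(\<xi>, \<eta>). \<phi> \<xi> \<eta> * P (q powi \<xi>) (q powi (\<eta> - \<xi>)) (q powi (- \<eta>))) ((\<lambda>(\<xi>, \<eta>). (\<eta> - \<xi>, \<eta>)) p))"
    unfolding Sm_def by (rule infsum_reindex_bij_betw[OF bij_swap, symmetric])
  also have "\<dots> = (\<Sum>\<^sub>\<infinity>p. - (case p of (\<xi>, \<eta>) \<Rightarrow> \<phi> \<xi> \<eta> * P (q powi (\<eta> - \<xi>)) (q powi \<xi>) (q powi (- \<eta>))))"
    using assms by (intro infsum_cong) (auto simp: antisymw_def)
  also have "\<dots> = - Sm \<phi> (\<lambda>X Y Z. P Y X Z)"
    unfolding Sm_def by (simp add: infsum_uminus)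
  finally show ?thesis by simp
qed

lemma Sm_alt: assumes "antisymw \<phi>" "fsw \<phi>" shows "Sm \<phi> (alt P) = 6 * Sm \<phi> P"
proof -
  have m: "Sm \<phi> (\<lambda>X Y Z. - f X Y Z) = - Sm \<phi> f" for f
    using Sm_cmult[of \<phi> "- 1" f] by simp
  have 1: "Sm \<phi> (\<lambda>X Y Z. P Y Z X) = Sm \<phi> P" by (rule Sm_cyc[OF assms(1)])
  have 2: "Sm \<phi> (\<lambda>X Y Z. P Z X Y) = Sm \<phi> P"
    using Sm_cyc[OF assms(1), of "\<lambda>X Y Z. P Y Z X"] 1 by simp
  have 3: "Sm \<phi> (\<lambda>X Y Z. P Y X Z) = - Sm \<phi> P" by (rule Sm_swap[OF assms(1)])
  have 4: "Sm \<phi> (\<lambda>X Y Z. P X Z Y) = - Sm \<phi> P"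
    using Sm_swap[OF assms(1), of "\<lambda>X Y Z. P Y Z X"] 1 by simp
  have 5: "Sm \<phi> (\<lambda>X Y Z. P Z Y X) = - Sm \<phi> P"
    using Sm_swap[OF assms(1), of "\<lambda>X Y Z. P Z X Y"] 2 by simp
  have "Sm \<phi> (alt P) = Sm \<phi> (\<lambda>X Y Z. P X Y Z + P Y Z X + P Z X Y + - P Y X Z + - P X Z Y + - P Z Y X)"
    by (rule Sm_cong) (simp add: alt_def)
  thus ?thesis by (simp only: Sm_add[OF assms(2)] m 1 2 3 4 5) simp
qed

text \<open>An antisymmetric weight sees only the antisymmetric part of the polynomial, so
  identities between lattice sums reduce to identities between alternants, to be checked on XYZ = 1
  only.\<close>

lemma Sm_alt_eq:
  assumes "antisymw \<phi>" "fsw \<phi>" "\<And>X Y Z. X * Y * Z = 1 \<Longrightarrow> alt P X Y Z = c * alt P' X Y Z"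
  shows "Sm \<phi> P = c * Sm \<phi> P'"
proof -
  have "Sm \<phi> (alt P) = Sm \<phi> (\<lambda>X Y Z. c * alt P' X Y Z)" by (rule Sm_cong) (rule assms(3))
  thus ?thesis by (simp add: Sm_alt assms(1,2) Sm_cmult)
qed

lemma antisymw_K: assumes "antisymw w" shows "antisymw (\<lambda>\<xi> \<eta>. w \<xi> \<eta> * KY M N \<xi> \<eta>)"
proof -
  have "KY M N (\<eta> - \<xi>) \<eta> = KY M N \<xi> \<eta>" "KY M N (\<eta> - \<xi>) (- \<xi>) = KY M N \<xi> \<eta>" for \<xi> \<eta>
    by (simp_all add: K_def mult_ac)
  thus ?thesis using assms unfolding antisymw_def by simp
qed

lemma K_supp: assumes "KY M N \<xi> \<eta> \<noteq> 0" shows "\<xi> \<in> {- N..M}" "\<eta> \<in> {- M..N}" "\<eta> - \<xi> \<in> {- N..M}"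
proof -
  have "- N \<le> \<xi> \<and> \<xi> \<le> M \<and> - N \<le> \<eta> - \<xi> \<and> \<eta> - \<xi> \<le> M \<and> - N \<le> - \<eta> \<and> - \<eta> \<le> M"
    using K_0[of N \<xi> M "\<eta> - \<xi>" "- \<eta>"] assms by blast
  thus "\<xi> \<in> {- N..M}" "\<eta> \<in> {- M..N}" "\<eta> - \<xi> \<in> {- N..M}" by auto
qed

lemma fsw_K: "fsw (\<lambda>\<xi> \<eta>. w \<xi> \<eta> * KY M N \<xi> \<eta>)"
  unfolding fsw_def
  by (rule finite_subset[of _ "{- N..M} \<times> {- M..N}"]) (use K_supp in fastforce)+

lemma KY_eq_0: assumes "antisymw w" "M + N \<le> 0" shows "w \<xi> \<eta> * KY M N \<xi> \<eta> = 0"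
proof (cases "KY M N \<xi> \<eta> = 0")
  case False
  have "\<xi> = 0 \<and> \<eta> = 0" using K_supp[OF False] assms(2) by auto
  thus ?thesis using antisymw_0[OF assms(1)] by simp
qed simp

section \<open>Lowering the kernel and the seed identity\<close>

lemma iq_down: "iq (m - 1 - x) = (1 - q powi m * q powi (- x)) * iq (m - x)"
proof -
  have "q powi m * q powi (- x) = q powi (m - x)" by (simp add: qpi_add[symmetric])
  moreover have "m - 1 - x = m - x - 1" by simp
  ultimately show ?thesis using iq_pred[of "m - x"] by metis
qed

lemma iq_down': "iq (m - 1 + x) = (1 - q powi m * q powi x) * iq (m + x)"
  using iq_down[of m "- x"] by simp

text \<open>The factor that lowers M is symmetric in X, Y, Z. It can therefore be taken out of an
  alternant, which is how a recurrence in (M, N) is read off.\<close>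

lemma K_down1:
  assumes "M + N \<ge> 1" "X * Y * Z = 1" "X = q powi x" "Y = q powi y" "Z = q powi z"
  shows "K M N x y z * ((1 - q powi M * (Y * Z)) * (1 - q powi M * (X * Z)) * (1 - q powi M * (X * Y)))
    = (1 - q powi (M + N)) * K (M - 1) N x y z"
proof -
  have i: "q powi (- x) = Y * Z" "q powi (- y) = X * Z" "q powi (- z) = X * Y"
    using assms(2-5) q_nz by (auto simp: power_int_minus field_simps)
  have "fq (M + N) = (1 - q powi (M + N)) * fq (M - 1 + N)" using fq_rec[OF assms(1)] by (simp add: algebra_simps)
  thus ?thesis unfolding K_def by (simp add: iq_down i mult_ac)
qed

lemma K_down2:
  assumes "M + N \<ge> 1" "X = q powi x" "Y = q powi y" "Z = q powi z"
  shows "K M N x y z * ((1 - q powi N * X) * (1 - q powi N * Y) * (1 - q powi N * Z))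
    = (1 - q powi (M + N)) * K M (N - 1) x y z"
proof -
  have "fq (M + N) = (1 - q powi (M + N)) * fq (M + (N - 1))" using fq_rec[OF assms(1)] by (simp add: algebra_simps)
  thus ?thesis unfolding K_def by (simp add: iq_down' assms(2-) mult_ac)
qed

text \<open>The reflection behind the next lemma is \<open>y \<mapsto> (y\<^sub>2 - 3, y\<^sub>1 + 3, y\<^sub>3)\<close>.\<close>

lemma seed_relation:
  fixes f :: "complex \<Rightarrow> complex" and M N :: int
  defines "a \<equiv> q powi M" and "b \<equiv> q powi N" and "p \<equiv> q powi (- 1)"
  shows "Sm (\<lambda>\<xi> \<eta>. cw 0 \<xi> \<eta> * KY M N \<xi> \<eta>)
    (\<lambda>X Y Z. (X - a) * (X - a * p) * (1 - a * p^2 * (Y * Z)) * ((1 - b * Y) * (1 - b * p * Y) * (1 - b * p^2 * Y)) * f Z) = 0"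
    (is "Sm ?\<phi> ?P = 0")
proof -
  \<comment> \<open>The polynomial replaces \<open>iq (M - \<xi>)\<close> by
    \<open>iq (M - 3 - \<xi>)\<close> and \<open>iq (N + (\<eta> - \<xi>))\<close> by
    \<open>iq (N - 3 + (\<eta> - \<xi>))\<close>; the offsets 3 are those of the reflection, which
    then only permutes the denominators. The third coordinate is fixed, hence the free factor
    \<open>f Z\<close>.\<close>
  define T where "T = (\<lambda>(\<xi>, \<eta>). chi (\<xi> + \<eta>) * q powi (2 * gq \<xi> \<eta> + 2 * \<xi>) * fq (M + N) *
     (iq (M - 3 - \<xi>) * iq (N + \<xi>)) * (iq (M - (\<eta> - \<xi>)) * iq (N - 3 + (\<eta> - \<xi>))) * (iq (M + \<eta>) * iq (N - \<eta>)) * f (q powi (- \<eta>)))"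
  have pn: "p^2 = q powi (- 2)" "p = q powi (- 1)"
    unfolding p_def by (simp_all add: power_int_def field_simps)
  have q2: "q powi (M - 2) = a * p^2" "q powi (N - 2) = b * p^2"
    unfolding a_def b_def pn(1) using qpi_add[of M "- 2"] qpi_add[of N "- 2"] by simp_all
  have q1: "q powi (M - 1) = a * p" "q powi (N - 1) = b * p"
    unfolding a_def b_def p_def using qpi_add[of M "- 1"] qpi_add[of N "- 1"] by simp_all
  have "Sm ?\<phi> ?P = infsum T UNIV" unfolding Sm_def
  proof (intro infsum_cong, clarify)
    fix \<xi> \<eta>
    define X where "X = q powi \<xi>"
    define Y where "Y = q powi (\<eta> - \<xi>)"
    define Z where "Z = q powi (- \<eta>)"
    have iX: "q powi (- \<xi>) = Y * Z" unfolding Y_def Z_def by (simp add: qpi_add[symmetric])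
    have xyz: "X * (Y * Z) = 1" unfolding X_def Y_def Z_def by (simp add: qpi_add[symmetric])
    have u: "iq (M - 3 - \<xi>) = (1 - a * p^2 * (Y * Z)) * (1 - a * p * (Y * Z)) * (1 - a * (Y * Z)) * iq (M - \<xi>)"
    proof -
      have "iq (M - 3 - \<xi>) = (1 - q powi (M - 2) * (Y * Z)) * (1 - q powi (M - 1) * (Y * Z)) * (1 - q powi M * (Y * Z)) * iq (M - \<xi>)"
        using iq_down[of "M - 2" \<xi>] iq_down[of "M - 1" \<xi>] iq_down[of M \<xi>] by (simp add: iX)
      thus ?thesis unfolding q2 q1 a_def[symmetric] .
    qed
    have v: "iq (N - 3 + (\<eta> - \<xi>)) = (1 - b * p^2 * Y) * (1 - b * p * Y) * (1 - b * Y) * iq (N + (\<eta> - \<xi>))"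
    proof -
      have "iq (N - 3 + (\<eta> - \<xi>)) = (1 - q powi (N - 2) * Y) * (1 - q powi (N - 1) * Y) * (1 - q powi N * Y) * iq (N + (\<eta> - \<xi>))"
        using iq_down'[of "N - 2" "\<eta> - \<xi>"] iq_down'[of "N - 1" "\<eta> - \<xi>"] iq_down'[of N "\<eta> - \<xi>"] by (simp add: Y_def)
      thus ?thesis unfolding q2 q1 b_def[symmetric] .
    qed
    have w: "(X - a) * (X - a * p) = X^2 * ((1 - a * p * (Y * Z)) * (1 - a * (Y * Z)))"
    proof -
      have "X^2 * ((1 - a * p * (Y * Z)) * (1 - a * (Y * Z))) = (X - a * (X * (Y * Z))) * (X - a * p * (X * (Y * Z)))"
        by (simp add: algebra_simps power2_eq_square)
      thus ?thesis by (simp add: xyz)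
    qed
    have x2: "q powi (2 * gq \<xi> \<eta> + 2 * \<xi>) = q powi (2 * gq \<xi> \<eta>) * X^2"
      by (simp only: qpi_add X_def power2_eq_square mult_2 mult.assoc)
    show "?\<phi> \<xi> \<eta> * ?P (q powi \<xi>) (q powi (\<eta> - \<xi>)) (q powi (- \<eta>)) = T (\<xi>, \<eta>)"
      unfolding X_def[symmetric] Y_def[symmetric] Z_def[symmetric] T_def split u v x2 w cw_def K_def
        mult_zero_left add_0 diff_minus_eq_add add_uminus_conv_diff
      by (simp only: mult_ac)
  qed
  also have "infsum T UNIV = 0"
  proof -
    have bij: "bij (\<lambda>(\<xi>, \<eta>). (\<eta> - \<xi> - 3, \<eta>) :: int \<times> int)"
      by (rule bij_betw_byWitness[where f' = "\<lambda>(\<xi>, \<eta>). (\<eta> - \<xi> - 3, \<eta>)"]) auto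
    have "infsum T UNIV = (\<Sum>\<^sub>\<infinity>p. T ((\<lambda>(\<xi>, \<eta>). (\<eta> - \<xi> - 3, \<eta>)) p))"
      by (rule infsum_reindex_bij_betw[OF bij, symmetric])
    also have "\<dots> = (\<Sum>\<^sub>\<infinity>p. - T p)"
    proof (intro infsum_cong, clarify)
      fix \<xi> \<eta> :: int
      have c: "chi ((\<eta> - \<xi> - 3) + \<eta>) = - chi (\<xi> + \<eta>)"
        using chi_add3[of "- (\<xi> + \<eta>)" "\<eta> - 1"] chi_minus[of "\<xi> + \<eta>"] by (simp add: algebra_simps)
      \<comment> \<open>The change of 2 \<open>gq\<close> under the reflection is compensated by
        that of the linear exponent 2 \<xi>, which is the X^2 hidden in (X - a)(X - a p).\<close>
      have "hq (\<eta> - \<xi> - 3) \<eta> - 1 = (hq \<xi> \<eta> - 1) + 3 * (2 * \<xi> - \<eta> + 3)"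
        by (simp add: hq_def power2_eq_square algebra_simps)
      hence g: "gq (\<eta> - \<xi> - 3) \<eta> = gq \<xi> \<eta> + (2 * \<xi> - \<eta> + 3)" unfolding gq_def by simp
      have e: "2 * gq (\<eta> - \<xi> - 3) \<eta> + 2 * (\<eta> - \<xi> - 3) = 2 * gq \<xi> \<eta> + 2 * \<xi>" unfolding g by simp
      have i: "M - 3 - (\<eta> - \<xi> - 3) = M - (\<eta> - \<xi>)" "N + (\<eta> - \<xi> - 3) = N - 3 + (\<eta> - \<xi>)"
        "M - (\<eta> - (\<eta> - \<xi> - 3)) = M - 3 - \<xi>" "N - 3 + (\<eta> - (\<eta> - \<xi> - 3)) = N + \<xi>" by simp_all
      show "T (\<eta> - \<xi> - 3, \<eta>) = - T (\<xi>, \<eta>)" unfolding T_def split c e i by (simp only: mult_ac mult_minus_left mult_minus_right)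
    qed
    finally show ?thesis by (simp add: infsum_uminus eq_neg_iff_add_eq_0)
  qed
  finally show ?thesis .
qed

definition Sd :: "int \<Rightarrow> int \<Rightarrow> complex" where
  "Sd M N = Sm (\<lambda>\<xi> \<eta>. cw 0 \<xi> \<eta> * KY M N \<xi> \<eta>) (\<lambda>X Y Z. X^2 * Y)"

lemma Sm_K_cong:
  assumes "\<And>\<xi> \<eta> X Y Z. X = q powi \<xi> \<Longrightarrow> Y = q powi (\<eta> - \<xi>) \<Longrightarrow> Z = q powi (- \<eta>) \<Longrightarrow> X * Y * Z = 1 \<Longrightarrow>
     KY M N \<xi> \<eta> * F X Y Z = c * KY M' N' \<xi> \<eta>"
  shows "Sm (\<lambda>\<xi> \<eta>. w \<xi> \<eta> * KY M N \<xi> \<eta>) (\<lambda>X Y Z. F X Y Z * P X Y Z) = c * Sm (\<lambda>\<xi> \<eta>. w \<xi> \<eta> * KY M' N' \<xi> \<eta>) P"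
proof -
  have "Sm (\<lambda>\<xi> \<eta>. w \<xi> \<eta> * KY M N \<xi> \<eta>) (\<lambda>X Y Z. F X Y Z * P X Y Z) = Sm (\<lambda>\<xi> \<eta>. w \<xi> \<eta> * KY M' N' \<xi> \<eta>) (\<lambda>X Y Z. c * P X Y Z)"
    unfolding Sm_def
  proof (intro infsum_cong, clarify)
    fix \<xi> \<eta>
    show "w \<xi> \<eta> * KY M N \<xi> \<eta> * (F (q powi \<xi>) (q powi (\<eta> - \<xi>)) (q powi (- \<eta>)) * P (q powi \<xi>) (q powi (\<eta> - \<xi>)) (q powi (- \<eta>)))
      = w \<xi> \<eta> * KY M' N' \<xi> \<eta> * (c * P (q powi \<xi>) (q powi (\<eta> - \<xi>)) (q powi (- \<eta>)))"
      using assms[OF refl refl refl XYZ, of \<xi> \<eta>] by (simp add: mult_ac)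
  qed
  thus ?thesis by (simp add: Sm_cmult)
qed

text \<open>\<open>seed_relation\<close> says that a certain sum vanishes. For a suitable
  \<open>f\<close> its alternant is the Vandermonde determinant times a combination of 1,
  \<open>Pa\<close>, \<open>Pb\<close> and \<open>Pa * Pb\<close>; here \<open>Pa\<close> lowers M
  and \<open>Pb\<close> lowers N, so the four terms of the recurrence correspond to these four
  factors.\<close>

lemma Sd_recurrence:
  fixes M N :: int
  defines "a \<equiv> q powi M" and "b \<equiv> q powi N" and "p \<equiv> q powi (- 1)"
  defines "t \<equiv> a * b"
  assumes MN: "M + N \<ge> 2"
  shows "t^2 * p^6 * (1 - t) * (1 - t * p) * Sd (M - 1) (N - 1)
    + b^3 * p^3 * (p * t - 1) * (p^2 * t - 1) * (1 - t) * Sd (M - 1) N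
    + a^3 * p^3 * (p * t - 1) * (p^2 * t - 1) * (1 - t) * Sd M (N - 1)
    + (t - 1) * (p * t - 1)^2 * (p^2 * t - 1)^2 * Sd M N = 0"
proof -
  define \<phi> where "\<phi> = (\<lambda>\<xi> \<eta>. cw 0 \<xi> \<eta> * KY M N \<xi> \<eta>)"
  have as: "antisymw \<phi>" unfolding \<phi>_def by (rule antisymw_K[OF antisymw_cw])
  have fs: "fsw \<phi>" unfolding \<phi>_def by (rule fsw_K)
  define Pa where "Pa = (\<lambda>X Y Z. (1 - a * (Y * Z)) * (1 - a * (X * Z)) * (1 - a * (X * Y)))"
  define Pb where "Pb = (\<lambda>X Y Z. (1 - b * X) * (1 - b * Y) * (1 - b * Z))"
  define V where "V = (\<lambda>(X :: complex) (Y :: complex) (Z :: complex). X^2 * Y)"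
  \<comment> \<open>The free function of \<open>seed_relation\<close> is (Z - a)(1 - b Z). On XYZ =
    1 the first factor is Z (1 - a XY), so it too is made of lowering factors.\<close>
  define P where "P = (\<lambda>X Y Z. (X - a) * (X - a * p) * (1 - a * p^2 * (Y * Z)) * ((1 - b * Y) * (1 - b * p * Y) * (1 - b * p^2 * Y)) * ((Z - a) * (1 - b * Z)))"
  define S where "S = (\<lambda>X Y Z. t^2 * p^6 * (Pa X Y Z * Pb X Y Z) + b^3 * p^3 * (p * t - 1) * (p^2 * t - 1) * Pa X Y Z
      + a^3 * p^3 * (p * t - 1) * (p^2 * t - 1) * Pb X Y Z + (t - 1) * (p * t - 1)^2 * (p^2 * t - 1)^2)"
  have 0: "Sm \<phi> P = 0"
    unfolding \<phi>_def P_def a_def b_def p_def by (rule seed_relation)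
  have 1: "Sm \<phi> P = 1 * Sm \<phi> (\<lambda>X Y Z. S X Y Z * V X Y Z)"
  proof (rule Sm_alt_eq[OF as fs])
    fix X Y Z :: complex assume xyz: "X * Y * Z = 1"
    define e1 e2 where "e1 = X + Y + Z" and "e2 = X * Y + Y * Z + Z * X"
    define a1 a2 a3 b1 b2 b3 c1 where abc: "a1 = - a * (1 + p)" "a2 = a^2 * p" "a3 = - (a^3 * p^3)" "b1 = - (b * (1 + p + p^2))"
      "b2 = b^2 * p * (1 + p + p^2)" "b3 = - (b^3 * p^3)" "c1 = 1 + a * b"
    \<comment> \<open>The relation X (YZ) = 1 removes the mixed terms apart from YZ itself, which
      brings the product into the form required by \<open>alt_cubic\<close>.\<close>
    have P': "P X Y Z = (1 * X^2 + (a1 - a * p^2) * X + (a2 + a^2 * p^2 * (1 + p)) + a3 * (Y * Z)) * (1 + b1 * Y + b2 * Y^2 + b3 * Y^3) * (- a + c1 * Z + - b * Z^2)"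
       if "X * Y * Z = 1" for X Y Z
    proof -
      have e: "X * (Y * Z) = 1" using that by (simp add: mult.assoc)
      have "(X - a) * (X - a * p) * (1 - a * p^2 * (Y * Z)) = (X - a) * (X - a * p) - a * p^2 * (X * (X * (Y * Z)) - (a + a * p) * (X * (Y * Z)) + a^2 * p * (Y * Z))"
        by (simp add: algebra_simps power2_eq_square)
      also have "\<dots> = 1 * X^2 + (a1 - a * p^2) * X + (a2 + a^2 * p^2 * (1 + p)) + a3 * (Y * Z)"
        unfolding e abc by (simp add: algebra_simps power2_eq_square power3_eq_cube)
      finally have 1: "(X - a) * (X - a * p) * (1 - a * p^2 * (Y * Z)) = 1 * X^2 + (a1 - a * p^2) * X + (a2 + a^2 * p^2 * (1 + p)) + a3 * (Y * Z)" .
      have 2: "(1 - b * Y) * (1 - b * p * Y) * (1 - b * p^2 * Y) = 1 + b1 * Y + b2 * Y^2 + b3 * Y^3"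
        unfolding abc by (simp add: algebra_simps power2_eq_square power3_eq_cube)
      have 3: "(Z - a) * (1 - b * Z) = - a + c1 * Z + - b * Z^2"
        unfolding abc by (simp add: algebra_simps power2_eq_square)
      show ?thesis unfolding P_def 1 2 3 by simp
    qed
    have S': "S x y z = t^2 * p^6 * ((1 - a * e2 + a^2 * e1 - a^3) * (1 - b * e1 + b^2 * e2 - b^3)) + b^3 * p^3 * (p * t - 1) * (p^2 * t - 1) * (1 - a * e2 + a^2 * e1 - a^3)
      + a^3 * p^3 * (p * t - 1) * (p^2 * t - 1) * (1 - b * e1 + b^2 * e2 - b^3) + (t - 1) * (p * t - 1)^2 * (p^2 * t - 1)^2"
      if "x * y * z = 1" "x + y + z = e1" "x * y + y * z + z * x = e2" for x y z
    proof -
      have "Pa x y z = 1 - a * (x * y + y * z + z * x) + a^2 * ((x * y * z) * (x + y + z)) - a^3 * (x * y * z)^2"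
        unfolding Pa_def by (simp add: algebra_simps power2_eq_square power3_eq_cube)
      moreover have "Pb x y z = 1 - b * (x + y + z) + b^2 * (x * y + y * z + z * x) - b^3 * (x * y * z)"
        unfolding Pb_def by (simp add: algebra_simps power2_eq_square power3_eq_cube)
      ultimately show ?thesis unfolding S_def that by simp
    qed
    define s where "s = t^2 * p^6 * ((1 - a * e2 + a^2 * e1 - a^3) * (1 - b * e1 + b^2 * e2 - b^3)) + b^3 * p^3 * (p * t - 1) * (p^2 * t - 1) * (1 - a * e2 + a^2 * e1 - a^3)
      + a^3 * p^3 * (p * t - 1) * (p^2 * t - 1) * (1 - b * e1 + b^2 * e2 - b^3) + (t - 1) * (p * t - 1)^2 * (p^2 * t - 1)^2"
    have Ss: "S X Y Z = s" "S Y Z X = s" "S Z X Y = s" "S Y X Z = s" "S X Z Y = s" "S Z Y X = s"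
      unfolding s_def by (intro S'; use xyz in \<open>simp add: e1_def e2_def algebra_simps\<close>)+
    have "alt (\<lambda>X Y Z. S X Y Z * V X Y Z) X Y Z = s * alt V X Y Z"
      unfolding alt_def Ss by (simp add: algebra_simps)
    \<comment> \<open>Both sides are now polynomials in a, b, p, e1, e2 times the same determinant;
      the four coefficients in \<open>S\<close> make these polynomials equal.\<close>
    moreover have "alt P X Y Z = s * alt V X Y Z"
    proof -
      have "alt P X Y Z = alt (\<lambda>X Y Z. (1 * X^2 + (a1 - a * p^2) * X + (a2 + a^2 * p^2 * (1 + p)) + a3 * (Y * Z)) * (1 + b1 * Y + b2 * Y^2 + b3 * Y^3) * (- a + c1 * Z + - b * Z^2)) X Y Z"
      proof -
        have "X * Y * Z = 1" "Y * Z * X = 1" "Z * X * Y = 1" "Y * X * Z = 1" "X * Z * Y = 1" "Z * Y * X = 1"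
          using xyz by (simp_all add: mult_ac)
        from this[THEN P'] show ?thesis unfolding alt_def by (simp only:)
      qed
      also have "\<dots> = s * alt V X Y Z"
        unfolding alt_cubic xyz e1_def[symmetric] e2_def[symmetric] V_def s_def t_def abc
        by algebra
      finally show ?thesis .
    qed
    ultimately show "alt P X Y Z = 1 * alt (\<lambda>X Y Z. S X Y Z * V X Y Z) X Y Z" by simp
  qed
  have A: "Sm \<phi> (\<lambda>X Y Z. Pa X Y Z * V X Y Z) = (1 - t) * Sd (M - 1) N"
    unfolding \<phi>_def Sd_def V_def Pa_def
    by (rule Sm_K_cong) (use MN in \<open>simp add: K_down1 a_def b_def t_def qpi_add\<close>)
  have B: "Sm \<phi> (\<lambda>X Y Z. Pb X Y Z * V X Y Z) = (1 - t) * Sd M (N - 1)"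
    unfolding \<phi>_def Sd_def V_def Pb_def
    by (rule Sm_K_cong) (use MN in \<open>simp add: K_down2 a_def b_def t_def qpi_add\<close>)
  \<comment> \<open>\<open>Pa\<close> and \<open>Pb\<close> are absorbed one after the other. The
    second absorption starts at (M - 1, N) and needs M - 1 + N >= 1, which is where M + N >= 2
    enters.\<close>
  have "Sm \<phi> (\<lambda>X Y Z. Pa X Y Z * (Pb X Y Z * V X Y Z)) = (1 - t) * Sm (\<lambda>\<xi> \<eta>. cw 0 \<xi> \<eta> * KY (M - 1) N \<xi> \<eta>) (\<lambda>X Y Z. Pb X Y Z * V X Y Z)"
    unfolding \<phi>_def Pa_def
    by (rule Sm_K_cong) (use MN in \<open>simp add: K_down1 a_def b_def t_def qpi_add\<close>)
  also have "Sm (\<lambda>\<xi> \<eta>. cw 0 \<xi> \<eta> * KY (M - 1) N \<xi> \<eta>) (\<lambda>X Y Z. Pb X Y Z * V X Y Z) = (1 - t * p) * Sd (M - 1) (N - 1)"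
  proof -
    have "M - 1 + N = M + N + - 1" by simp
    hence "t * p = q powi (M - 1 + N)" unfolding a_def b_def t_def p_def by (simp only: qpi_add)
    thus ?thesis unfolding Sd_def V_def Pb_def
      by (intro Sm_K_cong) (use MN in \<open>simp add: K_down2 b_def\<close>)
  qed
  finally have C: "Sm \<phi> (\<lambda>X Y Z. Pa X Y Z * (Pb X Y Z * V X Y Z)) = (1 - t) * ((1 - t * p) * Sd (M - 1) (N - 1))" .
  have D: "Sm \<phi> V = Sd M N" by (simp add: \<phi>_def V_def Sd_def)
  have "Sm \<phi> (\<lambda>X Y Z. S X Y Z * V X Y Z) = Sm \<phi> (\<lambda>X Y Z. (t^2 * p^6) * (Pa X Y Z * (Pb X Y Z * V X Y Z)) + (b^3 * p^3 * (p * t - 1) * (p^2 * t - 1)) * (Pa X Y Z * V X Y Z)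
      + (a^3 * p^3 * (p * t - 1) * (p^2 * t - 1)) * (Pb X Y Z * V X Y Z) + ((t - 1) * (p * t - 1)^2 * (p^2 * t - 1)^2) * V X Y Z)"
    unfolding S_def by (simp only: distrib_right mult.assoc)
  also have "\<dots> = (t^2 * p^6) * ((1 - t) * ((1 - t * p) * Sd (M - 1) (N - 1))) + (b^3 * p^3 * (p * t - 1) * (p^2 * t - 1)) * ((1 - t) * Sd (M - 1) N)
      + (a^3 * p^3 * (p * t - 1) * (p^2 * t - 1)) * ((1 - t) * Sd M (N - 1)) + ((t - 1) * (p * t - 1)^2 * (p^2 * t - 1)^2) * Sd M N"
    unfolding Sm_add[OF fs] Sm_cmult A B C D ..
  finally have E: "Sm \<phi> (\<lambda>X Y Z. S X Y Z * V X Y Z) = \<dots>" .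
  have "Sm \<phi> (\<lambda>X Y Z. S X Y Z * V X Y Z) = 0" using 0 1 by simp
  from E[unfolded this, symmetric] show ?thesis by (simp only: mult.assoc)
qed

lemma Sd_0: assumes "M \<le> 0 \<or> N \<le> 0" shows "Sd M N = 0"
proof -
  have "cw 0 \<xi> \<eta> * KY M N \<xi> \<eta> = 0" for \<xi> \<eta>
  proof (cases "KY M N \<xi> \<eta> = 0")
    case False
    have "\<xi> = 0 \<and> \<eta> = 0" using K_supp[OF False] assms by auto
    thus ?thesis using antisymw_0[OF antisymw_cw] by simp
  qed simp
  thus ?thesis unfolding Sd_def Sm_def by (intro infsum_0) auto
qed

text \<open>At M + N = 2 one has p^2 t = 1 and the coefficient of \<open>Sd M N\<close> in the
  recurrence vanishes, so this value has to be computed directly.\<close>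

lemma Sd_1: "Sd 1 1 = q powi (- 2) * iq 1"
proof -
  define T where "T = (\<lambda>(\<xi>, \<eta>). cw 0 \<xi> \<eta> * KY 1 1 \<xi> \<eta> * ((q powi \<xi>)^2 * q powi (\<eta> - \<xi>)))"
  \<comment> \<open>The support of the kernel consists of the origin, where the weight is 0, and the
    six roots.\<close>
  have "(T has_sum sum T {(1,1), (-1,-1), (1,0), (0,1), (0,-1), (-1,0)}) UNIV"
  proof (rule has_sum_finite_neutralI)
    fix p assume p: "p \<in> UNIV - {(1::int,1::int), (-1,-1), (1,0), (0,1), (0,-1), (-1,0)}"
    obtain \<xi> \<eta> where [simp]: "p = (\<xi>, \<eta>)" by (cases p)
    show "T p = 0"
    proof (cases "KY 1 1 \<xi> \<eta> = 0")
      case False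
      have "\<xi> \<in> {-1, 0, 1} \<and> \<eta> \<in> {-1, 0, 1} \<and> \<eta> - \<xi> \<in> {-1, 0, 1}" using K_supp[OF False] by auto
      hence "\<xi> = 0 \<and> \<eta> = 0" using p by auto
      thus ?thesis using antisymw_0[OF antisymw_cw] by (simp add: T_def)
    qed (simp add: T_def)
  qed auto
  hence "Sd 1 1 = sum T {(1,1), (-1,-1), (1,0), (0,1), (0,-1), (-1,0)}"
    by (simp add: Sd_def Sm_def T_def infsumI)
  also have "\<dots> = (1 / q^2 - q^2 + 2 * q - 2 / q) * (iq 1)^2 * (fq 2 * iq 2) * iq 2"
    using q_nz by (simp add: T_def cw_def chi_def gq_def hq_def K_def iq_0 power_int_minus field_simps power2_eq_square)
  also have "fq 2 * iq 2 = 1" by (simp add: iq_eq fq_nz)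
  also have "iq 1 = (1 - q^2) * iq 2" using iq_pred[of 2] by simp
  finally have "Sd 1 1 = (1 / q^2 - q^2 + 2 * q - 2 / q) * (1 - q^2) * iq 2 * (iq 1 * iq 2)" 
    using iq_pred[of 2] by (simp add: power2_eq_square)
  also have "(1 / q^2 - q^2 + 2 * q - 2 / q) = (1 - q^2) * (1 - q)^2 / q^2"
    using q_nz by (simp add: field_simps power2_eq_square)
  finally have "Sd 1 1 = ((1 - q) * ((1 - q^2) * iq 2))^2 * iq 1 / q^2"
    by (simp add: power2_eq_square mult_ac)
  also have "(1 - q^2) * iq 2 = iq 1" using iq_pred[of 2] by simp
  also have "(1 - q) * iq 1 = 1" using iq_pred[of 1] by (simp add: iq_0)
  finally show ?thesis by (simp add: power_int_minus field_simps)
qed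

text \<open>The recurrence determines \<open>Sd M N\<close> once M + N >= 3, since then 1 - t, 1 - p
  t and 1 - p^2 t are all nonzero. The product on the right solves the same recurrence and has the
  same boundary values.\<close>

theorem seed:
  "Sd M N = q powi (2 * (M - 1) * (N - 1) - 2) * iq (M - 1) * iq (N - 1) * iq (M + N - 1)"
proof (induction "nat (M + N)" arbitrary: M N rule: less_induct)
  case less
  define R where "R = (\<lambda>M N. q powi (2 * (M - 1) * (N - 1) - 2) * iq (M - 1) * iq (N - 1) * iq (M + N - 1))"
  consider "M \<le> 0 \<or> N \<le> 0" | "M = 1" "N = 1" | "M \<ge> 1" "N \<ge> 1" "M + N \<ge> 3" by linarith
  thus ?case
  proof cases
    case 1 thus ?thesis using Sd_0[OF 1] by (auto simp: iq_neg)
  next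
    case 2 thus ?thesis by (simp add: Sd_1 iq_0)
  next
    case 3
    define a b p t where abpt: "a = q powi M" "b = q powi N" "p = q powi (- 1)" "t = a * b"
    have IH: "Sd (M - 1) (N - 1) = R (M - 1) (N - 1)" "Sd (M - 1) N = R (M - 1) N" "Sd M (N - 1) = R M (N - 1)"
      unfolding R_def by ((rule less.hyps), use 3 in simp)+
    have nz: "a \<noteq> 0" "b \<noteq> 0" "p \<noteq> 0" using q_nz by (auto simp: abpt)
    have t: "t = q powi (M + N)" "p * t = q powi (M + N - 1)" "p^2 * t = q powi (M + N - 2)"
    proof -
      show t: "t = q powi (M + N)" by (simp add: abpt qpi_add)
      have "M + N - 1 = M + N + - 1" "M + N - 2 = M + N + - 1 + - 1" by simp_all
      thus "p * t = q powi (M + N - 1)" "p^2 * t = q powi (M + N - 2)"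
        unfolding t abpt(3) by (simp_all only: qpi_add power2_eq_square mult_ac)
    qed
    have n1: "1 - t \<noteq> 0" "1 - p * t \<noteq> 0" "1 - p^2 * t \<noteq> 0"
      unfolding t(2,3) unfolding t(1) using qpowi_neq_1[of "M + N"] qpowi_neq_1[of "M + N - 1"] qpowi_neq_1[of "M + N - 2"] 3 by auto
    have d: "iq (M - 1 - 1) = (1 - a * p) * iq (M - 1)" "iq (N - 1 - 1) = (1 - b * p) * iq (N - 1)"
      "iq (M + N - 1 - 1) = (1 - p * t) * iq (M + N - 1)" "iq (M + N - 1 - 1 - 1) = (1 - p^2 * t) * ((1 - p * t) * iq (M + N - 1))"
    proof -
      have "M - 1 = M + - 1" "N - 1 = N + - 1" by simp_all
      hence "a * p = q powi (M - 1)" "b * p = q powi (N - 1)" by (simp_all only: abpt qpi_add)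
      thus "iq (M - 1 - 1) = (1 - a * p) * iq (M - 1)" "iq (N - 1 - 1) = (1 - b * p) * iq (N - 1)"
        by (simp_all only: iq_pred[of "M - 1"] iq_pred[of "N - 1"])
      show 3: "iq (M + N - 1 - 1) = (1 - p * t) * iq (M + N - 1)" unfolding t(2) by (rule iq_pred)
      have "iq (M + N - 1 - 1 - 1) = (1 - q powi (M + N - 1 - 1)) * iq (M + N - 1 - 1)" by (rule iq_pred)
      thus "iq (M + N - 1 - 1 - 1) = (1 - p^2 * t) * ((1 - p * t) * iq (M + N - 1))" unfolding 3 t(3) by simp
    qed
    define c where "c = q powi (2 * (M - 1) * (N - 1) - 2) * iq (M - 1) * iq (N - 1) * iq (M + N - 1)"
    \<comment> \<open>Lowering both parameters, M alone or N alone diminishes the exponent 2 (M -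
      1)(N - 1) - 2 by 2 (M + N) - 6, 2 (N - 1) or 2 (M - 1); as powers of q these are t^2 p^6, b^2
      p^2 and a^2 p^2.\<close>
    have pa: "q powi (- (2 * (M + N) - 6)) * (t^2 * p^6) = 1" "q powi (- (2 * (N - 1))) * (b^2 * p^2) = 1" "q powi (- (2 * (M - 1))) * (a^2 * p^2) = 1"
    proof -
      have i: "(q powi m)^k = q powi (m * int k)" for m k by (simp add: power_int_mult power_int_of_nat)
      show "q powi (- (2 * (M + N) - 6)) * (t^2 * p^6) = 1" "q powi (- (2 * (N - 1))) * (b^2 * p^2) = 1" "q powi (- (2 * (M - 1))) * (a^2 * p^2) = 1"
        unfolding t(1) abpt(1-3) i qpi_add[symmetric] by (simp_all add: algebra_simps)
    qed
    have R0: "R (M - 1) (N - 1) * (t^2 * p^6) = (1 - a * p) * (1 - b * p) * (1 - p * t) * (1 - p^2 * t) * c"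
    proof -
      have e: "2 * (M - 1 - 1) * (N - 1 - 1) - 2 = (2 * (M - 1) * (N - 1) - 2) + - (2 * (M + N) - 6)" by (simp add: algebra_simps)
      have "M - 1 + (N - 1) - 1 = M + N - 1 - 1 - 1" by simp
      hence "R (M - 1) (N - 1) * (t^2 * p^6) = (1 - a * p) * (1 - b * p) * (1 - p * t) * (1 - p^2 * t) * c * (q powi (- (2 * (M + N) - 6)) * (t^2 * p^6))"
        unfolding R_def c_def e qpi_add[of "2 * (M - 1) * (N - 1) - 2"] by (simp only: d mult_ac)
      thus ?thesis by (simp only: pa mult_1_right)
    qed
    have R1: "R (M - 1) N * (b^2 * p^2) = (1 - a * p) * (1 - p * t) * c"
    proof -
      have e: "2 * (M - 1 - 1) * (N - 1) - 2 = (2 * (M - 1) * (N - 1) - 2) + - (2 * (N - 1))" by (simp add: algebra_simps)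
      have "M - 1 + N - 1 = M + N - 1 - 1" by simp
      hence "R (M - 1) N * (b^2 * p^2) = (1 - a * p) * (1 - p * t) * c * (q powi (- (2 * (N - 1))) * (b^2 * p^2))"
        unfolding R_def c_def e qpi_add[of "2 * (M - 1) * (N - 1) - 2"] by (simp only: d mult_ac)
      thus ?thesis by (simp only: pa mult_1_right)
    qed
    have R2: "R M (N - 1) * (a^2 * p^2) = (1 - b * p) * (1 - p * t) * c"
    proof -
      have e: "2 * (M - 1) * (N - 1 - 1) - 2 = (2 * (M - 1) * (N - 1) - 2) + - (2 * (M - 1))" by (simp add: algebra_simps)
      have "M + (N - 1) - 1 = M + N - 1 - 1" by simp
      hence "R M (N - 1) * (a^2 * p^2) = (1 - b * p) * (1 - p * t) * c * (q powi (- (2 * (M - 1))) * (a^2 * p^2))"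
        unfolding R_def c_def e qpi_add[of "2 * (M - 1) * (N - 1) - 2"] by (simp only: d mult_ac)
      thus ?thesis by (simp only: pa mult_1_right)
    qed
    have "(t^2 * p^6 * (1 - t) * (1 - t * p) * Sd (M - 1) (N - 1)
      + b^3 * p^3 * (p * t - 1) * (p^2 * t - 1) * (1 - t) * Sd (M - 1) N
      + a^3 * p^3 * (p * t - 1) * (p^2 * t - 1) * (1 - t) * Sd M (N - 1))
      + (t - 1) * (p * t - 1)^2 * (p^2 * t - 1)^2 * Sd M N = 0"
      unfolding abpt using Sd_recurrence[of M N] 3 by simp
    moreover have "t^2 * p^6 * (1 - t) * (1 - t * p) * Sd (M - 1) (N - 1)
      + b^3 * p^3 * (p * t - 1) * (p^2 * t - 1) * (1 - t) * Sd (M - 1) N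
      + a^3 * p^3 * (p * t - 1) * (p^2 * t - 1) * (1 - t) * Sd M (N - 1)
      = (1 - t) * (1 - p * t)^2 * (1 - p^2 * t)^2 * c"
    proof -
      have "t^2 * p^6 * (1 - t) * (1 - t * p) * Sd (M - 1) (N - 1)
      + b^3 * p^3 * (p * t - 1) * (p^2 * t - 1) * (1 - t) * Sd (M - 1) N
      + a^3 * p^3 * (p * t - 1) * (p^2 * t - 1) * (1 - t) * Sd M (N - 1)
       = (1 - t) * (1 - t * p) * (R (M - 1) (N - 1) * (t^2 * p^6)) + (b * p) * (p * t - 1) * (p^2 * t - 1) * (1 - t) * (R (M - 1) N * (b^2 * p^2))
        + (a * p) * (p * t - 1) * (p^2 * t - 1) * (1 - t) * (R M (N - 1) * (a^2 * p^2))"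
        unfolding IH by algebra
      also have "\<dots> = (1 - t) * (1 - p * t)^2 * (1 - p^2 * t)^2 * c"
        unfolding R0 R1 R2 unfolding abpt(4) by algebra
      finally show ?thesis .
    qed
    ultimately have "((1 - t) * (1 - p * t)^2 * (1 - p^2 * t)^2) * (c - Sd M N) = 0" by algebra
    hence "Sd M N = c" using n1 by simp
    thus ?thesis by (simp add: c_def)
  qed
qed

section \<open>Changes of kernel\<close>

lemma Sm_quadratic:
  assumes w: "antisymw w"
    and P: "\<And>X Y Z. X * Y * Z = 1 \<Longrightarrow> P X Y Z = (a0 + a1 * X + a2 * X^2) * (b0 + b1 * Y + b2 * Y^2) * (c0 + c1 * Z + c2 * Z^2)"
  shows "Sm (\<lambda>\<xi> \<eta>. w \<xi> \<eta> * KY M N \<xi> \<eta>) P = (a2 * (b1 * c0 - b0 * c1) - a1 * (b2 * c0 - b0 * c2) + a0 * (b2 * c1 - b1 * c2)) *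
     Sm (\<lambda>\<xi> \<eta>. w \<xi> \<eta> * KY M N \<xi> \<eta>) (\<lambda>X Y Z. X^2 * Y)"
proof -
  have "Sm (\<lambda>\<xi> \<eta>. w \<xi> \<eta> * KY M N \<xi> \<eta>) P = Sm (\<lambda>\<xi> \<eta>. w \<xi> \<eta> * KY M N \<xi> \<eta>)
    (\<lambda>X Y Z. (a0 + a1 * X + a2 * X^2) * (b0 + b1 * Y + b2 * Y^2) * (c0 + c1 * Z + c2 * Z^2))"
    by (rule Sm_cong) (rule P)
  also have "\<dots> = (a2 * (b1 * c0 - b0 * c1) - a1 * (b2 * c0 - b0 * c2) + a0 * (b2 * c1 - b1 * c2)) *
     Sm (\<lambda>\<xi> \<eta>. w \<xi> \<eta> * KY M N \<xi> \<eta>) (\<lambda>X Y Z. X^2 * Y)"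
    by (rule Sm_alt_eq[OF antisymw_K[OF w] fsw_K]) (rule alt_quadratic)
  finally show ?thesis .
qed

lemma Sm_K:
  "Sm (\<lambda>\<xi> \<eta>. w \<xi> \<eta> * KY M N \<xi> \<eta>) (\<lambda>X Y Z. X^2 * Y) = (\<Sum>\<^sub>\<infinity>(\<xi>, \<eta>). w \<xi> \<eta> * q powi (\<xi> + \<eta>) * KY M N \<xi> \<eta>)"
  unfolding Sm_def
proof (intro infsum_cong, clarify)
  fix \<xi> \<eta> :: int
  have "\<xi> + \<eta> = \<xi> + \<xi> + (\<eta> - \<xi>)" by simp
  hence "q powi (\<xi> + \<eta>) = (q powi \<xi>)^2 * q powi (\<eta> - \<xi>)" by (simp only: qpi_add power2_eq_square)
  thus "w \<xi> \<eta> * KY M N \<xi> \<eta> * ((q powi \<xi>)^2 * q powi (\<eta> - \<xi>)) = w \<xi> \<eta> * q powi (\<xi> + \<eta>) * KY M N \<xi> \<eta>" by simp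
qed

lemma Sm_termwise:
  assumes "\<And>\<xi> \<eta> X Y Z. X = q powi \<xi> \<Longrightarrow> Y = q powi (\<eta> - \<xi>) \<Longrightarrow> Z = q powi (- \<eta>) \<Longrightarrow> X * (Y * Z) = 1 \<Longrightarrow>
      \<phi> \<xi> \<eta> * P X Y Z = c * f \<xi> \<eta>"
  shows "Sm \<phi> P = c * (\<Sum>\<^sub>\<infinity>(\<xi>, \<eta>). f \<xi> \<eta>)"
proof -
  have "Sm \<phi> P = (\<Sum>\<^sub>\<infinity>p. c * (case p of (\<xi>, \<eta>) \<Rightarrow> f \<xi> \<eta>))"
    unfolding Sm_def
  proof (intro infsum_cong, clarify)
    fix \<xi> \<eta>
    show "\<phi> \<xi> \<eta> * P (q powi \<xi>) (q powi (\<eta> - \<xi>)) (q powi (- \<eta>)) = c * f \<xi> \<eta>"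
      using XYZ[of \<xi> \<eta>] by (intro assms refl) (simp add: mult.assoc)
  qed
  thus ?thesis by (simp add: infsum_cmult_right')
qed

text \<open>Up to a constant, the kernel at the shifted point is the kernel of (M + 1, N + 1) times
  six linear factors. Together with q^(\<xi> + \<eta>) = X^2 Y they form a product of one quadratic
  in each variable, and the alternant of such a product is a constant times the Vandermonde
  determinant.\<close>

theorem kernel_B:
  assumes w: "antisymw w"
  shows "(1 - q powi (M + N + 1)) * (\<Sum>\<^sub>\<infinity>(\<xi>, \<eta>). w \<xi> \<eta> * q powi (\<xi> + \<eta>) * KY (M + 1) (N + 1) \<xi> \<eta>)
    = (\<Sum>\<^sub>\<infinity>(\<xi>, \<eta>). w \<xi> \<eta> * q powi (\<xi> + \<eta>) * K M N (\<xi> + 1) (\<eta> - \<xi>) (- \<eta> - 1))"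
proof -
  consider "M + N \<ge> 0" | "M + N = - 1" | "M + N \<le> - 2" by linarith
  thus ?thesis
  proof cases
    case 1
    define a b p t where abpt: "a = q powi (M + 1)" "b = q powi (N + 1)" "p = q powi (- 1)" "t = a * b"
    define \<phi> where "\<phi> = (\<lambda>\<xi> \<eta>. w \<xi> \<eta> * KY (M + 1) (N + 1) \<xi> \<eta>)"
    \<comment> \<open>X^2 Y is distributed over the three factors that lower M: for instance X (1 -
      a YZ) = X - a because XYZ = 1.\<close>
    define P where "P = (\<lambda>X Y Z. (X - a) * (X - a * p) * ((Y - a) * (1 - b * Y)) * ((1 - b * Z) * (1 - b * p * Z)))"
    have "M = (M + 1) + - 1" "N = (N + 1) + - 1" by simp_all
    hence qM: "q powi M = a * p" "q powi N = b * p" unfolding abpt by (metis qpi_add)+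
    have t: "t = q powi (M + 1 + (N + 1))" by (simp only: abpt qpi_add)
    have "M + N + 1 = M + 1 + (N + 1) + - 1" by simp
    hence pt: "p * t = q powi (M + N + 1)" by (simp only: t abpt(3) qpi_add mult_ac)
    have n: "1 - t \<noteq> 0" "1 - p * t \<noteq> 0"
      unfolding pt unfolding t using qpowi_neq_1[of "M + 1 + (N + 1)"] qpowi_neq_1[of "M + N + 1"] 1 by auto
    have A: "Sm \<phi> P = ((1 - t) * (1 - p * t)) * (\<Sum>\<^sub>\<infinity>(\<xi>, \<eta>). w \<xi> \<eta> * q powi (\<xi> + \<eta>) * K M N (\<xi> + 1) (\<eta> - \<xi>) (- \<eta> - 1))"
    proof (rule Sm_termwise)
      fix \<xi> \<eta> X Y Z assume X: "X = q powi \<xi>" "Y = q powi (\<eta> - \<xi>)" "Z = q powi (- \<eta>)" and xyz: "X * (Y * Z) = 1"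
      have i: "q powi (- \<xi>) = Y * Z" "q powi (- (\<eta> - \<xi>)) = X * Z" unfolding X by (simp_all add: qpi_add[symmetric])
      have "\<xi> + \<eta> = \<xi> + \<xi> + (\<eta> - \<xi>)" by simp
      hence e: "q powi (\<xi> + \<eta>) = X^2 * Y" by (simp only: qpi_add power2_eq_square X)
      have 1: "iq (M - (\<xi> + 1)) = (1 - a * p * (Y * Z)) * ((1 - a * (Y * Z)) * iq (M + 1 - \<xi>))"
      proof -
        have "M - (\<xi> + 1) = M - 1 - \<xi>" by simp
        hence "iq (M - (\<xi> + 1)) = (1 - q powi M * q powi (- \<xi>)) * iq (M - \<xi>)" by (simp only: iq_down)
        also have "iq (M - \<xi>) = (1 - q powi (M + 1) * q powi (- \<xi>)) * iq (M + 1 - \<xi>)" using iq_down[of "M + 1" \<xi>] by simp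
        finally show ?thesis unfolding i qM abpt(1)[symmetric] .
      qed
      have 2: "iq (N + (\<xi> + 1)) = iq (N + 1 + \<xi>)" by (simp add: add_ac)
      have 3: "iq (M - (\<eta> - \<xi>)) = (1 - a * (X * Z)) * iq (M + 1 - (\<eta> - \<xi>))"
        using iq_down[of "M + 1" "\<eta> - \<xi>"] unfolding i abpt(1)[symmetric] by simp
      have 4: "iq (N + (\<eta> - \<xi>)) = (1 - b * Y) * iq (N + 1 + (\<eta> - \<xi>))"
        using iq_down'[of "N + 1" "\<eta> - \<xi>"] unfolding X abpt(2)[symmetric] by simp
      have 5: "iq (M - (- \<eta> - 1)) = iq (M + 1 - - \<eta>)" by (rule arg_cong[of _ _ iq]) simp
      have 6: "iq (N + (- \<eta> - 1)) = (1 - b * p * Z) * ((1 - b * Z) * iq (N + 1 + - \<eta>))"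
      proof -
        have "N + (- \<eta> - 1) = N - 1 + - \<eta>" by simp
        hence "iq (N + (- \<eta> - 1)) = (1 - q powi N * q powi (- \<eta>)) * iq (N + - \<eta>)" by (simp only: iq_down')
        also have "iq (N + - \<eta>) = (1 - q powi (N + 1) * q powi (- \<eta>)) * iq (N + 1 + - \<eta>)" using iq_down'[of "N + 1" "- \<eta>"] by simp
        finally show ?thesis unfolding X(3)[symmetric] qM abpt(2)[symmetric] .
      qed
      have "fq (M + 1 + (N + 1)) = (1 - t) * fq (M + N + 1)" using fq_rec[of "M + 1 + (N + 1)"] \<open>M + N \<ge> 0\<close> unfolding t by (simp add: add_ac)
      also have "fq (M + N + 1) = (1 - p * t) * fq (M + N)" using fq_rec[of "M + N + 1"] \<open>M + N \<ge> 0\<close> unfolding pt by simp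
      finally have 7: "fq (M + 1 + (N + 1)) = (1 - t) * ((1 - p * t) * fq (M + N))" .
      have "X^2 * Y * ((1 - a * p * (Y * Z)) * (1 - a * (Y * Z)) * (1 - a * (X * Z)))
         = (X - a * p * (X * (Y * Z))) * (X - a * (X * (Y * Z))) * (Y - a * (X * (Y * Z)))" by algebra
      also have "\<dots> = (X - a) * (X - a * p) * (Y - a)" unfolding xyz by simp
      finally have 8: "P X Y Z = X^2 * Y * ((1 - a * p * (Y * Z)) * (1 - a * (Y * Z)) * (1 - a * (X * Z))) * ((1 - b * Y) * ((1 - b * Z) * (1 - b * p * Z)))"
        unfolding P_def by (simp only: mult_ac)
      show "\<phi> \<xi> \<eta> * P X Y Z = ((1 - t) * (1 - p * t)) * (w \<xi> \<eta> * q powi (\<xi> + \<eta>) * K M N (\<xi> + 1) (\<eta> - \<xi>) (- \<eta> - 1))"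
        unfolding \<phi>_def 8 e K_def 1 2 3 4 5 6 7 by (simp only: mult_ac)
    qed
    have B: "Sm \<phi> P = (1 - t) * (1 - p * t)^2 * Sm \<phi> (\<lambda>X Y Z. X^2 * Y)"
    proof -
      \<comment> \<open>The determinant of the coefficients factors as (1 - t)(1 - p t)^2. The part
        (1 - t)(1 - p t) is the quotient of the numerators \<open>fq\<close>; the remaining 1 - p t
        is the factor 1 - q^(M + N + 1) of the statement.\<close>
      have "Sm \<phi> P = (1 * ((1 + t) * 1 - (- a) * (- (b * (1 + p)))) - (- (a * (1 + p))) * ((- b) * 1 - (- a) * (b^2 * p))
          + (a^2 * p) * ((- b) * (- (b * (1 + p))) - (1 + t) * (b^2 * p))) * Sm \<phi> (\<lambda>X Y Z. X^2 * Y)"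
        unfolding \<phi>_def
      proof (rule Sm_quadratic[OF w])
        fix X Y Z show "P X Y Z = (a^2 * p + - (a * (1 + p)) * X + 1 * X^2) * (- a + (1 + t) * Y + - b * Y^2) * (1 + - (b * (1 + p)) * Z + b^2 * p * Z^2)"
          unfolding P_def abpt(4) by algebra
      qed
      also have "(1 * ((1 + t) * 1 - (- a) * (- (b * (1 + p)))) - (- (a * (1 + p))) * ((- b) * 1 - (- a) * (b^2 * p))
          + (a^2 * p) * ((- b) * (- (b * (1 + p))) - (1 + t) * (b^2 * p))) = (1 - t) * (1 - p * t)^2"
        unfolding abpt(4) by algebra
      finally show ?thesis .
    qed
    have "((1 - t) * (1 - p * t)) * ((1 - p * t) * Sm \<phi> (\<lambda>X Y Z. X^2 * Y)) = ((1 - t) * (1 - p * t)) * (\<Sum>\<^sub>\<infinity>(\<xi>, \<eta>). w \<xi> \<eta> * q powi (\<xi> + \<eta>) * K M N (\<xi> + 1) (\<eta> - \<xi>) (- \<eta> - 1))"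
    proof -
      have "((1 - t) * (1 - p * t)) * ((1 - p * t) * Sm \<phi> (\<lambda>X Y Z. X^2 * Y)) = (1 - t) * (1 - p * t)^2 * Sm \<phi> (\<lambda>X Y Z. X^2 * Y)"
        by (simp only: power2_eq_square mult.assoc)
      thus ?thesis using A B by metis
    qed
    hence "(1 - p * t) * Sm \<phi> (\<lambda>X Y Z. X^2 * Y) = (\<Sum>\<^sub>\<infinity>(\<xi>, \<eta>). w \<xi> \<eta> * q powi (\<xi> + \<eta>) * K M N (\<xi> + 1) (\<eta> - \<xi>) (- \<eta> - 1))"
      using n by simp
    thus ?thesis unfolding pt \<phi>_def Sm_K .
  next
    \<comment> \<open>Here 1 - q^(M + N + 1) = 0, and the box that supports the kernel on the right
      is empty.\<close>
    case 2
    have "K M N (\<xi> + 1) (\<eta> - \<xi>) (- \<eta> - 1) = 0" for \<xi> \<eta> by (rule K_0) (use 2 in auto)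
    thus ?thesis using 2 by (simp add: case_prod_unfold)
  next
    case 3
    have 1: "K M N (\<xi> + 1) (\<eta> - \<xi>) (- \<eta> - 1) = 0" for \<xi> \<eta> by (rule K_0) (use 3 in auto)
    have "w \<xi> \<eta> * q powi (\<xi> + \<eta>) * KY (M + 1) (N + 1) \<xi> \<eta> = 0" for \<xi> \<eta>
      using KY_eq_0[OF w, of "M + 1" "N + 1" \<xi> \<eta>] 3 by auto
    thus ?thesis unfolding 1 by (simp only: mult_zero_right)
       (simp add: case_prod_unfold)
  qed
qed

text \<open>Raising the third coordinate by 1 and taking N for N + 1 costs the factors 1 - a XY, 1 -
  b X and 1 - b Y, with a = q^(M + 1), b = q^(N + 1). The determinant for 1 - b X, Y (1 - b Y) and
  c0 + c1 Z + c2 Z^2 is -(b^2 c0 + b c1 + c2), and the last assumption lets it cancel the factor 1 -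
  a b of the numerator.\<close>

lemma kernel_U_aux:
  assumes w: "antisymw w"
    and u: "\<And>\<xi> \<eta>. u \<xi> \<eta> = F (q powi \<xi>) (q powi (\<eta> - \<xi>)) (q powi (- \<eta>))"
    and F: "\<And>X Y Z. X * (Y * Z) = 1 \<Longrightarrow> F X Y Z * (1 - q powi (M + 1) * (X * Y)) = Y * (c0 + c1 * Z + c2 * Z^2)"
    and d: "(q powi (N + 1))^2 * c0 + q powi (N + 1) * c1 + c2 = d * (1 - q powi (M + 1) * q powi (N + 1))"
  shows "(\<Sum>\<^sub>\<infinity>(\<xi>, \<eta>). w \<xi> \<eta> * u \<xi> \<eta> * K (M + 1) N \<xi> (\<eta> - \<xi>) (- \<eta> + 1))
    = - d * (\<Sum>\<^sub>\<infinity>(\<xi>, \<eta>). w \<xi> \<eta> * q powi (\<xi> + \<eta>) * KY (M + 1) (N + 1) \<xi> \<eta>)"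
proof (cases "M + N \<ge> - 1")
  case False
  have 1: "K (M + 1) N \<xi> (\<eta> - \<xi>) (- \<eta> + 1) = 0" for \<xi> \<eta> by (rule K_0) (use False in auto)
  have "w \<xi> \<eta> * q powi (\<xi> + \<eta>) * KY (M + 1) (N + 1) \<xi> \<eta> = 0" for \<xi> \<eta>
    using KY_eq_0[OF w, of "M + 1" "N + 1" \<xi> \<eta>] False by auto
  thus ?thesis unfolding 1 by (simp only: mult_zero_right) (simp add: case_prod_unfold)
next
  case True
  define a b t where abt: "a = q powi (M + 1)" "b = q powi (N + 1)" "t = a * b"
  define \<phi> where "\<phi> = (\<lambda>\<xi> \<eta>. w \<xi> \<eta> * KY (M + 1) (N + 1) \<xi> \<eta>)"
  define P where "P = (\<lambda>X Y Z. F X Y Z * (1 - a * (X * Y)) * ((1 - b * X) * (1 - b * Y)))"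
  have t: "t = q powi (M + 1 + (N + 1))" by (simp only: abt qpi_add)
  have n: "1 - t \<noteq> 0" unfolding t using qpowi_neq_1[of "M + 1 + (N + 1)"] True by auto
  have A: "Sm \<phi> P = (1 - t) * (\<Sum>\<^sub>\<infinity>(\<xi>, \<eta>). w \<xi> \<eta> * u \<xi> \<eta> * K (M + 1) N \<xi> (\<eta> - \<xi>) (- \<eta> + 1))"
  proof (rule Sm_termwise)
    fix \<xi> \<eta> X Y Z assume X: "X = q powi \<xi>" "Y = q powi (\<eta> - \<xi>)" "Z = q powi (- \<eta>)" and xyz: "X * (Y * Z) = 1"
    have i: "q powi (- (- \<eta>)) = X * Y" unfolding X by (simp add: qpi_add[symmetric])
    have 1: "iq (N + \<xi>) = (1 - b * X) * iq (N + 1 + \<xi>)"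
      using iq_down'[of "N + 1" \<xi>] unfolding X abt(2)[symmetric] by simp
    have 2: "iq (N + (\<eta> - \<xi>)) = (1 - b * Y) * iq (N + 1 + (\<eta> - \<xi>))"
      using iq_down'[of "N + 1" "\<eta> - \<xi>"] unfolding X abt(2)[symmetric] by simp
    have "M + 1 - (- \<eta> + 1) = M + 1 - 1 - - \<eta>" by simp
    hence 3: "iq (M + 1 - (- \<eta> + 1)) = (1 - a * (X * Y)) * iq (M + 1 - - \<eta>)"
      by (simp only: iq_down i abt(1))
    have 4: "iq (N + (- \<eta> + 1)) = iq (N + 1 + - \<eta>)" by (rule arg_cong[of _ _ iq]) simp
    have 5: "fq (M + 1 + (N + 1)) = (1 - t) * fq (M + 1 + N)"
      using fq_rec[of "M + 1 + (N + 1)"] True unfolding t by (simp add: add_ac)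
    show "\<phi> \<xi> \<eta> * P X Y Z = (1 - t) * (w \<xi> \<eta> * u \<xi> \<eta> * K (M + 1) N \<xi> (\<eta> - \<xi>) (- \<eta> + 1))"
      unfolding \<phi>_def P_def K_def 1 2 3 4 5 u X[symmetric] by (simp only: mult_ac)
  qed
  have "Sm \<phi> P = (0 * (1 * c0 - 0 * c1) - (- b) * ((- b) * c0 - 0 * c2) + 1 * ((- b) * c1 - 1 * c2)) * Sm \<phi> (\<lambda>X Y Z. X^2 * Y)"
    unfolding \<phi>_def
  proof (rule Sm_quadratic[OF w])
    fix X Y Z :: complex assume "X * Y * Z = 1"
    hence xyz: "X * (Y * Z) = 1" by (simp add: mult.assoc)
    show "P X Y Z = (1 + - b * X + 0 * X^2) * (0 + 1 * Y + - b * Y^2) * (c0 + c1 * Z + c2 * Z^2)"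
      unfolding P_def abt(1) F[OF xyz] by algebra
  qed
  also have "(0 * (1 * c0 - 0 * c1) - (- b) * ((- b) * c0 - 0 * c2) + 1 * ((- b) * c1 - 1 * c2)) = - (b^2 * c0 + b * c1 + c2)" by algebra
  also have "b^2 * c0 + b * c1 + c2 = d * (1 - t)" using d unfolding abt(3) abt(1,2) .
  also have "- (d * (1 - t)) * Sm \<phi> (\<lambda>X Y Z. X^2 * Y) = (1 - t) * (- d * Sm \<phi> (\<lambda>X Y Z. X^2 * Y))" by algebra
  finally have "(1 - t) * (\<Sum>\<^sub>\<infinity>(\<xi>, \<eta>). w \<xi> \<eta> * u \<xi> \<eta> * K (M + 1) N \<xi> (\<eta> - \<xi>) (- \<eta> + 1))
     = (1 - t) * (- d * Sm \<phi> (\<lambda>X Y Z. X^2 * Y))" using A by (rule trans[OF sym, rotated])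
  hence "(\<Sum>\<^sub>\<infinity>(\<xi>, \<eta>). w \<xi> \<eta> * u \<xi> \<eta> * K (M + 1) N \<xi> (\<eta> - \<xi>) (- \<eta> + 1)) = - d * Sm \<phi> (\<lambda>X Y Z. X^2 * Y)"
    by (rule mult_left_cancel[THEN iffD1, OF n])
  thus ?thesis unfolding \<phi>_def Sm_K .
qed

text \<open>The two monomials YZ^2 and YZ supply the starting data of the second family: this one
  for \<sigma> = 0, while \<open>kernel_U1\<close> carries the extra q^(N + 1) needed for \<sigma> =
  1.\<close>

lemma kernel_U0:
  assumes "antisymw w"
  shows "(\<Sum>\<^sub>\<infinity>(\<xi>, \<eta>). w \<xi> \<eta> * q powi (- \<xi> - \<eta>) * K (M + 1) N \<xi> (\<eta> - \<xi>) (- \<eta> + 1))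
    = - 1 * (\<Sum>\<^sub>\<infinity>(\<xi>, \<eta>). w \<xi> \<eta> * q powi (\<xi> + \<eta>) * KY (M + 1) (N + 1) \<xi> \<eta>)"
proof (rule kernel_U_aux[OF assms, of _ "\<lambda>X Y Z. Y * Z^2" _ 0 "- (q powi (M + 1))" 1])
  fix \<xi> \<eta> :: int
  have "- \<xi> - \<eta> = (\<eta> - \<xi>) + (- \<eta> + - \<eta>)" by simp
  thus "q powi (- \<xi> - \<eta>) = q powi (\<eta> - \<xi>) * (q powi (- \<eta>))^2" by (simp only: qpi_add power2_eq_square)
next
  fix X Y Z :: complex assume "X * (Y * Z) = 1"
  thus "Y * Z^2 * (1 - q powi (M + 1) * (X * Y)) = Y * (0 + - (q powi (M + 1)) * Z + 1 * Z^2)" by algebra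
qed algebra

lemma kernel_U1:
  assumes "antisymw w"
  shows "(\<Sum>\<^sub>\<infinity>(\<xi>, \<eta>). w \<xi> \<eta> * q powi (- \<xi>) * K (M + 1) N \<xi> (\<eta> - \<xi>) (- \<eta> + 1))
    = - (q powi (N + 1)) * (\<Sum>\<^sub>\<infinity>(\<xi>, \<eta>). w \<xi> \<eta> * q powi (\<xi> + \<eta>) * KY (M + 1) (N + 1) \<xi> \<eta>)"
proof (rule kernel_U_aux[OF assms, of _ "\<lambda>X Y Z. Y * Z" _ "- (q powi (M + 1))" 1 0])
  fix \<xi> \<eta> :: int
  have "- \<xi> = (\<eta> - \<xi>) + - \<eta>" by simp
  thus "q powi (- \<xi>) = q powi (\<eta> - \<xi>) * q powi (- \<eta>)" by (simp only: qpi_add)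
next
  fix X Y Z :: complex assume "X * (Y * Z) = 1"
  thus "Y * Z * (1 - q powi (M + 1) * (X * Y)) = Y * (- (q powi (M + 1)) + 1 * Z + 0 * Z^2)" by algebra
qed algebra

theorem seed_sum:
  "(\<Sum>\<^sub>\<infinity>(\<xi>, \<eta>). cw 0 \<xi> \<eta> * q powi (\<xi> + \<eta>) * KY (M + 1) (N + 1) \<xi> \<eta>) = q powi (2 * M * N - 2) * iq M * iq N * iq (M + N + 1)"
  using seed[of "M + 1" "N + 1"] unfolding Sd_def Sm_K by (simp add: add_ac)

end

section \<open>The Jacobi triple product\<close>

lemma has_sum_times:
  fixes f :: "'a \<Rightarrow> complex" and g :: "'b \<Rightarrow> complex"
  assumes f: "(f has_sum S) A" and g: "(g has_sum T) B"
  shows "((\<lambda>(x, y). f x * g y) has_sum S * T) (A \<times> B)"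
proof -
  have fa: "(\<lambda>x. norm (f x)) summable_on A" and ga: "(\<lambda>x. norm (g x)) summable_on B"
    using f g by (auto simp: summable_on_iff_abs_summable_on_complex[symmetric] has_sum_imp_summable)
  have "(\<lambda>p. norm ((\<lambda>(x, y). f x * g y) p)) summable_on (A \<times> B)"
  proof (rule Infinite_Sum.abs_summable_on_Sigma_iff[THEN iffD2], intro conjI ballI)
    fix x show "(\<lambda>y. norm ((\<lambda>(x, y). f x * g y) (x, y))) summable_on B"
      using summable_on_cmult_right[OF ga, of "norm (f x)"] by (simp add: norm_mult)
  next
    show "(\<lambda>x. norm (\<Sum>\<^sub>\<infinity>y\<in>B. norm ((\<lambda>(x, y). f x * g y) (x, y)))) summable_on A"
      using summable_on_cmult_left[OF fa, of "\<Sum>\<^sub>\<infinity>y\<in>B. norm (g y)"]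
      by (simp add: norm_mult infsum_cmult_right' abs_mult infsum_nonneg)
  qed
  hence "(\<lambda>(x, y). f x * g y) summable_on (A \<times> B)"
    by (simp add: summable_on_iff_abs_summable_on_complex)
  then obtain R where R: "((\<lambda>(x, y). f x * g y) has_sum R) (A \<times> B)" by (auto simp: summable_on_def)
  have "((\<lambda>x. f x * T) has_sum R) A"
    by (rule has_sum_SigmaD[OF R]) (use has_sum_cmult_right[OF g] in simp)
  moreover have "((\<lambda>x. f x * T) has_sum S * T) A" by (rule has_sum_cmult_left[OF f])
  ultimately show ?thesis using R has_sum_unique by fastforce
qed

text \<open>Tannery's theorem: a finite set carries the dominating series up to e / 4, and hence
  every \<open>f n\<close> and the limit as well; on that set convergence is termwise.\<close>

lemma infsum_dominated_convergence:
  fixes f :: "nat \<Rightarrow> 'a \<Rightarrow> complex"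
  assumes g: "g summable_on UNIV" and le: "\<And>n x. norm (f n x) \<le> g x"
    and lim: "\<And>x. (\<lambda>n. f n x) \<longlonglongrightarrow> F x"
  shows "F summable_on UNIV" "(\<lambda>n. infsum (f n) UNIV) \<longlonglongrightarrow> infsum F UNIV"
proof -
  have le': "norm (F x) \<le> g x" for x
    by (rule tendsto_upperbound[OF tendsto_norm[OF lim]]) (auto simp: le)
  have g0: "g x \<ge> 0" for x by (rule order_trans[OF norm_ge_zero le'])
  have abs: "(\<lambda>x. norm (h x)) summable_on A" if "\<And>x. norm (h x) \<le> g x" for h :: "'a \<Rightarrow> complex" and A
  proof (rule Infinite_Sum.abs_summable_on_comparison_test[of g])
    show "(\<lambda>x. norm (g x)) summable_on A" using summable_on_subset_banach[OF g, of A] g0 by simp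
  qed (use that g0 in auto)
  have sm: "h summable_on A" if "\<And>x. norm (h x) \<le> g x" for h :: "'a \<Rightarrow> complex" and A
    using abs[OF that] by (simp add: abs_summable_summable)
  show "F summable_on UNIV" by (rule sm[OF le'])
  show "(\<lambda>n. infsum (f n) UNIV) \<longlonglongrightarrow> infsum F UNIV"
  proof (rule LIMSEQ_I)
    fix e :: real assume e: "e > 0"
    obtain A where A: "finite A" "dist (sum g A) (infsum g UNIV) \<le> e / 4"
      using infsum_finite_approximation[OF g, of "e / 4"] e by auto
    have tail: "norm (infsum h UNIV - sum h A) \<le> e / 4" if h: "\<And>x. norm (h x) \<le> g x" for h :: "'a \<Rightarrow> complex"
    proof -
      have "infsum h (A \<union> - A) = infsum h A + infsum h (- A)" by (rule infsum_Un_disjoint) (auto intro: sm[OF h])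
      hence t1: "infsum h UNIV - sum h A = infsum h (- A)" using A(1) by (simp add: Compl_partition)
      have t2: "norm (infsum h (- A)) \<le> infsum (\<lambda>x. norm (h x)) (- A)" by (rule norm_infsum_bound[OF abs[OF h]])
      have t3: "infsum (\<lambda>x. norm (h x)) (- A) \<le> infsum g (- A)"
        by (intro infsum_mono abs h summable_on_subset_banach[OF g] subset_UNIV)
      have "infsum g (A \<union> - A) = infsum g A + infsum g (- A)"
        by (rule infsum_Un_disjoint) (auto intro: summable_on_subset_banach[OF g])
      hence t4: "infsum g (- A) = infsum g UNIV - sum g A" using A(1) by (simp add: Compl_partition)
      show ?thesis unfolding t1 using t2 t3 t4 A(2)[unfolded dist_real_def] by linarith
    qed
    have "(\<lambda>n. sum (f n) A) \<longlonglongrightarrow> sum F A" by (intro tendsto_sum lim)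
    from this obtain N where N: "\<And>n. n \<ge> N \<Longrightarrow> norm (sum (f n) A - sum F A) < e / 4"
      using LIMSEQ_D[OF \<open>(\<lambda>n. sum (f n) A) \<longlonglongrightarrow> sum F A\<close>, of "e / 4"] e by auto
    show "\<exists>N. \<forall>n\<ge>N. norm (infsum (f n) UNIV - infsum F UNIV) < e"
    proof (intro exI allI impI)
      fix n assume "n \<ge> N"
      have "infsum (f n) UNIV - infsum F UNIV = (infsum (f n) UNIV - sum (f n) A) + (sum (f n) A - sum F A) - (infsum F UNIV - sum F A)" by simp
      also have "norm \<dots> \<le> norm (infsum (f n) UNIV - sum (f n) A) + norm (sum (f n) A - sum F A) + norm (infsum F UNIV - sum F A)"
        by (rule order_trans[OF norm_triangle_ineq4 add_right_mono[OF norm_triangle_ineq]])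
      also have "\<dots> < e"
        using tail[of "f n", OF le] tail[of F, OF le'] N[OF \<open>n \<ge> N\<close>] e by linarith
      finally show "norm (infsum (f n) UNIV - infsum F UNIV) < e" .
    qed
  qed
qed

lemma has_sum_diff:
  fixes f g :: "'a \<Rightarrow> complex"
  assumes "(f has_sum a) A" "(g has_sum b) A" shows "((\<lambda>x. f x - g x) has_sum (a - b)) A"
  using has_sum_add[OF assms(1) has_sum_cmult_right[OF assms(2), of "- 1"]] by simp

definition tri :: "int \<Rightarrow> int" where "tri n = n * (n - 1) div 2"

lemma tri2: "2 * tri n = n * (n - 1)"
proof -
  have "even (n * (n - 1))" by simp
  thus ?thesis by (simp add: tri_def)
qed

lemma tri_Suc: "tri (n + 1) = tri n + n"
  using tri2[of "n + 1"] tri2[of n] by (simp add: algebra_simps)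

abbreviation sg :: "int \<Rightarrow> complex" where "sg n \<equiv> (- 1) powi n"

lemma sg_add: "sg (m + n) = sg m * sg n"
  by (simp add: power_int_add)

lemma sg_minus: "sg (- n) = sg n"
  by (simp add: power_int_minus flip: power_int_inverse)

section \<open>Limits of shifted factorials and of the kernel\<close>

lemma qpoch_lim:
  assumes "norm q < 1" shows "(\<lambda>n. qpoch x q n) \<longlonglongrightarrow> qpinf x q"
proof -
  have "summable (\<lambda>j. norm (x * q ^ j))"
    using assms by (auto simp: norm_mult norm_power intro!: summable_mult summable_geometric)
  hence "convergent_prod (\<lambda>j. 1 - x * q ^ j)"
    by (intro abs_convergent_prod_imp_convergent_prod summable_imp_abs_convergent_prod) simp
  hence "(\<lambda>n. \<Prod>j\<le>n. 1 - x * q ^ j) \<longlonglongrightarrow> qpinf x q"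
    unfolding qpinf_def by (rule convergent_prod_LIMSEQ)
  hence "(\<lambda>n. qpoch x q (Suc n)) \<longlonglongrightarrow> qpinf x q" by (simp add: qpoch_def lessThan_Suc_atMost)
  thus ?thesis by (rule LIMSEQ_imp_Suc)
qed

context qbase begin

lemma qpinf_nz: "qpinf q q \<noteq> 0"
proof -
  have "summable (\<lambda>j. norm (q * q ^ j))"
    using q_lt1 by (auto simp: norm_mult norm_power intro!: summable_mult summable_geometric)
  hence "convergent_prod (\<lambda>j. 1 - q * q ^ j)"
    by (intro abs_convergent_prod_imp_convergent_prod summable_imp_abs_convergent_prod) simp
  moreover have "1 - q * q ^ j \<noteq> 0" for j using qpow_neq_1[of "Suc j"] by simp
  ultimately show ?thesis unfolding qpinf_def using prodinf_nonzero by blast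
qed

lemma fq_lim: "(\<lambda>n. fq (int n)) \<longlonglongrightarrow> qpinf q q"
  using qpoch_lim[OF q_lt1, of q] by (simp add: fq_def)

lemma iq_lim: "(\<lambda>n. iq (int n + a)) \<longlonglongrightarrow> 1 / qpinf q q"
proof -
  have "(\<lambda>n. iq (int n)) \<longlonglongrightarrow> 1 / qpinf q q"
    using tendsto_divide[OF tendsto_const fq_lim qpinf_nz, of 1] by (simp add: iq_eq)
  hence "(\<lambda>n. iq (int (n + nat a))) \<longlonglongrightarrow> 1 / qpinf q q" by (rule LIMSEQ_ignore_initial_segment)
  moreover have "int (n + nat a) = int (n + nat (- a)) + a" for n by linarith
  ultimately have "(\<lambda>n. iq (int (n + nat (- a)) + a)) \<longlonglongrightarrow> 1 / qpinf q q" by (simp only:)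
  thus ?thesis by (rule LIMSEQ_offset)
qed

lemma fq_lim2: "(\<lambda>n. fq (int n + int n)) \<longlonglongrightarrow> qpinf q q"
  using LIMSEQ_subseq_LIMSEQ[OF fq_lim, of "\<lambda>n. n + n"] by (simp add: strict_mono_def o_def)

lemma fq_iq_bound: obtains C where "C \<ge> 1" "\<And>n. norm (fq n) \<le> C" "\<And>n. norm (iq n) \<le> C"
proof -
  obtain C1 where C1: "\<And>n. norm (fq (int n)) \<le> C1"
    using convergent_imp_Bseq[OF convergentI[OF fq_lim]] unfolding Bseq_def by blast
  obtain C2 where C2: "\<And>n. norm (iq (int n + 0)) \<le> C2"
    using convergent_imp_Bseq[OF convergentI[OF iq_lim[of 0]]] unfolding Bseq_def by blast
  show thesis
  proof (rule that[of "max 1 (max C1 C2)"])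
    fix n
    have "norm (fq n) \<le> C1" using C1[of "nat n"] by (simp only: fq_def nat_int)
    thus "norm (fq n) \<le> max 1 (max C1 C2)" by (simp add: le_max_iff_disj)
    show "norm (iq n) \<le> max 1 (max C1 C2)"
      using C2[of "nat n"] by (cases "n < 0") (simp_all add: iq_neg le_max_iff_disj)
  qed simp
qed

lemma K_bound: obtains C where "C \<ge> 1" "\<And>M N x y z. norm (K M N x y z) \<le> C"
proof -
  obtain C where C: "C \<ge> 1" "\<And>n. norm (fq n) \<le> C" "\<And>n. norm (iq n) \<le> C" using fq_iq_bound by blast
  have "norm (K M N x y z) \<le> C * (C * C) * (C * C) * (C * C)" for M N x y z
    unfolding K_def norm_mult by (intro mult_mono C mult_nonneg_nonneg norm_ge_zero) (use C(1) in auto)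
  hence "norm (K M N x y z) \<le> max 1 (C * (C * C) * (C * C) * (C * C))" for M N x y z
    by (simp add: le_max_iff_disj)
  thus thesis using that[OF max.cobounded1] by blast
qed

text \<open>One numerator against six denominators leaves the fifth power. The limit depends neither
  on the lattice point nor on the offsets, so all shifted kernels become equal in the end.\<close>

lemma K_lim: "(\<lambda>n. K (int n + d) (int n + e) x y z) \<longlonglongrightarrow> 1 / qpinf q q ^ 5"
proof -
  have 1: "(\<lambda>n. fq (int n + int n + c)) \<longlonglongrightarrow> qpinf q q" for c
  proof -
    have "filterlim (\<lambda>n. nat (int n + int n + c)) at_top sequentially"
      unfolding filterlim_at_top
    proof (intro allI eventually_sequentiallyI)
      fix Z n :: nat assume "n \<ge> Z + nat \<bar>c\<bar>"
      thus "nat (int n + int n + c) \<ge> Z" by linarith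
    qed
    from filterlim_compose[OF fq_lim this] have "(\<lambda>n. fq (int (nat (int n + int n + c)))) \<longlonglongrightarrow> qpinf q q" .
    moreover have "fq (int (nat z)) = fq z" for z by (simp only: fq_def nat_int)
    ultimately show ?thesis by (simp only:)
  qed
  have "(\<lambda>n. fq (int n + int n + (d + e)) * (iq (int n + (d - x)) * iq (int n + (e + x))) * (iq (int n + (d - y)) * iq (int n + (e + y))) *
     (iq (int n + (d - z)) * iq (int n + (e + z)))) \<longlonglongrightarrow>
    qpinf q q * (1 / qpinf q q * (1 / qpinf q q)) * (1 / qpinf q q * (1 / qpinf q q)) * (1 / qpinf q q * (1 / qpinf q q))"
    by (intro tendsto_mult 1 iq_lim)
  thus ?thesis using qpinf_nz by (simp add: K_def algebra_simps power_numeral_reduce)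
qed

section \<open>Theta series and their finite form\<close>

definition J :: "complex \<Rightarrow> int \<Rightarrow> complex" where
  "J x k = sg k * q powi (tri k) * x powi k"

lemma J_Suc: assumes "x \<noteq> 0" shows "J x (k + 1) = - (x * q powi k * J x k)"
  using assms q_nz by (simp add: J_def tri_Suc power_int_add)

text \<open>The q-binomial theorem in bilateral form. Appending a factor to either product subtracts
  a multiple of the series shifted by one, and the two series merge by the contiguity of
  \<open>iq\<close>.\<close>

lemma J_finite:
  assumes x: "x \<noteq> 0"
  shows "((\<lambda>k. J x k * (fq (int m + int n) * iq (int m - k) * iq (int n + k))) has_sum qpoch x q m * qpoch (q / x) q n) UNIV"
proof (induction m)
  case 0
  show ?case
  proof (induction n)
    case 0
    have "((\<lambda>k. J x k * (fq (int 0 + int 0) * iq (int 0 - k) * iq (int 0 + k))) has_sum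
       (\<Sum>k\<in>{0}. J x k * (fq (int 0 + int 0) * iq (int 0 - k) * iq (int 0 + k)))) UNIV"
    proof (rule has_sum_finite_neutralI[of "{0}"])
      fix k :: int assume "k \<in> UNIV - {0}"
      hence "int 0 - k < 0 \<or> int 0 + k < 0" by auto
      thus "J x k * (fq (int 0 + int 0) * iq (int 0 - k) * iq (int 0 + k)) = 0" by (auto simp: iq_neg)
    qed auto
    thus ?case by (simp add: J_def fq_0 iq_0 qpoch_def tri_def)
  next
    case (Suc n)
    let ?N = "int (Suc n)"
    let ?t = "\<lambda>k. J x k * (fq (int 0 + int n) * iq (int 0 - k) * iq (int n + k))"
    have "((\<lambda>k. ?t k - q powi ?N / x * ?t (k + 1)) has_sum qpoch x q 0 * qpoch (q / x) q n - q powi ?N / x * (qpoch x q 0 * qpoch (q / x) q n)) UNIV"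
      by (intro has_sum_diff has_sum_cmult_right has_sum_shift_int Suc)
    moreover have "?t k - q powi ?N / x * ?t (k + 1) = J x k * (fq (int 0 + ?N) * iq (int 0 - k) * iq (?N + k))" for k
    proof -
      have 1: "iq (int n + k) = (1 - q powi ?N * q powi k) * iq (?N + k)"
        using iq_pred[of "?N + k"] by (simp add: qpi_add)
      have 2: "iq (int 0 - (k + 1)) = (1 - q powi (- k)) * iq (int 0 - k)"
        using iq_pred[of "- k"] by simp
      have 3: "fq (int 0 + ?N) = (1 - q powi ?N) * fq (int 0 + int n)" using fq_rec[of ?N] by simp
      have 4: "q powi k * q powi (- k) = 1" by (simp add: qpi_add[symmetric])
      have 5: "iq (int n + (k + 1)) = iq (?N + k)" by (rule arg_cong[of _ _ iq]) simp
      have "?t k - q powi ?N / x * ?t (k + 1) = J x k * fq (int 0 + int n) * iq (int 0 - k) * iq (?N + k) *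
         ((1 - q powi ?N * q powi k) + q powi ?N * (q powi k - q powi k * q powi (- k)))"
        unfolding 1 2 5 J_Suc[OF x] using x by (simp add: field_simps)
      also have "(1 - q powi ?N * q powi k) + q powi ?N * (q powi k - q powi k * q powi (- k)) = 1 - q powi ?N"
        unfolding 4 by (simp add: algebra_simps)
      finally show ?thesis unfolding 3 by (simp only: mult_ac)
    qed
    moreover have "qpoch x q 0 * qpoch (q / x) q n - q powi ?N / x * (qpoch x q 0 * qpoch (q / x) q n) = qpoch x q 0 * qpoch (q / x) q (Suc n)"
      by (simp add: qpoch_def power_int_def nat_add_distrib algebra_simps)
    ultimately show ?case by simp
  qed
next
  case (Suc m)
  let ?M = "int (Suc m)"
  let ?t = "\<lambda>k. J x k * (fq (int m + int n) * iq (int m - k) * iq (int n + k))"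
  have "((\<lambda>k. ?t k - x * q powi (int m) * ?t (k + - 1)) has_sum qpoch x q m * qpoch (q / x) q n - x * q powi (int m) * (qpoch x q m * qpoch (q / x) q n)) UNIV"
    by (intro has_sum_diff has_sum_cmult_right has_sum_shift_int Suc)
  moreover have "?t k - x * q powi (int m) * ?t (k + - 1) = J x k * (fq (?M + int n) * iq (?M - k) * iq (int n + k))" for k
  proof -
    have 0: "x * J x (k + - 1) = - (q powi (1 - k) * J x k)"
    proof -
      have "q powi (1 - k) * J x k = - (x * J x (k - 1)) * (q powi (1 - k) * q powi (k - 1))"
        using J_Suc[OF x, of "k - 1"] by simp
      also have "q powi (1 - k) * q powi (k - 1) = 1" by (simp add: qpi_add[symmetric])
      finally show ?thesis by simp
    qed
    have 1: "iq (int m - k) = (1 - q powi (?M - k)) * iq (?M - k)"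
      using iq_pred[of "?M - k"] by (simp add: algebra_simps)
    have 2: "iq (int n + (k + - 1)) = (1 - q powi (int n + k)) * iq (int n + k)"
      using iq_pred[of "int n + k"] by (simp add: algebra_simps)
    have 3: "fq (?M + int n) = (1 - q powi (?M + int n)) * fq (int m + int n)" using fq_rec[of "?M + int n"] by (simp add: algebra_simps)
    have 5: "iq (int m - (k + - 1)) = iq (?M - k)" by (rule arg_cong[of _ _ iq]) simp
    have 4: "q powi (int m) * q powi (1 - k) = q powi (?M - k)" "q powi (?M - k) * q powi (int n + k) = q powi (?M + int n)"
      by (simp_all only: qpi_add[symmetric]) (simp_all add: algebra_simps)
    have "?t k - x * q powi (int m) * ?t (k + - 1) = ?t k - (x * J x (k + - 1)) * q powi (int m) * (fq (int m + int n) * iq (int m - (k + - 1)) * iq (int n + (k + - 1)))"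
      by (simp only: mult_ac)
    also have "\<dots> = J x k * fq (int m + int n) * iq (?M - k) * iq (int n + k) *
         ((1 - q powi (?M - k)) + (q powi (int m) * q powi (1 - k)) * (1 - q powi (int n + k)))"
      unfolding 0 1 2 5 by (simp add: algebra_simps)
    also have "(1 - q powi (?M - k)) + (q powi (int m) * q powi (1 - k)) * (1 - q powi (int n + k)) = 1 - q powi (?M + int n)"
      unfolding 4(1) 4(2)[symmetric] by (simp add: algebra_simps)
    finally show ?thesis unfolding 3 by (simp only: mult_ac)
  qed
  moreover have "qpoch x q m * qpoch (q / x) q n - x * q powi (int m) * (qpoch x q m * qpoch (q / x) q n) = qpoch x q (Suc m) * qpoch (q / x) q n"
    by (simp add: qpoch_def algebra_simps)
  ultimately show ?case by simp
qed

lemma half_summable: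
  fixes f :: "nat \<Rightarrow> complex"
  assumes "\<And>n. f (Suc n) = c * q ^ n * f n" shows "f summable_on UNIV"
proof -
  have "(\<lambda>n. norm c * norm q ^ n) \<longlonglongrightarrow> norm c * 0"
    using q_lt1 by (intro tendsto_mult tendsto_const LIMSEQ_power_zero) simp
  hence "eventually (\<lambda>n. norm c * norm q ^ n < 1 / 2) sequentially" by (rule order_tendstoD) simp
  then obtain N where N: "\<And>n. n \<ge> N \<Longrightarrow> norm c * norm q ^ n < 1 / 2" by (auto simp: eventually_sequentially)
  have "summable (\<lambda>n. norm (f n))"
  proof (rule summable_ratio_test[of "1 / 2" N])
    fix n assume "n \<ge> N"
    thus "norm (norm (f (Suc n))) \<le> 1 / 2 * norm (norm (f n))"
      using mult_right_mono[OF less_imp_le[OF N[of n]], of "norm (f n)"] by (simp add: assms norm_mult norm_power)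
  qed simp
  thus ?thesis by (rule norm_summable_imp_summable_on)
qed

lemma J_summable: assumes x: "x \<noteq> 0" shows "J x summable_on UNIV"
proof -
  have A: "(\<lambda>n. J x (int n)) summable_on UNIV"
  proof (rule half_summable[of _ "- x"])
    fix n
    have "int (Suc n) = int n + 1" by simp
    thus "J x (int (Suc n)) = - x * q ^ n * J x (int n)" by (simp only: J_Suc[OF x]) simp
  qed
  have B: "(\<lambda>n. J x (- int n)) summable_on UNIV"
  proof (rule half_summable[of _ "- q / x"])
    fix n
    have "- int (Suc n) + 1 = - int n" by simp
    from J_Suc[OF x, of "- int (Suc n)", unfolded this]
    have 1: "J x (- int n) = - (x * q powi (- int (Suc n)) * J x (- int (Suc n)))" .
    have "q ^ n * q = q powi (int (Suc n))" by (simp only: power_int_of_nat power_Suc2)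
    hence 2: "q ^ n * q * q powi (- int (Suc n)) = 1" by (simp only: qpi_add[symmetric]) simp
    have "- q / x * q ^ n * J x (- int n) = q ^ n * q * q powi (- int (Suc n)) * J x (- int (Suc n))"
      unfolding 1 using x by (simp del: of_nat_Suc)
    also have "\<dots> = J x (- int (Suc n))" unfolding 2 by (rule mult_1_left)
    finally show "J x (- int (Suc n)) = - q / x * q ^ n * J x (- int n)" by (rule sym)
  qed
  have 1: "J x summable_on (range int)"
    using A by (subst summable_on_reindex) (auto simp: o_def)
  have 2: "J x summable_on (range (\<lambda>n. - int n))"
    using B by (subst summable_on_reindex) (auto simp: o_def inj_def)
  have "z \<in> range int \<union> range (\<lambda>n. - int n)" for z
    by (cases z rule: int_cases2) auto
  hence "range int \<union> range (\<lambda>n. - int n) = UNIV" by blast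
  thus ?thesis using summable_on_union[OF 1 2] by simp
qed

text \<open>Take m = n -> infinity in \<open>J_finite\<close>; the q-binomial coefficients are
  uniformly bounded, so a multiple of the norm of \<open>J x\<close> dominates.\<close>

theorem jacobi_triple:
  assumes x: "x \<noteq> 0"
  shows "(J x has_sum qpinf x q * qpinf (q / x) q * qpinf q q) UNIV"
proof -
  obtain C where C: "C \<ge> 1" "\<And>n. norm (fq n) \<le> C" "\<And>n. norm (iq n) \<le> C" using fq_iq_bound by blast
  let ?f = "\<lambda>n k. J x k * (fq (int n + int n) * iq (int n - k) * iq (int n + k))"
  have s: "(\<lambda>k. norm (J x k) * (C * C * C)) summable_on UNIV"
    by (rule summable_on_cmult_left[OF summable_on_iff_abs_summable_on_complex[THEN iffD1, OF J_summable[OF x]]])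
  have b: "norm (?f n k) \<le> norm (J x k) * (C * C * C)" for n k
    unfolding norm_mult by (intro mult_left_mono mult_mono C mult_nonneg_nonneg norm_ge_zero) (use C(1) in auto)
  have "(\<lambda>n. J x k * (fq (int n + int n) * iq (int n + (- k)) * iq (int n + k))) \<longlonglongrightarrow> J x k * (qpinf q q * (1 / qpinf q q) * (1 / qpinf q q))" for k
    by (intro tendsto_mult tendsto_const fq_lim2 iq_lim)
  hence l: "(\<lambda>n. ?f n k) \<longlonglongrightarrow> J x k * (1 / qpinf q q)" for k using qpinf_nz by simp
  have "infsum (?f n) UNIV = qpoch x q n * qpoch (q / x) q n" for n
    by (rule infsumI[OF J_finite[OF x]])
  hence "(\<lambda>n. qpoch x q n * qpoch (q / x) q n) \<longlonglongrightarrow> (\<Sum>\<^sub>\<infinity>k. J x k * (1 / qpinf q q))"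
    using infsum_dominated_convergence(2)[OF s b l] by simp
  moreover have "(\<lambda>n. qpoch x q n * qpoch (q / x) q n) \<longlonglongrightarrow> qpinf x q * qpinf (q / x) q"
    by (intro tendsto_mult qpoch_lim q_lt1)
  ultimately have "(\<Sum>\<^sub>\<infinity>k. J x k * (1 / qpinf q q)) = qpinf x q * qpinf (q / x) q"
    using LIMSEQ_unique by blast
  hence "infsum (J x) UNIV = qpinf x q * qpinf (q / x) q * qpinf q q"
    using qpinf_nz by (simp only: infsum_cmult_left') (simp add: field_simps)
  thus ?thesis using has_sum_infsum[OF J_summable[OF x]] by simp
qed

end

section \<open>The Macdonald identity of type A2\<close>

lemma qpoch_split3: "qpoch p (p^3) n * qpoch (p^2) (p^3) n * qpoch (p^3) (p^3) n = qpoch p p (3 * n)"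
proof (induction n)
  case (Suc n)
  have "3 * Suc n = Suc (Suc (Suc (3 * n)))" by simp
  hence "qpoch p p (3 * Suc n) = qpoch p p (3 * n) * (1 - p * p ^ (3 * n)) * (1 - p * p ^ Suc (3 * n)) * (1 - p * p ^ Suc (Suc (3 * n)))"
    by (simp only: qpoch_def prod.lessThan_Suc)
  moreover have "qpoch x (p^3) (Suc n) = qpoch x (p^3) n * (1 - x * p ^ (3 * n))" for x
    by (simp add: qpoch_def power_mult)
  ultimately show ?case unfolding Suc[symmetric] by (simp add: power2_eq_square power3_eq_cube mult_ac)
qed (simp add: qpoch_def)

lemma qpinf_split3:
  assumes "norm p < 1" shows "qpinf p (p^3) * qpinf (p^2) (p^3) * qpinf (p^3) (p^3) = qpinf p p"
proof -
  have "norm (p^3) < 1" using assms by (simp add: norm_power power_less_one_iff)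
  hence "(\<lambda>n. qpoch p (p^3) n * qpoch (p^2) (p^3) n * qpoch (p^3) (p^3) n) \<longlonglongrightarrow> qpinf p (p^3) * qpinf (p^2) (p^3) * qpinf (p^3) (p^3)"
    by (intro tendsto_mult qpoch_lim)
  moreover have "(\<lambda>n. qpoch p p (3 * n)) \<longlonglongrightarrow> qpinf p p"
    using LIMSEQ_subseq_LIMSEQ[OF qpoch_lim[OF assms, of p], of "\<lambda>n. 3 * n"] by (simp add: strict_mono_def o_def)
  ultimately show ?thesis unfolding qpoch_split3 using LIMSEQ_unique by blast
qed

lemma qpinf_1: assumes "norm p < 1" shows "qpinf 1 p = 0"
proof -
  have "qpoch 1 p (Suc n) = 0" for n by (simp add: qpoch_def prod.lessThan_Suc_shift del: prod.lessThan_Suc)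
  hence "(\<lambda>n. qpoch 1 p (Suc n)) \<longlonglongrightarrow> 0" by simp
  hence "(\<lambda>n. qpoch 1 p n) \<longlonglongrightarrow> 0" by (rule LIMSEQ_imp_Suc)
  thus ?thesis using qpoch_lim[OF assms] LIMSEQ_unique by blast
qed

text \<open>Exponents with \<open>tri\<close> are compared after doubling, and those with
  \<open>gq\<close> after multiplication by 6, so that no division remains.\<close>

lemma int_cancel2: "(2 :: int) * a = 2 * b \<Longrightarrow> a = b"
  by simp

lemma int_cancel6: "(6 :: int) * a = 2 * (h - 1) \<Longrightarrow> h = 3 * g + 1 \<Longrightarrow> a = g"
  by simp

lemma sg_4: "sg (4 * n + r) = sg r"
proof -
  have "sg (4 * n) = 1" by (subst power_int_mult) simp
  thus ?thesis by (simp add: sg_add)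
qed

context qbase begin

text \<open>These are triple products with base q^3 at x = q^2, q and 1. The first two combine to
  Euler's product, which is the pentagonal number theorem; the third contains the factor 1 -
  1.\<close>

lemma pent_sum:
  assumes "r \<in> {0, 1, 2}"
  shows "((\<lambda>n. sg n * q powi (3 * tri n + (2 - r) * n)) has_sum (if r = 2 then 0 else qpinf q q)) UNIV"
proof -
  have q3: "norm (q^3) < 1" using q_lt1 by (simp add: norm_power power_less_one_iff)
  interpret c: qbase "q^3" using q_nz q3 by unfold_locales auto
  have x: "q powi (2 - r) \<noteq> 0" using q_nz by simp
  have J: "c.J (q powi (2 - r)) n = sg n * q powi (3 * tri n + (2 - r) * n)" for n
  proof -
    have "(q^3) powi tri n = q powi (3 * tri n)" using power_int_mult[of q 3 "tri n"] by simp
    moreover have "(q powi (2 - r)) powi n = q powi ((2 - r) * n)" by (simp add: power_int_mult)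
    ultimately show ?thesis unfolding c.J_def qpi_add by simp
  qed
  have "qpinf (q powi (2 - r)) (q^3) * qpinf (q^3 / q powi (2 - r)) (q^3) * qpinf (q^3) (q^3) = (if r = 2 then 0 else qpinf q q)"
  proof -
    have d: "q^3 / q^2 = q" "q^3 / q = q^2" using q_nz by (simp_all add: power2_eq_square power3_eq_cube)
    consider "r = 0" | "r = 1" | "r = 2" using assms by auto
    thus ?thesis
    proof cases
      case 1 thus ?thesis using qpinf_split3[OF q_lt1] by (simp add: d mult_ac)
    next
      case 2 thus ?thesis using qpinf_split3[OF q_lt1] by (simp add: d mult_ac)
    next
      case 3 thus ?thesis using qpinf_1[OF q3] by simp
    qed
  qed
  thus ?thesis using c.jacobi_triple[OF x] unfolding J by simp
qed

text \<open>Moving n by \<tau> changes the linear coefficient by 3 \<tau>, so only the residue of t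
  modulo 3 matters, up to a sign and a power of q.\<close>

lemma pent_shift:
  assumes t: "t = 3 * \<tau> + r" and r: "r \<in> {0, 1, 2}"
  shows "((\<lambda>n. sg n * q powi (3 * tri n + (2 - t) * n)) has_sum
     sg \<tau> * q powi (- 3 * tri \<tau> - (1 + r) * \<tau>) * (if r = 2 then 0 else qpinf q q)) UNIV"
proof -
  let ?E = "- 3 * tri \<tau> - (1 + r) * \<tau>"
  have "((\<lambda>n. sg \<tau> * q powi ?E * (sg (n + - \<tau>) * q powi (3 * tri (n + - \<tau>) + (2 - r) * (n + - \<tau>)))) has_sum
     sg \<tau> * q powi ?E * (if r = 2 then 0 else qpinf q q)) UNIV"
    by (rule has_sum_shift_int[OF has_sum_cmult_right[OF pent_sum[OF r]]])
  moreover have "sg \<tau> * q powi ?E * (sg (n + - \<tau>) * q powi (3 * tri (n + - \<tau>) + (2 - r) * (n + - \<tau>))) = sg n * q powi (3 * tri n + (2 - t) * n)" for n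
  proof -
    have "2 * (?E + (3 * tri (n + - \<tau>) + (2 - r) * (n + - \<tau>))) = 2 * (3 * tri n + (2 - t) * n)"
      using tri2[of \<tau>] tri2[of n] tri2[of "n + - \<tau>"] unfolding t by (simp add: algebra_simps)
    hence e: "?E + (3 * tri (n + - \<tau>) + (2 - r) * (n + - \<tau>)) = 3 * tri n + (2 - t) * n" by (rule int_cancel2)
    have s: "sg \<tau> * sg (n + - \<tau>) = sg n" by (simp add: sg_add[symmetric])
    show ?thesis unfolding e[symmetric] s[symmetric] qpi_add[of ?E] by (simp only: mult_ac)
  qed
  ultimately show ?thesis by simp
qed

definition th :: "complex \<Rightarrow> complex" where
  "th x = qpinf x q * qpinf (q / x) q"

text \<open>Expand the three theta functions; after the substitution \<open>(l, m) = (X - n, Y - n)\<close> the sum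
  over \<open>n\<close> is a shifted pentagonal number sum, which produces the character \<open>chi\<close>.\<close>

theorem macdonald_A2:
  assumes u: "u \<noteq> 0" and v: "v \<noteq> 0"
  shows "((\<lambda>(\<xi>, \<eta>). chi (\<xi> + \<eta>) * q powi gq \<xi> \<eta> * u powi \<xi> * v powi \<eta>) has_sum
    qpinf q q ^ 2 * (th u * th v * th (u * v)) / (u * v)) UNIV"
proof -
  define Q where "Q = qpinf q q"
  have Q: "Q \<noteq> 0" using qpinf_nz by (simp add: Q_def)
  define S where "S = th u * Q * (th v * Q) * (th (u * v) * Q)"
  have uv: "u * v \<noteq> 0" using u v by simp
  have SS: "((\<lambda>(x, y). (\<lambda>(x, y). J u x * J v y) x * J (u * v) y) has_sum S) UNIV"
    unfolding S_def th_def Q_def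
    using has_sum_times[OF has_sum_times[OF jacobi_triple[OF u] jacobi_triple[OF v]] jacobi_triple[OF uv]] by simp
  have bij: "bij (\<lambda>((X, Y), n). ((X - n, Y - n), n) :: (int \<times> int) \<times> int)"
    by (rule bij_betw_byWitness[where f' = "\<lambda>((X, Y), n). ((X + n, Y + n), n)"]) auto
  have "((\<lambda>p. (\<lambda>(x, y). (\<lambda>(x, y). J u x * J v y) x * J (u * v) y) ((\<lambda>((X, Y), n). ((X - n, Y - n), n)) p)) has_sum S) UNIV"
    by (rule has_sum_bij[OF bij SS])
  hence A: "((\<lambda>((X, Y), n). J u (X - n) * J v (Y - n) * J (u * v) n) has_sum S) (UNIV \<times> UNIV)"
    by (simp add: case_prod_unfold)
  \<comment> \<open>Completing the square centres the quadratic form at (1, 1). Undoing this shift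
    at the end produces the denominator u v.\<close>
  define G where "G = (\<lambda>(X, Y). chi ((X - 1) + (Y - 1)) * q powi gq (X - 1) (Y - 1) * (u powi X * v powi Y) * Q)"
  have B: "(G has_sum S) UNIV"
  proof (rule has_sum_SigmaD[OF A])
    fix p :: "int \<times> int"
    obtain X Y where p: "p = (X, Y)" by (cases p)
    define t \<tau> r where "t = X + Y" and "\<tau> = t div 3" and "r = t mod 3"
    have t: "t = 3 * \<tau> + r" by (simp add: \<tau>_def r_def)
    have r: "r \<in> {0, 1, 2}" proof -
      have "r = 0 \<or> r = 1 \<or> r = 2" unfolding r_def by presburger
      thus ?thesis by simp
    qed
    define c where "c = sg t * q powi (tri X + tri Y) * (u powi X * v powi Y)"
    have trm: "J u (X - n) * J v (Y - n) * J (u * v) n = c * (sg n * q powi (3 * tri n + (2 - t) * n))" for n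
    proof -
      have "2 * (tri (X - n) + tri (Y - n) + tri n) = 2 * ((tri X + tri Y) + (3 * tri n + (2 - t) * n))"
        using tri2[of "X - n"] tri2[of "Y - n"] tri2[of n] tri2[of X] tri2[of Y] unfolding t_def by (simp add: algebra_simps)
      hence e: "tri (X - n) + tri (Y - n) + tri n = (tri X + tri Y) + (3 * tri n + (2 - t) * n)" by (rule int_cancel2)
      have s: "sg (X - n) * sg (Y - n) * sg n = sg t * sg n"
      proof -
        have "sg (X - n) * sg (Y - n) * sg n = sg (t + - n)" unfolding t_def by (simp add: sg_add[symmetric] algebra_simps)
        thus ?thesis by (simp only: sg_add sg_minus)
      qed
      have w: "u powi (X - n) * v powi (Y - n) * (u * v) powi n = u powi X * v powi Y"
        using u v by (simp add: power_int_mult_distrib power_int_diff)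
      have "J u (X - n) * J v (Y - n) * J (u * v) n = (sg (X - n) * sg (Y - n) * sg n) * (q powi tri (X - n) * q powi tri (Y - n) * q powi tri n) *
          (u powi (X - n) * v powi (Y - n) * (u * v) powi n)"
        unfolding J_def by (simp only: mult_ac)
      also have "q powi tri (X - n) * q powi tri (Y - n) * q powi tri n = q powi (tri X + tri Y) * q powi (3 * tri n + (2 - t) * n)"
        unfolding qpi_add[symmetric] e ..
      finally show ?thesis unfolding s w c_def by (simp only: mult_ac)
    qed
    have "((\<lambda>n. c * (sg n * q powi (3 * tri n + (2 - t) * n))) has_sum
      c * (sg \<tau> * q powi (- 3 * tri \<tau> - (1 + r) * \<tau>) * (if r = 2 then 0 else Q))) UNIV"
      unfolding Q_def by (intro has_sum_cmult_right pent_shift[OF t r])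
    moreover have "c * (sg \<tau> * q powi (- 3 * tri \<tau> - (1 + r) * \<tau>) * (if r = 2 then 0 else Q)) = G p"
    proof -
      \<comment> \<open>This index is r + 1 modulo 3, so \<open>chi\<close> vanishes exactly in the
        class r = 2 in which the pentagonal sum is 0.\<close>
      have "(X - 1) + (Y - 1) = (r + 1) + 3 * (\<tau> - 1)" using t by (simp add: t_def)
      hence ch: "chi ((X - 1) + (Y - 1)) = chi (r + 1)" by (simp only: chi_add3)
      show ?thesis
      proof (cases "r = 2")
        case True
        thus ?thesis unfolding p G_def split ch by (simp add: chi_def)
      next
        case False
        hence r01: "r = 0 \<or> r = 1" using r by auto
        have cs: "chi (r + 1) = sg r" using r01 by (auto simp: chi_def)
        have "chi ((X - 1) + (Y - 1)) \<noteq> 0" unfolding ch cs by simp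
        hence h: "hq (X - 1) (Y - 1) = 3 * gq (X - 1) (Y - 1) + 1" by (rule hq_gq)
        have Y: "Y = 3 * \<tau> + r - X" using t by (simp add: t_def)
        have rr: "r * r = r" using r01 by auto
        \<comment> \<open>The multiplier 6 clears the halves in \<open>tri\<close> and the third in
          \<open>gq\<close>; since r is 0 or 1, r^2 may be replaced by r.\<close>
        have "6 * ((tri X + tri Y) + (- 3 * tri \<tau> - (1 + r) * \<tau>)) = 3 * (X * (X - 1)) + 3 * (Y * (Y - 1)) - 9 * (\<tau> * (\<tau> - 1)) - 6 * (1 + r) * \<tau>"
          using tri2[of X] tri2[of Y] tri2[of \<tau>] by (simp add: algebra_simps)
        also have "\<dots> = 2 * (hq (X - 1) (Y - 1) - 1)"
          unfolding hq_def Y using rr by (simp add: power2_eq_square algebra_simps)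
        finally have e: "(tri X + tri Y) + (- 3 * tri \<tau> - (1 + r) * \<tau>) = gq (X - 1) (Y - 1)" using h by (rule int_cancel6)
        \<comment> \<open>As t + \<tau> = 4 \<tau> + r, the sign is (-1)^r, which is the value of
          the character at r + 1.\<close>
        have s: "sg t * sg \<tau> = chi (r + 1)"
        proof -
          have "sg t * sg \<tau> = sg (4 * \<tau> + r)" unfolding sg_add[symmetric] t by (simp add: algebra_simps)
          thus ?thesis by (simp only: sg_4 cs)
        qed
        have "c * (sg \<tau> * q powi (- 3 * tri \<tau> - (1 + r) * \<tau>) * Q) = (sg t * sg \<tau>) * (q powi (tri X + tri Y) * q powi (- 3 * tri \<tau> - (1 + r) * \<tau>)) * (u powi X * v powi Y) * Q"
          unfolding c_def by (simp only: mult_ac)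
        also have "\<dots> = G p" unfolding p G_def split ch qpi_add[symmetric] e s ..
        finally show ?thesis using False by simp
      qed
    qed
    ultimately show "((\<lambda>n. (\<lambda>((X, Y), n). J u (X - n) * J v (Y - n) * J (u * v) n) (p, n)) has_sum G p) UNIV"
      unfolding p split trm by simp
  qed
  have bij2: "bij (\<lambda>(\<xi>, \<eta>). (\<xi> + 1, \<eta> + 1) :: int \<times> int)"
    by (rule bij_betw_byWitness[where f' = "\<lambda>(X, Y). (X - 1, Y - 1)"]) auto
  have "((\<lambda>p. 1 / (u * v * Q) * G ((\<lambda>(\<xi>, \<eta>). (\<xi> + 1, \<eta> + 1)) p)) has_sum 1 / (u * v * Q) * S) UNIV"
    by (intro has_sum_cmult_right has_sum_bij[OF bij2] B)
  moreover have "1 / (u * v * Q) * G ((\<lambda>(\<xi>, \<eta>). (\<xi> + 1, \<eta> + 1)) p) = (\<lambda>(\<xi>, \<eta>). chi (\<xi> + \<eta>) * q powi gq \<xi> \<eta> * u powi \<xi> * v powi \<eta>) p" for p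
    using u v Q by (cases p) (simp add: G_def power_int_add field_simps)
  moreover have "1 / (u * v * Q) * S = Q ^ 2 * (th u * th v * th (u * v)) / (u * v)"
    using u v Q by (simp add: S_def field_simps power2_eq_square)
  ultimately show ?thesis by (simp add: Q_def)
qed

end

section \<open>Bailey steps\<close>

lemma bij_betw_PiE_Suc:
  "bij_betw (\<lambda>(r, s). r(Suc n := s)) (PiE {1..n} (\<lambda>_. UNIV) \<times> UNIV) (PiE {1..Suc n} (\<lambda>_. UNIV))"
proof (rule bij_betw_byWitness[where f' = "\<lambda>r. (r(Suc n := undefined), r (Suc n))"])
  show "\<forall>p\<in>PiE {1..n} (\<lambda>_. UNIV) \<times> UNIV. (\<lambda>r. (r(Suc n := undefined), r (Suc n))) ((\<lambda>(r, s). r(Suc n := s)) p) = p"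
    by (auto simp: fun_eq_iff PiE_def extensional_def)
  show "(\<lambda>(r, s). r(Suc n := s)) ` (PiE {1..n} (\<lambda>_. UNIV) \<times> UNIV) \<subseteq> PiE {1..Suc n} (\<lambda>_. UNIV)"
    by (auto simp: PiE_def extensional_def)
  show "(\<lambda>r. (r(Suc n := undefined), r (Suc n))) ` PiE {1..Suc n} (\<lambda>_. UNIV) \<subseteq> PiE {1..n} (\<lambda>_. UNIV) \<times> UNIV"
    by (auto simp: PiE_def extensional_def)
qed auto

text \<open>Splits off the variable of highest index, the innermost one of the theorem. Summability
  is handed down to the shorter tuple, so it has to be proved only once, for the full tuple.\<close>

lemma has_sum_PiE_Suc:
  fixes F :: "(nat \<Rightarrow> 'a) \<Rightarrow> complex"
  assumes "F summable_on PiE {1..Suc n} (\<lambda>_. UNIV)"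
    and "\<And>r. ((\<lambda>s. F (r(Suc n := s))) has_sum G r) UNIV"
  shows "G summable_on PiE {1..n} (\<lambda>_. UNIV)"
    and "(F has_sum infsum G (PiE {1..n} (\<lambda>_. UNIV))) (PiE {1..Suc n} (\<lambda>_. UNIV))"
proof -
  obtain T where T: "(F has_sum T) (PiE {1..Suc n} (\<lambda>_. UNIV))" using assms(1) by (auto simp: summable_on_def)
  have "((\<lambda>p. F ((\<lambda>(r, s). r(Suc n := s)) p)) has_sum T) (PiE {1..n} (\<lambda>_. UNIV) \<times> UNIV)"
    using has_sum_reindex_bij_betw[OF bij_betw_PiE_Suc[of n], of F T] T by simp
  hence "(G has_sum T) (PiE {1..n} (\<lambda>_. UNIV))"
    by (rule has_sum_SigmaD) (simp add: assms(2))
  thus "G summable_on PiE {1..n} (\<lambda>_. UNIV)" "(F has_sum infsum G (PiE {1..n} (\<lambda>_. UNIV))) (PiE {1..Suc n} (\<lambda>_. UNIV))"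
    using T by (auto simp: infsumI has_sum_imp_summable)
qed

lemma prod_PiE_summable:
  fixes g :: "'a \<Rightarrow> complex" and n :: nat
  assumes "g summable_on UNIV"
  shows "(\<lambda>r. \<Prod>j\<in>{1..n}. g (r j)) summable_on PiE {1..n} (\<lambda>_. UNIV)"
proof (induction n)
  case (Suc n)
  have "(\<lambda>(r, s). (\<Prod>j\<in>{1..n}. g (r j)) * g s) summable_on (PiE {1..n} (\<lambda>_. UNIV) \<times> UNIV)"
    using has_sum_times[OF has_sum_infsum[OF Suc] has_sum_infsum[OF assms]] by (rule has_sum_imp_summable)
  also have "(\<lambda>(r, s). (\<Prod>j\<in>{1..n}. g (r j)) * g s) = (\<lambda>p. (\<lambda>r. \<Prod>j\<in>{1..Suc n}. g (r j)) ((\<lambda>(r, s). r(Suc n := s)) p))"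
    by (auto simp: fun_eq_iff intro!: prod.cong)
  finally show ?case using summable_on_reindex_bij_betw[OF bij_betw_PiE_Suc[of n], of "\<lambda>r. \<Prod>j\<in>{1..Suc n}. g (r j)"] by simp
qed simp

lemma norm_bound_summable:
  fixes f g :: "'a \<Rightarrow> complex"
  assumes "g summable_on A" "\<And>x. x \<in> A \<Longrightarrow> norm (f x) \<le> norm (g x)"
  shows "f summable_on A"
  using Infinite_Sum.abs_summable_on_comparison_test[of g A f] assms
  by (simp add: summable_on_iff_abs_summable_on_complex)

lemma geometric_lattice_summable:
  fixes c :: real
  assumes "0 \<le> c" "c < 1"
  shows "(\<lambda>(x, y). if 0 \<le> x \<and> 0 \<le> y then complex_of_real (c ^ nat (x + y)) else 0) summable_on (UNIV :: (int \<times> int) set)"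
proof -
  define a :: "int \<Rightarrow> complex" where "a = (\<lambda>x. if 0 \<le> x then complex_of_real (c ^ nat x) else 0)"
  have "(\<lambda>n::nat. complex_of_real (c ^ n)) summable_on UNIV"
    by (rule norm_summable_imp_summable_on) (use assms in \<open>auto simp: norm_power intro!: summable_geometric\<close>)
  hence "a summable_on range int" by (subst summable_on_reindex) (auto simp: o_def a_def)
  moreover have "a summable_on UNIV \<longleftrightarrow> a summable_on range int"
  proof (rule summable_on_cong_neutral)
    fix x assume "x \<in> UNIV - range int"
    hence "\<not> 0 \<le> x" by (metis DiffD2 nonneg_int_cases rangeI)
    thus "a x = 0" by (simp add: a_def)
  qed auto
  ultimately have a: "a summable_on UNIV" by simp
  have "(\<lambda>(x, y). a x * a y) summable_on (UNIV \<times> UNIV)"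
    by (rule has_sum_imp_summable[OF has_sum_times[OF has_sum_infsum[OF a] has_sum_infsum[OF a]]])
  moreover have "(\<lambda>(x, y). a x * a y) = (\<lambda>(x, y). if 0 \<le> x \<and> 0 \<le> y then complex_of_real (c ^ nat (x + y)) else 0)"
    by (auto simp: fun_eq_iff a_def nat_add_distrib power_add)
  ultimately show ?thesis by simp
qed

section \<open>One Bailey step for each of the three kernels\<close>

context qbase begin

text \<open>\<open>bailey_kernel\<close> applied under a lattice sum: the coefficient at a lattice
  point only acquires q to the power minus the second elementary symmetric polynomial of the shifted
  coordinates.\<close>

lemma bailey_step:
  fixes c :: "int \<Rightarrow> int \<Rightarrow> complex" and a b M N :: int
  defines "e \<equiv> (\<lambda>\<xi> \<eta>. - ((\<xi> + a) * (\<eta> - \<xi>) + (\<eta> - \<xi>) * (- \<eta> + b) + (- \<eta> + b) * (\<xi> + a)))"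
  shows "((\<lambda>(r, s). q powi (r\<^sup>2 - r * s + s\<^sup>2 - (a + b) * (r - s)) * iq (M - r) * iq (N - s) *
       (\<Sum>\<^sub>\<infinity>(\<xi>, \<eta>). c \<xi> \<eta> * K r s (\<xi> + a) (\<eta> - \<xi>) (- \<eta> + b))) has_sum
     (\<Sum>\<^sub>\<infinity>(\<xi>, \<eta>). c \<xi> \<eta> * q powi (e \<xi> \<eta>) * K M N (\<xi> + a) (\<eta> - \<xi>) (- \<eta> + b))) UNIV"
proof -
  define k where "k = (\<lambda>r s \<xi> \<eta>. K r s (\<xi> + a) (\<eta> - \<xi>) (- \<eta> + b))"
  define E where "E = (\<lambda>r s. q powi (r\<^sup>2 - r * s + s\<^sup>2 - (a + b) * (r - s)) * iq (M - r) * iq (N - s))"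
  define f where "f = (\<lambda>(r, s) (\<xi>, \<eta>). E r s * (c \<xi> \<eta> * k r s \<xi> \<eta>))"
  have k0: "\<xi> \<in> {- s - a..r - a} \<and> \<eta> \<in> {b - r..b + s} \<and> - s \<le> \<xi> + a \<and> \<xi> + a \<le> r" if "k r s \<xi> \<eta> \<noteq> 0" for r s \<xi> \<eta>
  proof -
    have "- s \<le> \<xi> + a \<and> \<xi> + a \<le> r \<and> - s \<le> \<eta> - \<xi> \<and> \<eta> - \<xi> \<le> r \<and> - s \<le> - \<eta> + b \<and> - \<eta> + b \<le> r"
      using K_0[of s "\<xi> + a" r "\<eta> - \<xi>" "- \<eta> + b"] that unfolding k_def by blast
    thus ?thesis by auto
  qed
  have E0: "r \<le> M \<and> s \<le> N" if "E r s \<noteq> 0" for r s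
    using that by (cases "r \<le> M"; cases "s \<le> N") (simp_all add: E_def iq_neg)
  have ks: "(\<lambda>(\<xi>, \<eta>). d \<xi> \<eta> * k r s \<xi> \<eta>) summable_on UNIV" for d :: "int \<Rightarrow> int \<Rightarrow> complex" and r s
  proof (rule finite_supp_summable)
    show "finite ({- s - a..r - a} \<times> {b - r..b + s})" by simp
    fix p assume p: "p \<notin> {- s - a..r - a} \<times> {b - r..b + s}"
    obtain \<xi> \<eta> where [simp]: "p = (\<xi>, \<eta>)" by (cases p)
    have "k r s \<xi> \<eta> = 0" using k0[of r s \<xi> \<eta>] p by auto
    thus "(case p of (\<xi>, \<eta>) \<Rightarrow> d \<xi> \<eta> * k r s \<xi> \<eta>) = 0" by simp
  qed
  \<comment> \<open>The factors in \<open>E\<close> bound r and s from above only. The lower bounds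
    come from the kernel, whose box is empty unless - s \<le> r.\<close>
  have S: "(\<lambda>(x, y). f x y) summable_on UNIV"
  proof (rule finite_supp_summable)
    show "finite (({- N..M} \<times> {- M..N}) \<times> ({- N - a..M - a} \<times> {b - M..b + N}))" by simp
    fix p assume p: "p \<notin> (({- N..M} \<times> {- M..N}) \<times> ({- N - a..M - a} \<times> {b - M..b + N}))"
    obtain r s \<xi> \<eta> where [simp]: "p = ((r, s), (\<xi>, \<eta>))" by (metis prod.exhaust)
    show "(\<lambda>(x, y). f x y) p = 0"
    proof (rule ccontr)
      assume "(\<lambda>(x, y). f x y) p \<noteq> 0"
      hence "E r s \<noteq> 0" "k r s \<xi> \<eta> \<noteq> 0" by (auto simp: f_def)
      from E0[OF this(1)] k0[OF this(2)] have "- N \<le> r \<and> r \<le> M \<and> - M \<le> s \<and> s \<le> N \<and> - N - a \<le> \<xi> \<and> \<xi> \<le> M - a \<and> b - M \<le> \<eta> \<and> \<eta> \<le> b + N" by auto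
      thus False using p by auto
    qed
  qed
  have 1: "(f x has_sum (\<lambda>(r, s). E r s * (\<Sum>\<^sub>\<infinity>(\<xi>, \<eta>). c \<xi> \<eta> * k r s \<xi> \<eta>)) x) UNIV" for x
  proof (cases x)
    case (Pair r s)
    have "((\<lambda>y. E r s * (\<lambda>(\<xi>, \<eta>). c \<xi> \<eta> * k r s \<xi> \<eta>) y) has_sum E r s * (\<Sum>\<^sub>\<infinity>(\<xi>, \<eta>). c \<xi> \<eta> * k r s \<xi> \<eta>)) UNIV"
      by (intro has_sum_cmult_right has_sum_infsum ks)
    thus ?thesis unfolding Pair f_def by (simp add: case_prod_unfold)
  qed
  have 2: "((\<lambda>x. f x y) has_sum (\<lambda>(\<xi>, \<eta>). c \<xi> \<eta> * q powi (e \<xi> \<eta>) * k M N \<xi> \<eta>) y) UNIV" for y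
  proof (cases y)
    case (Pair \<xi> \<eta>)
    have ab: "(\<xi> + a) + (\<eta> - \<xi>) + (- \<eta> + b) = a + b" by simp
    have "((\<lambda>(r, s). E r s * k r s \<xi> \<eta>) has_sum q powi (e \<xi> \<eta>) * k M N \<xi> \<eta>) UNIV"
      using bailey_kernel[of "\<xi> + a" "\<eta> - \<xi>" "- \<eta> + b" M N, unfolded ab] unfolding E_def k_def e_def .
    hence B: "((\<lambda>x. c \<xi> \<eta> * (\<lambda>(r, s). E r s * k r s \<xi> \<eta>) x) has_sum c \<xi> \<eta> * (q powi (e \<xi> \<eta>) * k M N \<xi> \<eta>)) UNIV"
      by (rule has_sum_cmult_right)
    have A: "c \<xi> \<eta> * (\<lambda>(r, s). E r s * k r s \<xi> \<eta>) x = f x y" for x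
      unfolding Pair f_def by (cases x) (simp only: split mult_ac)
    show ?thesis using B unfolding A unfolding Pair split mult.assoc .
  qed
  have 3: "((\<lambda>(\<xi>, \<eta>). c \<xi> \<eta> * q powi (e \<xi> \<eta>) * k M N \<xi> \<eta>) has_sum (\<Sum>\<^sub>\<infinity>(\<xi>, \<eta>). c \<xi> \<eta> * q powi (e \<xi> \<eta>) * k M N \<xi> \<eta>)) UNIV"
    by (intro has_sum_infsum ks)
  show ?thesis using has_sum_fubini[OF S 1 2 3] unfolding E_def k_def .
qed

lemma cw_Suc: "cw n \<xi> \<eta> * q powi hq \<xi> \<eta> = cw (n + 1) \<xi> \<eta>"
proof -
  have "(n + 1) * hq \<xi> \<eta> + 2 * gq \<xi> \<eta> = n * hq \<xi> \<eta> + 2 * gq \<xi> \<eta> + hq \<xi> \<eta>" by (simp add: algebra_simps)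
  thus ?thesis unfolding cw_def by (simp only: qpi_add mult_ac)
qed

text \<open>Kernel sum for the variables that carry the linear term r_1 + r_2. The offsets M + 1, N
  + 1 generate that term.\<close>

definition SA :: "int \<Rightarrow> int \<times> int \<Rightarrow> complex" where
  "SA n = (\<lambda>(M, N). \<Sum>\<^sub>\<infinity>(\<xi>, \<eta>). cw n \<xi> \<eta> * q powi (\<xi> + \<eta>) * KY (M + 1) (N + 1) \<xi> \<eta>)"

text \<open>Kernel sum after the factor 1 - q^(r_1 + r_2 + 1) has been used: y is moved by the
  highest root (1, 0, -1), and m counts the accumulated powers of q^(y_1 - y_3).\<close>

definition SB :: "int \<Rightarrow> int \<Rightarrow> int \<times> int \<Rightarrow> complex" where
  "SB n m = (\<lambda>(M, N). \<Sum>\<^sub>\<infinity>(\<xi>, \<eta>). cw n \<xi> \<eta> * q powi (m * (\<xi> + \<eta>)) * K M N (\<xi> + 1) (\<eta> - \<xi>) (- \<eta> - 1))"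

text \<open>Kernel sum of the second family, taken at y + (0, 0, 1), a point off the root lattice
  with coordinate sum 1.\<close>

definition SU :: "int \<Rightarrow> int \<Rightarrow> int \<times> int \<Rightarrow> complex" where
  "SU n m = (\<lambda>(M, N). \<Sum>\<^sub>\<infinity>(\<xi>, \<eta>). cw n \<xi> \<eta> * q powi (- \<xi> - m * \<eta>) * K (M + 1) N \<xi> (\<eta> - \<xi>) (- \<eta> + 1))"

lemma bij_shift2: "bij (\<lambda>(r, s). (r + a, s + b) :: int \<times> int)"
  by (rule bij_betw_byWitness[where f' = "\<lambda>(r, s). (r - a, s - b)"]) auto

lemma bailey_step_shift:
  fixes c c' :: "int \<Rightarrow> int \<Rightarrow> complex" and a b M N \<alpha> \<beta> :: int
  assumes W: "\<And>r s. W r s = k0 * q powi ((r + \<alpha>)\<^sup>2 - (r + \<alpha>) * (s + \<beta>) + (s + \<beta>)\<^sup>2 - (a + b) * ((r + \<alpha>) - (s + \<beta>)))"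
    and e: "\<And>\<xi> \<eta>. c \<xi> \<eta> * q powi (- ((\<xi> + a) * (\<eta> - \<xi>) + (\<eta> - \<xi>) * (- \<eta> + b) + (- \<eta> + b) * (\<xi> + a))) = k1 * c' \<xi> \<eta>"
  shows "((\<lambda>(r, s). W r s * (iq (M - r) * iq (N - s)) *
       (\<Sum>\<^sub>\<infinity>(\<xi>, \<eta>). c \<xi> \<eta> * K (r + \<alpha>) (s + \<beta>) (\<xi> + a) (\<eta> - \<xi>) (- \<eta> + b))) has_sum
     k0 * (k1 * (\<Sum>\<^sub>\<infinity>(\<xi>, \<eta>). c' \<xi> \<eta> * K (M + \<alpha>) (N + \<beta>) (\<xi> + a) (\<eta> - \<xi>) (- \<eta> + b)))) UNIV"
proof -
  define F where "F = (\<lambda>(r, s). q powi (r\<^sup>2 - r * s + s\<^sup>2 - (a + b) * (r - s)) * iq ((M + \<alpha>) - r) * iq ((N + \<beta>) - s) *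
       (\<Sum>\<^sub>\<infinity>(\<xi>, \<eta>). c \<xi> \<eta> * K r s (\<xi> + a) (\<eta> - \<xi>) (- \<eta> + b)))"
  define S where "S = (\<Sum>\<^sub>\<infinity>(\<xi>, \<eta>). c \<xi> \<eta> * q powi (- ((\<xi> + a) * (\<eta> - \<xi>) + (\<eta> - \<xi>) * (- \<eta> + b) + (- \<eta> + b) * (\<xi> + a))) * K (M + \<alpha>) (N + \<beta>) (\<xi> + a) (\<eta> - \<xi>) (- \<eta> + b))"
  have "(F has_sum S) UNIV" unfolding F_def S_def by (rule bailey_step)
  hence A: "((\<lambda>p. k0 * F ((\<lambda>(r, s). (r + \<alpha>, s + \<beta>)) p)) has_sum k0 * S) UNIV"
    by (intro has_sum_cmult_right has_sum_bij[OF bij_shift2])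
  have 1: "k0 * F ((\<lambda>(r, s). (r + \<alpha>, s + \<beta>)) p) = (\<lambda>(r, s). W r s * (iq (M - r) * iq (N - s)) *
       (\<Sum>\<^sub>\<infinity>(\<xi>, \<eta>). c \<xi> \<eta> * K (r + \<alpha>) (s + \<beta>) (\<xi> + a) (\<eta> - \<xi>) (- \<eta> + b))) p" for p
  proof -
    obtain r s where p: "p = (r, s)" by (cases p)
    have i: "M + \<alpha> - (r + \<alpha>) = M - r" "N + \<beta> - (s + \<beta>) = N - s" by simp_all
    show ?thesis unfolding p F_def split W i by (simp only: mult.assoc)
  qed
  have "S = (\<Sum>\<^sub>\<infinity>p. k1 * (case p of (\<xi>, \<eta>) \<Rightarrow> c' \<xi> \<eta> * K (M + \<alpha>) (N + \<beta>) (\<xi> + a) (\<eta> - \<xi>) (- \<eta> + b)))"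
    unfolding S_def e by (intro infsum_cong) (simp add: case_prod_unfold)
  hence 2: "S = k1 * (\<Sum>\<^sub>\<infinity>(\<xi>, \<eta>). c' \<xi> \<eta> * K (M + \<alpha>) (N + \<beta>) (\<xi> + a) (\<eta> - \<xi>) (- \<eta> + b))"
    by (simp only: infsum_cmult_right')
  show ?thesis using A unfolding 1 2 .
qed

text \<open>hq (r + 1) (s + 1) = hq r s + r + s + 1: the offset of the kernel yields the linear
  term, and the constant 1 is the q^(-1) on the right.\<close>

lemma step_A:
  "((\<lambda>(r, s). q powi (hq r s + (r + s)) * (iq (M - r) * iq (N - s)) * SA n (r, s)) has_sum q powi (- 1) * SA (n + 1) (M, N)) UNIV"
proof -
  have "((\<lambda>(r, s). q powi (hq r s + (r + s)) * (iq (M - r) * iq (N - s)) *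
       (\<Sum>\<^sub>\<infinity>(\<xi>, \<eta>). (cw n \<xi> \<eta> * q powi (\<xi> + \<eta>)) * K (r + 1) (s + 1) (\<xi> + 0) (\<eta> - \<xi>) (- \<eta> + 0))) has_sum
     q powi (- 1) * (1 * (\<Sum>\<^sub>\<infinity>(\<xi>, \<eta>). (cw (n + 1) \<xi> \<eta> * q powi (\<xi> + \<eta>)) * K (M + 1) (N + 1) (\<xi> + 0) (\<eta> - \<xi>) (- \<eta> + 0)))) UNIV"
  proof (rule bailey_step_shift)
    fix r s :: int
    have "hq r s + (r + s) = - 1 + ((r + 1)\<^sup>2 - (r + 1) * (s + 1) + (s + 1)\<^sup>2 - (0 + 0) * (r + 1 - (s + 1)))"
      by (simp add: hq_def power2_eq_square algebra_simps)
    thus "q powi (hq r s + (r + s)) = q powi (- 1) * q powi ((r + 1)\<^sup>2 - (r + 1) * (s + 1) + (s + 1)\<^sup>2 - (0 + 0) * (r + 1 - (s + 1)))"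
      by (simp only: qpi_add)
  next
    fix \<xi> \<eta> :: int
    have "- ((\<xi> + 0) * (\<eta> - \<xi>) + (\<eta> - \<xi>) * (- \<eta> + 0) + (- \<eta> + 0) * (\<xi> + 0)) = hq \<xi> \<eta>"
      by (simp add: hq_def power2_eq_square algebra_simps)
    thus "(cw n \<xi> \<eta> * q powi (\<xi> + \<eta>)) * q powi (- ((\<xi> + 0) * (\<eta> - \<xi>) + (\<eta> - \<xi>) * (- \<eta> + 0) + (- \<eta> + 0) * (\<xi> + 0))) = 1 * (cw (n + 1) \<xi> \<eta> * q powi (\<xi> + \<eta>))"
      unfolding cw_Suc[symmetric] by (simp only: mult_ac mult_1_left)
  qed
  thus ?thesis unfolding SA_def split add_0_right mult_1_left .
qed

text \<open>At y + (1, 0, -1) the exponent gained is hq + (y_1 - y_3) + 1, so m grows with n and one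
  factor q comes out.\<close>

lemma step_B:
  "((\<lambda>(r, s). q powi (hq r s) * (iq (M - r) * iq (N - s)) * SB n m (r, s)) has_sum q * SB (n + 1) (m + 1) (M, N)) UNIV"
proof -
  have "((\<lambda>(r, s). q powi (hq r s) * (iq (M - r) * iq (N - s)) *
       (\<Sum>\<^sub>\<infinity>(\<xi>, \<eta>). (cw n \<xi> \<eta> * q powi (m * (\<xi> + \<eta>))) * K (r + 0) (s + 0) (\<xi> + 1) (\<eta> - \<xi>) (- \<eta> + - 1))) has_sum
     1 * (q * (\<Sum>\<^sub>\<infinity>(\<xi>, \<eta>). (cw (n + 1) \<xi> \<eta> * q powi ((m + 1) * (\<xi> + \<eta>))) * K (M + 0) (N + 0) (\<xi> + 1) (\<eta> - \<xi>) (- \<eta> + - 1)))) UNIV"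
  proof (rule bailey_step_shift)
    fix r s :: int
    show "q powi (hq r s) = 1 * q powi ((r + 0)\<^sup>2 - (r + 0) * (s + 0) + (s + 0)\<^sup>2 - (1 + - 1) * (r + 0 - (s + 0)))"
      by (simp add: hq_def)
  next
    fix \<xi> \<eta> :: int
    have e: "m * (\<xi> + \<eta>) + (- ((\<xi> + 1) * (\<eta> - \<xi>) + (\<eta> - \<xi>) * (- \<eta> + - 1) + (- \<eta> + - 1) * (\<xi> + 1))) = 1 + (hq \<xi> \<eta> + (m + 1) * (\<xi> + \<eta>))"
      by (simp add: hq_def power2_eq_square algebra_simps)
    have "q powi (m * (\<xi> + \<eta>)) * q powi (- ((\<xi> + 1) * (\<eta> - \<xi>) + (\<eta> - \<xi>) * (- \<eta> + - 1) + (- \<eta> + - 1) * (\<xi> + 1))) = q * (q powi hq \<xi> \<eta> * q powi ((m + 1) * (\<xi> + \<eta>)))"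
      unfolding qpi_add[symmetric] e unfolding qpi_add by simp
    thus "(cw n \<xi> \<eta> * q powi (m * (\<xi> + \<eta>))) * q powi (- ((\<xi> + 1) * (\<eta> - \<xi>) + (\<eta> - \<xi>) * (- \<eta> + - 1) + (- \<eta> + - 1) * (\<xi> + 1)))
      = q * (cw (n + 1) \<xi> \<eta> * q powi ((m + 1) * (\<xi> + \<eta>)))"
      unfolding cw_Suc[symmetric] mult.assoc by (simp only: mult.left_commute[of q "cw n \<xi> \<eta>"])
  qed
  thus ?thesis unfolding SB_def split add_0_right mult_1_left add_uminus_conv_diff .
qed

text \<open>With coordinate sum 1 the weight of \<open>bailey_kernel\<close> at (r + 1, s) is
  exactly hq r s + r, and the exponent gained is hq - \<eta>, with no constant left over.\<close>

lemma step_U: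
  "((\<lambda>(r, s). q powi (hq r s + r) * (iq (M - r) * iq (N - s)) * SU n m (r, s)) has_sum SU (n + 1) (m + 1) (M, N)) UNIV"
proof -
  have "((\<lambda>(r, s). q powi (hq r s + r) * (iq (M - r) * iq (N - s)) *
       (\<Sum>\<^sub>\<infinity>(\<xi>, \<eta>). (cw n \<xi> \<eta> * q powi (- \<xi> - m * \<eta>)) * K (r + 1) (s + 0) (\<xi> + 0) (\<eta> - \<xi>) (- \<eta> + 1))) has_sum
     1 * (1 * (\<Sum>\<^sub>\<infinity>(\<xi>, \<eta>). (cw (n + 1) \<xi> \<eta> * q powi (- \<xi> - (m + 1) * \<eta>)) * K (M + 1) (N + 0) (\<xi> + 0) (\<eta> - \<xi>) (- \<eta> + 1)))) UNIV"
  proof (rule bailey_step_shift)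
    fix r s :: int
    have "(r + 1)\<^sup>2 - (r + 1) * (s + 0) + (s + 0)\<^sup>2 - (0 + 1) * (r + 1 - (s + 0)) = hq r s + r"
      by (simp add: hq_def power2_eq_square algebra_simps)
    thus "q powi (hq r s + r) = 1 * q powi ((r + 1)\<^sup>2 - (r + 1) * (s + 0) + (s + 0)\<^sup>2 - (0 + 1) * (r + 1 - (s + 0)))"
      by (simp only: mult_1_left)
  next
    fix \<xi> \<eta> :: int
    have e: "(- \<xi> - m * \<eta>) + - ((\<xi> + 0) * (\<eta> - \<xi>) + (\<eta> - \<xi>) * (- \<eta> + 1) + (- \<eta> + 1) * (\<xi> + 0)) = hq \<xi> \<eta> + (- \<xi> - (m + 1) * \<eta>)"
      by (simp add: hq_def power2_eq_square algebra_simps)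
    show "(cw n \<xi> \<eta> * q powi (- \<xi> - m * \<eta>)) * q powi (- ((\<xi> + 0) * (\<eta> - \<xi>) + (\<eta> - \<xi>) * (- \<eta> + 1) + (- \<eta> + 1) * (\<xi> + 0))) = 1 * (cw (n + 1) \<xi> \<eta> * q powi (- \<xi> - (m + 1) * \<eta>))"
      unfolding cw_Suc[symmetric] mult.assoc qpi_add[symmetric] e mult_1_left ..
  qed
  thus ?thesis unfolding SU_def split add_0_right mult_1_left .
qed

lemma SA_0: "SA 0 u = q powi (2 * fst u * snd u - 2) * iq (fst u) * iq (snd u) * iq (fst u + snd u + 1)"
  unfolding SA_def using seed_sum by (simp add: case_prod_unfold)

lemma SA_SB: "(1 - q powi (fst u + snd u + 1)) * SA n u = SB n 1 u"
  unfolding SA_def SB_def using kernel_B[OF antisymw_cw, of "fst u" "snd u" n] by (simp add: case_prod_unfold)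

lemma SU_0: "SU 0 1 u = - SA 0 u" "SU 0 0 u = - (q powi (snd u + 1)) * SA 0 u"
  unfolding SA_def SU_def using kernel_U0[OF antisymw_cw, of 0 "fst u" "snd u"] kernel_U1[OF antisymw_cw, of 0 "fst u" "snd u"]
  by (simp_all add: case_prod_unfold)

text \<open>The kernel is bounded uniformly in all arguments, so the coefficients themselves, up to
  a constant, dominate.\<close>

lemma kernel_sum_lim:
  assumes "(\<lambda>(\<xi>, \<eta>). c \<xi> \<eta>) summable_on UNIV"
  shows "(\<lambda>n. \<Sum>\<^sub>\<infinity>(\<xi>, \<eta>). c \<xi> \<eta> * K (int n + d) (int n + e) (x \<xi> \<eta>) (y \<xi> \<eta>) (z \<xi> \<eta>)) \<longlonglongrightarrow> (\<Sum>\<^sub>\<infinity>(\<xi>, \<eta>). c \<xi> \<eta>) / qpinf q q ^ 5"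
proof -
  obtain C where C: "C \<ge> 1" "\<And>M N x y z. norm (K M N x y z) \<le> C" using K_bound by blast
  have s: "(\<lambda>p. norm (case p of (\<xi>, \<eta>) \<Rightarrow> c \<xi> \<eta>) * C) summable_on UNIV"
    by (rule summable_on_cmult_left[OF summable_on_iff_abs_summable_on_complex[THEN iffD1, OF assms]])
  have "(\<lambda>n. infsum ((\<lambda>n (\<xi>, \<eta>). c \<xi> \<eta> * K (int n + d) (int n + e) (x \<xi> \<eta>) (y \<xi> \<eta>) (z \<xi> \<eta>)) n) UNIV) \<longlonglongrightarrow> infsum (\<lambda>p. (case p of (\<xi>, \<eta>) \<Rightarrow> c \<xi> \<eta>) * (1 / qpinf q q ^ 5)) UNIV"
  proof (rule infsum_dominated_convergence(2)[OF s])
    fix n p show "norm (case p of (\<xi>, \<eta>) \<Rightarrow> c \<xi> \<eta> * K (int n + d) (int n + e) (x \<xi> \<eta>) (y \<xi> \<eta>) (z \<xi> \<eta>)) \<le> norm (case p of (\<xi>, \<eta>) \<Rightarrow> c \<xi> \<eta>) * C"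
      by (cases p) (auto simp: norm_mult intro!: mult_left_mono C)
  next
    fix p show "(\<lambda>n. case p of (\<xi>, \<eta>) \<Rightarrow> c \<xi> \<eta> * K (int n + d) (int n + e) (x \<xi> \<eta>) (y \<xi> \<eta>) (z \<xi> \<eta>)) \<longlonglongrightarrow> (case p of (\<xi>, \<eta>) \<Rightarrow> c \<xi> \<eta>) * (1 / qpinf q q ^ 5)"
    proof -
      obtain \<xi> \<eta> where p: "p = (\<xi>, \<eta>)" by (cases p)
      show ?thesis unfolding p split by (intro tendsto_mult tendsto_const K_lim)
    qed
  qed
  moreover have "infsum (\<lambda>p. (case p of (\<xi>, \<eta>) \<Rightarrow> c \<xi> \<eta>) * (1 / qpinf q q ^ 5)) UNIV = (\<Sum>\<^sub>\<infinity>(\<xi>, \<eta>). c \<xi> \<eta>) / qpinf q q ^ 5"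
    by (subst infsum_cmult_left') simp
  ultimately show ?thesis by simp
qed

end

section \<open>Iteration and the main theorem\<close>

lemma bij_betw_PiE_1:
  "bij_betw (\<lambda>s. (\<lambda>_. undefined)(Suc 0 := s)) UNIV (PiE {1..Suc 0} (\<lambda>_. UNIV))"
  by (rule bij_betw_byWitness[where f' = "\<lambda>r. r (Suc 0)"]) (auto simp: fun_eq_iff PiE_def extensional_def)

context qbase begin

section \<open>Nested sums and their limit\<close>

definition chain :: "nat \<Rightarrow> (nat \<Rightarrow> int \<times> int \<Rightarrow> complex) \<Rightarrow> (int \<times> int \<Rightarrow> complex) \<Rightarrow> (nat \<Rightarrow> int \<times> int) \<Rightarrow> complex" where
  "chain n w B r = (\<Prod>j\<in>{1..n}. w j (r j)) *
     (\<Prod>j\<in>{1..n-1}. iq (fst (r j) - fst (r (j+1))) * iq (snd (r j) - snd (r (j+1)))) * B (r n)"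

lemma chain_Suc:
  assumes "n \<ge> 1"
  shows "chain (Suc n) w B (r(Suc n := s)) = (\<Prod>j\<in>{1..n}. w j (r j)) *
     (\<Prod>j\<in>{1..n-1}. iq (fst (r j) - fst (r (j+1))) * iq (snd (r j) - snd (r (j+1)))) *
     (w (Suc n) s * (iq (fst (r n) - fst s) * iq (snd (r n) - snd s)) * B s)"
proof -
  obtain m where n: "n = Suc m" using assms by (cases n) auto
  have G: "(\<Prod>j\<in>{1..Suc k}. f j) = (\<Prod>j\<in>{1..k}. f j) * f (Suc k)" for f :: "nat \<Rightarrow> complex" and k by simp
  have "(\<Prod>j\<in>{1..n}. w j ((r(Suc n := s)) j)) = (\<Prod>j\<in>{1..n}. w j (r j))" by (rule prod.cong) auto
  hence 1: "(\<Prod>j\<in>{1..Suc n}. w j ((r(Suc n := s)) j)) = (\<Prod>j\<in>{1..n}. w j (r j)) * w (Suc n) s"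
    unfolding G by simp
  have "(\<Prod>j\<in>{1..m}. iq (fst ((r(Suc n := s)) j) - fst ((r(Suc n := s)) (j+1))) * iq (snd ((r(Suc n := s)) j) - snd ((r(Suc n := s)) (j+1))))
     = (\<Prod>j\<in>{1..m}. iq (fst (r j) - fst (r (j+1))) * iq (snd (r j) - snd (r (j+1))))"
    by (rule prod.cong) (auto simp: n)
  hence 2: "(\<Prod>j\<in>{1..n}. iq (fst ((r(Suc n := s)) j) - fst ((r(Suc n := s)) (j+1))) * iq (snd ((r(Suc n := s)) j) - snd ((r(Suc n := s)) (j+1))))
     = (\<Prod>j\<in>{1..n-1}. iq (fst (r j) - fst (r (j+1))) * iq (snd (r j) - snd (r (j+1)))) * (iq (fst (r n) - fst s) * iq (snd (r n) - snd s))"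
    unfolding n G diff_Suc_1 by simp
  have "chain (Suc n) w B (r(Suc n := s)) = (\<Prod>j\<in>{1..Suc n}. w j ((r(Suc n := s)) j)) *
     (\<Prod>j\<in>{1..n}. iq (fst ((r(Suc n := s)) j) - fst ((r(Suc n := s)) (j+1))) * iq (snd ((r(Suc n := s)) j) - snd ((r(Suc n := s)) (j+1)))) * B s"
    unfolding chain_def diff_Suc_1 fun_upd_same ..
  thus ?thesis unfolding 1 2 by (simp only: mult_ac)
qed

text \<open>The sum collapses from the inside: summing over the variable of index Suc j turns
  \<open>B (Suc j)\<close> into \<open>B j\<close>. Variable 1 is kept, since no outer factor
  truncates it.\<close>

lemma chain_sum:
  assumes "n \<ge> 1" and "chain n w (B n) summable_on PiE {1..n} (\<lambda>_. UNIV)"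
    and "\<And>j M N. 1 \<le> j \<Longrightarrow> j < n \<Longrightarrow>
      ((\<lambda>(r, s). w (Suc j) (r, s) * (iq (M - r) * iq (N - s)) * B (Suc j) (r, s)) has_sum B j (M, N)) UNIV"
  shows "(\<lambda>v. w 1 v * B 1 v) summable_on UNIV
    \<and> (chain n w (B n) has_sum (\<Sum>\<^sub>\<infinity>v. w 1 v * B 1 v)) (PiE {1..n} (\<lambda>_. UNIV))"
  using assms
proof (induction n rule: nat_induct_at_least)
  case base
  have eq: "chain 1 w (B 1) ((\<lambda>_. undefined)(Suc 0 := s)) = w 1 s * B 1 s" for s by (simp add: chain_def)
  have s: "(\<lambda>v. w 1 v * B 1 v) summable_on UNIV"
    using summable_on_reindex_bij_betw[OF bij_betw_PiE_1, of "chain 1 w (B 1)"] base(1) unfolding eq by simp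
  from has_sum_infsum[OF s] have "(chain 1 w (B 1) has_sum (\<Sum>\<^sub>\<infinity>v. w 1 v * B 1 v)) (PiE {1..Suc 0} (\<lambda>_. UNIV))"
    using has_sum_reindex_bij_betw[OF bij_betw_PiE_1, of "chain 1 w (B 1)"] unfolding eq by simp
  thus ?case using s by simp
next
  case (Suc n)
  have A: "((\<lambda>s. chain (Suc n) w (B (Suc n)) (r(Suc n := s))) has_sum chain n w (B n) r) UNIV" for r
  proof -
    let ?c = "(\<Prod>j\<in>{1..n}. w j (r j)) * (\<Prod>j\<in>{1..n-1}. iq (fst (r j) - fst (r (j+1))) * iq (snd (r j) - snd (r (j+1))))"
    have "((\<lambda>p. ?c * (\<lambda>(x, y). w (Suc n) (x, y) * (iq (fst (r n) - x) * iq (snd (r n) - y)) * B (Suc n) (x, y)) p) has_sum ?c * B n (fst (r n), snd (r n))) UNIV"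
      by (intro has_sum_cmult_right Suc.prems) (use Suc.hyps in auto)
    thus ?thesis unfolding chain_Suc[OF Suc.hyps(1)] unfolding chain_def by (simp add: case_prod_unfold)
  qed
  note B = has_sum_PiE_Suc[OF Suc.prems(1) A]
  have I: "(\<lambda>v. w 1 v * B 1 v) summable_on UNIV
    \<and> (chain n w (B n) has_sum (\<Sum>\<^sub>\<infinity>v. w 1 v * B 1 v)) (PiE {1..n} (\<lambda>_. UNIV))"
    by (rule Suc.IH[OF B(1)]) (rule Suc.prems(2), auto)
  show ?case using I B(2) unfolding infsumI[OF conjunct2[OF I]] by blast
qed

text \<open>The step for j = 0 carries two extra factors \<open>iq (m - r)\<close> and
  \<open>iq (m - s)\<close>. As m grows they tend to 1 / \<open>qpinf q q\<close> each, and removing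
  them gives the square, which reduces the fifth power from the kernel to the cube of the
  theorem.\<close>

lemma chain_limit:
  assumes n: "n \<ge> 1" and s: "chain n w (B n) summable_on PiE {1..n} (\<lambda>_. UNIV)"
    and st: "\<And>j M N. j < n \<Longrightarrow>
      ((\<lambda>(r, s). w (Suc j) (r, s) * (iq (M - r) * iq (N - s)) * B (Suc j) (r, s)) has_sum B j (M, N)) UNIV"
    and L: "(\<lambda>m. B 0 (int m, int m)) \<longlonglongrightarrow> L"
  shows "(chain n w (B n) has_sum L * qpinf q q ^ 2) (PiE {1..n} (\<lambda>_. UNIV))"
proof -
  obtain C where C: "C \<ge> 1" "\<And>n. norm (iq n) \<le> C" using fq_iq_bound by metis
  have 1: "(\<lambda>v. w 1 v * B 1 v) summable_on UNIV" "(chain n w (B n) has_sum (\<Sum>\<^sub>\<infinity>v. w 1 v * B 1 v)) (PiE {1..n} (\<lambda>_. UNIV))"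
    using chain_sum[OF n s st] by auto
  define f where "f = (\<lambda>m v. (iq (int m - fst v) * iq (int m - snd v)) * (w 1 v * B 1 v))"
  have "infsum (f m) UNIV = B 0 (int m, int m)" for m
  proof -
    have "(\<lambda>(r, s). w (Suc 0) (r, s) * (iq (int m - r) * iq (int m - s)) * B (Suc 0) (r, s)) = f m"
      by (auto simp: f_def fun_eq_iff)
    thus ?thesis using infsumI[OF st[of 0 "int m" "int m"]] n by simp
  qed
  moreover have "(\<lambda>m. infsum (f m) UNIV) \<longlonglongrightarrow> (\<Sum>\<^sub>\<infinity>v. (1 / qpinf q q * (1 / qpinf q q)) * (w 1 v * B 1 v))"
  proof (rule infsum_dominated_convergence(2))
    show "(\<lambda>v. C * C * norm (w 1 v * B 1 v)) summable_on UNIV"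
      by (rule summable_on_cmult_right[OF summable_on_iff_abs_summable_on_complex[THEN iffD1, OF 1(1)]])
    show "norm (f m v) \<le> C * C * norm (w 1 v * B 1 v)" for m v
      unfolding f_def norm_mult[of _ "w 1 v * B 1 v"] unfolding norm_mult[of "iq _"]
      by (intro mult_right_mono mult_mono C norm_ge_zero) (use C(1) in auto)
    show "(\<lambda>m. f m v) \<longlonglongrightarrow> (1 / qpinf q q * (1 / qpinf q q)) * (w 1 v * B 1 v)" for v
      unfolding f_def diff_conv_add_uminus by (intro tendsto_mult tendsto_const iq_lim)
  qed
  ultimately have "(\<Sum>\<^sub>\<infinity>v. (1 / qpinf q q * (1 / qpinf q q)) * (w 1 v * B 1 v)) = L"
    using L LIMSEQ_unique by fastforce
  hence "(\<Sum>\<^sub>\<infinity>v. w 1 v * B 1 v) = L * qpinf q q ^ 2"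
    using qpinf_nz by (simp only: infsum_cmult_right') (simp add: field_simps power2_eq_square)
  thus ?thesis using 1(2) by simp
qed

lemma chain_nonneg:
  assumes "chain n w B r \<noteq> 0" and B: "\<And>x y. B (x, y) \<noteq> 0 \<Longrightarrow> 0 \<le> x \<and> 0 \<le> y" and j: "1 \<le> j" "j \<le> n"
  shows "0 \<le> fst (r j) \<and> 0 \<le> snd (r j)"
  using j(2,1)
proof (induction j rule: inc_induct)
  case base
  have "B (fst (r n), snd (r n)) \<noteq> 0" using assms(1) by (auto simp: chain_def)
  thus ?case by (rule B)
next
  case (step j)
  have "iq (fst (r j) - fst (r (j+1))) * iq (snd (r j) - snd (r (j+1))) \<noteq> 0"
    using assms(1) step by (simp add: chain_def)
  hence "fst (r j) - fst (r (j+1)) \<ge> 0" "snd (r j) - snd (r (j+1)) \<ge> 0"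
    using iq_neg by (auto simp: not_less[symmetric])
  thus ?case using step by auto
qed

text \<open>By the truncations only nested nonnegative entries contribute. There the weights decay
  geometrically in every variable, while the factors \<open>iq\<close> and \<open>B\<close> are
  bounded.\<close>

lemma chain_summable:
  assumes w: "\<And>j x y. 1 \<le> j \<Longrightarrow> j \<le> n \<Longrightarrow> 0 \<le> x \<Longrightarrow> 0 \<le> y \<Longrightarrow> norm (w j (x, y)) \<le> 2 * sqrt (norm q) ^ nat (x + y)"
    and B: "\<And>x y. B (x, y) \<noteq> 0 \<Longrightarrow> 0 \<le> x \<and> 0 \<le> y" "\<And>v. norm (B v) \<le> b"
  shows "chain n w B summable_on PiE {1..n} (\<lambda>_. UNIV)"
proof -
  obtain C where C: "C \<ge> 1" "\<And>n. norm (iq n) \<le> C" using fq_iq_bound by metis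
  define \<sigma> where "\<sigma> = sqrt (norm q)"
  have \<sigma>: "0 \<le> \<sigma>" "\<sigma> < 1" using q_lt1 by (simp_all add: \<sigma>_def real_sqrt_lt_1_iff)
  define g where "g = (\<lambda>(x :: int, y :: int). if 0 \<le> x \<and> 0 \<le> y then complex_of_real (\<sigma> ^ nat (x + y)) else 0)"
  define c where "c = 2 ^ n * (C * C) ^ (n - 1) * b"
  have b0: "b \<ge> 0" using B(2)[of "(0, 0)"] norm_ge_zero order_trans by blast
  have "(\<lambda>r. \<Prod>j\<in>{1..n}. g (r j)) summable_on PiE {1..n} (\<lambda>_. UNIV)"
    by (rule prod_PiE_summable) (unfold g_def, rule geometric_lattice_summable[OF \<sigma>])
  hence s: "(\<lambda>r. complex_of_real c * (\<Prod>j\<in>{1..n}. g (r j))) summable_on PiE {1..n} (\<lambda>_. UNIV)"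
    by (rule summable_on_cmult_right)
  show ?thesis
  proof (rule norm_bound_summable[OF s])
    fix r
    show "norm (chain n w B r) \<le> norm (complex_of_real c * (\<Prod>j\<in>{1..n}. g (r j)))"
    proof (cases "chain n w B r = 0")
      case False
      have nn: "0 \<le> fst (r j) \<and> 0 \<le> snd (r j)" if "j \<in> {1..n}" for j
        using chain_nonneg[OF False B(1), of j] that by auto
      have g: "norm (g (r j)) = \<sigma> ^ nat (fst (r j) + snd (r j))" if "j \<in> {1..n}" for j
        using nn[OF that] \<sigma>(1) by (simp add: g_def case_prod_unfold norm_power)
      have "norm (\<Prod>j\<in>{1..n}. w j (r j)) \<le> (\<Prod>j\<in>{1..n}. 2 * norm (g (r j)))"
        unfolding prod_norm[symmetric]
      proof (rule prod_mono, rule conjI)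
        fix j assume j: "j \<in> {1..n}"
        show "norm (w j (r j)) \<le> 2 * norm (g (r j))"
          using w[of j "fst (r j)" "snd (r j)"] nn[OF j] j unfolding g[OF j] \<sigma>_def by simp
      qed simp
      also have "\<dots> = 2 ^ n * norm (\<Prod>j\<in>{1..n}. g (r j))" by (simp add: prod.distrib prod_norm)
      finally have 1: "norm (\<Prod>j\<in>{1..n}. w j (r j)) \<le> 2 ^ n * norm (\<Prod>j\<in>{1..n}. g (r j))" .
      have "norm (\<Prod>j\<in>{1..n-1}. iq (fst (r j) - fst (r (j+1))) * iq (snd (r j) - snd (r (j+1)))) \<le> (\<Prod>j\<in>{1..n-1}. C * C)"
        unfolding prod_norm[symmetric]
      proof (rule prod_mono, rule conjI)
        fix j show "norm (iq (fst (r j) - fst (r (j+1))) * iq (snd (r j) - snd (r (j+1)))) \<le> C * C"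
          unfolding norm_mult by (intro mult_mono C norm_ge_zero) (use C(1) in auto)
      qed simp
      hence 2: "norm (\<Prod>j\<in>{1..n-1}. iq (fst (r j) - fst (r (j+1))) * iq (snd (r j) - snd (r (j+1)))) \<le> (C * C) ^ (n - 1)" by simp
      have "norm (chain n w B r) \<le> 2 ^ n * norm (\<Prod>j\<in>{1..n}. g (r j)) * (C * C) ^ (n - 1) * b"
        unfolding chain_def norm_mult by (intro mult_mono 1 2 B(2) mult_nonneg_nonneg norm_ge_zero) (use C(1) in auto)
      also have "\<dots> = norm (complex_of_real c * (\<Prod>j\<in>{1..n}. g (r j)))"
        using b0 C(1) by (simp add: c_def norm_mult abs_mult norm_power)
      finally show ?thesis .
    qed simp
  qed
qed

section \<open>Bounds, and the Macdonald identity in terms of q\<close>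

lemma hq_ge: "2 * hq x y \<ge> x + y" if "x \<ge> 0" "y \<ge> 0"
proof -
  have "x \<le> x * x" if "x \<ge> 0" for x :: int
    using that by (cases "x = 0") (auto intro: mult_left_mono[of 1 x x, simplified])
  hence "x + y \<le> x * x + y * y" using that by (simp add: add_mono)
  also have "\<dots> \<le> x * x + y * y + (x - y) * (x - y)" by simp
  also have "\<dots> = 2 * hq x y" by (simp add: hq_def power2_eq_square algebra_simps)
  finally show ?thesis .
qed

lemma norm_q_powi: "n \<ge> 0 \<Longrightarrow> norm (q powi n) = norm q ^ nat n"
  by (simp add: power_int_def norm_power)

lemma norm_q_powi_le1: "n \<ge> 0 \<Longrightarrow> norm (q powi n) \<le> 1"
  using q_lt1 by (simp add: norm_q_powi power_le_one)

text \<open>\<open>hq\<close> dominates only half of x + y, hence the square root of the norm of q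
  as ratio.\<close>

lemma norm_q_powi_hq:
  assumes "x \<ge> 0" "y \<ge> 0" "e \<ge> 0"
  shows "norm (q powi (hq x y + e)) \<le> sqrt (norm q) ^ nat (x + y)"
proof -
  have h: "2 * (hq x y + e) \<ge> x + y" using hq_ge[of x y] assms by auto
  hence h0: "hq x y + e \<ge> 0" using assms by auto
  have "norm (q powi (hq x y + e)) = norm q ^ nat (hq x y + e)" using h0 by (rule norm_q_powi)
  also have "\<dots> = (sqrt (norm q) ^ 2) ^ nat (hq x y + e)" by simp
  also have "\<dots> = sqrt (norm q) ^ (2 * nat (hq x y + e))" by (simp only: power_mult)
  also have "\<dots> \<le> sqrt (norm q) ^ nat (x + y)"
    by (rule power_decreasing) (use h q_lt1 in \<open>auto simp: real_sqrt_le_1_iff\<close>)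
  finally show ?thesis .
qed

lemma beta_bound:
  obtains b where "\<And>e x y. e \<ge> 0 \<Longrightarrow> norm (q powi (2 * x * y + e * y) * iq x * iq y * iq (x + y + 1)) \<le> b"
proof -
  obtain C where C: "C \<ge> 1" "\<And>n. norm (iq n) \<le> C" using fq_iq_bound by metis
  show thesis
  proof (rule that[of "1 * C * C * C"])
    fix e x y :: int assume e: "e \<ge> 0"
    show "norm (q powi (2 * x * y + e * y) * iq x * iq y * iq (x + y + 1)) \<le> 1 * C * C * C"
    proof (cases "x \<ge> 0 \<and> y \<ge> 0")
      case True
      hence "norm (q powi (2 * x * y + e * y)) \<le> 1" using e by (intro norm_q_powi_le1) auto
      thus ?thesis unfolding norm_mult by (intro mult_mono C mult_nonneg_nonneg norm_ge_zero) (use C(1) in auto)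
    next
      case False
      hence "iq x = 0 \<or> iq y = 0" using iq_neg by auto
      thus ?thesis using C(1) by auto
    qed
  qed
qed

lemma norm_qpow: "0 < m \<Longrightarrow> norm (q ^ m) < 1"
  using q_lt1 by (simp add: norm_power power_less_one_iff)

text \<open>\<open>macdonald_A2\<close> with base p, u = q^A and v = q^B. The power of q in front
  combines q^n from hq = 3 gq + 1 with the denominator u v.\<close>

lemma cw_macdonald:
  fixes n A B :: nat
  assumes le: "A + B \<le> 3 * n + 2"
  defines "p \<equiv> q ^ (3 * n + 2)"
  shows "((\<lambda>(\<xi>, \<eta>). cw (int n) \<xi> \<eta> * q powi (int A * \<xi> + int B * \<eta>)) has_sum
    q powi (int n - int A - int B) * (qpinf p p ^ 2 * (qpinf (q ^ A) p * qpinf (q ^ (3 * n + 2 - A)) p *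
      (qpinf (q ^ B) p * qpinf (q ^ (3 * n + 2 - B)) p) * (qpinf (q ^ (A + B)) p * qpinf (q ^ (3 * n + 2 - (A + B))) p)))) UNIV"
proof -
  have "norm p < 1" unfolding p_def by (rule norm_qpow) simp
  then interpret P: qbase p using q_nz by unfold_locales (auto simp: p_def)
  have th: "P.th (q ^ m) = qpinf (q ^ m) p * qpinf (q ^ (3 * n + 2 - m)) p" if "m \<le> 3 * n + 2" for m
  proof -
    have "q ^ (3 * n + 2 - m) = p / q ^ m" by (simp only: power_diff[OF q_nz that] p_def)
    thus ?thesis by (simp only: P.th_def)
  qed
  have "((\<lambda>x. q powi int n * (\<lambda>(\<xi>, \<eta>). chi (\<xi> + \<eta>) * p powi gq \<xi> \<eta> * (q ^ A) powi \<xi> * (q ^ B) powi \<eta>) x) has_sum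
    q powi int n * (qpinf p p ^ 2 * (P.th (q ^ A) * P.th (q ^ B) * P.th (q ^ A * q ^ B)) / (q ^ A * q ^ B))) UNIV"
    by (intro has_sum_cmult_right P.macdonald_A2) (use q_nz in auto)
  moreover have "q powi int n * (\<lambda>(\<xi>, \<eta>). chi (\<xi> + \<eta>) * p powi gq \<xi> \<eta> * (q ^ A) powi \<xi> * (q ^ B) powi \<eta>) x
    = (\<lambda>(\<xi>, \<eta>). cw (int n) \<xi> \<eta> * q powi (int A * \<xi> + int B * \<eta>)) x" for x
  proof -
    obtain \<xi> \<eta> where x: "x = (\<xi>, \<eta>)" by (cases x)
    show ?thesis
    proof (cases "chi (\<xi> + \<eta>) = 0")
      case True thus ?thesis by (simp add: x cw_def)
    next
      case False
      have pw: "(q ^ m) powi z = q powi (int m * z)" for m z by (simp add: power_int_mult power_int_of_nat)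
      have "int n * hq \<xi> \<eta> + 2 * gq \<xi> \<eta> = int n + int (3 * n + 2) * gq \<xi> \<eta>"
        unfolding hq_gq[OF False] by (simp add: algebra_simps)
      hence "cw (int n) \<xi> \<eta> = chi (\<xi> + \<eta>) * (q powi int n * p powi gq \<xi> \<eta>)"
        unfolding cw_def p_def pw by (simp only: qpi_add)
      thus ?thesis unfolding x split pw qpi_add by (simp only: mult_ac)
    qed
  qed
  moreover have "q powi int n * (qpinf p p ^ 2 * (P.th (q ^ A) * P.th (q ^ B) * P.th (q ^ A * q ^ B)) / (q ^ A * q ^ B))
    = q powi (int n - int A - int B) * (qpinf p p ^ 2 * (qpinf (q ^ A) p * qpinf (q ^ (3 * n + 2 - A)) p *
      (qpinf (q ^ B) p * qpinf (q ^ (3 * n + 2 - B)) p) * (qpinf (q ^ (A + B)) p * qpinf (q ^ (3 * n + 2 - (A + B))) p)))"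
  proof -
    have "q powi (int n - int A - int B) = q powi int n / (q ^ A * q ^ B)"
      using q_nz by (simp add: power_int_diff power_int_of_nat)
    moreover have "A \<le> 3 * n + 2" "B \<le> 3 * n + 2" using le by auto
    ultimately show ?thesis unfolding power_add[symmetric] using le by (simp add: th)
  qed
  ultimately show ?thesis by simp
qed

section \<open>The first family\<close>

definition beta :: "int \<Rightarrow> int \<times> int \<Rightarrow> complex" where
  "beta e = (\<lambda>(x, y). q powi (2 * x * y + e * y) * iq x * iq y * iq (x + y + 1))"

lemma beta_nonneg: "beta e (x, y) \<noteq> 0 \<Longrightarrow> 0 \<le> x \<and> 0 \<le> y"
  using iq_neg by (auto simp: beta_def not_less[symmetric])

text \<open>The factor of the theorem involving r^(i-1) is attached to the variable j = i - 1. As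
  variables start at 1, it never occurs for i = 1, in agreement with the convention.\<close>

definition wt1 :: "nat \<Rightarrow> nat \<Rightarrow> int \<times> int \<Rightarrow> complex" where
  "wt1 i j = (\<lambda>(x, y). q powi (hq x y + (if i \<le> j then x + y else 0)) * (if i = Suc j then 1 - q powi (x + y + 1) else 1))"

text \<open>The value left after summing the variables above j. The seed contributes q^2, each of
  the first n + 1 - i steps q^(-1), and each later step q; the kernel changes from \<open>SA\<close>
  to \<open>SB\<close> when variable i - 1 is summed.\<close>

definition st1 :: "nat \<Rightarrow> nat \<Rightarrow> nat \<Rightarrow> int \<times> int \<Rightarrow> complex" where
  "st1 n i j v = (if i \<le> Suc j then q powi (2 - int (n - j)) * SA (int (n - j)) v
     else q powi (2 - int (n + 1 - i) + int (i - 1 - j)) * SB (int (n - j)) (int (i - j)) v)"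

lemma st1_last: assumes "i \<le> n + 1" shows "st1 n i n = beta 0"
proof
  fix v :: "int \<times> int"
  obtain x y where v: "v = (x, y)" by (cases v)
  have "q powi 2 * q powi (2 * x * y - 2) = q powi (2 * x * y)" by (simp only: qpi_add[symmetric]) simp
  thus "st1 n i n v = beta 0 v" using assms by (simp add: st1_def SA_0 beta_def v mult.assoc[symmetric])
qed

lemma st1_step:
  assumes i: "1 \<le> i" "i \<le> n + 1" and j: "j < n"
  shows "((\<lambda>(r, s). wt1 i (Suc j) (r, s) * (iq (M - r) * iq (N - s)) * st1 n i (Suc j) (r, s)) has_sum st1 n i j (M, N)) UNIV"
proof -
  have nj: "int (n - j) = int (n - Suc j) + 1" using j by simp
  consider "i \<le> Suc j" | "i = Suc (Suc j)" | "i > Suc (Suc j)" by linarith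
  thus ?thesis
  proof cases
    case 1
    define c where "c = q powi (2 - int (n - Suc j))"
    have "((\<lambda>p. c * (\<lambda>(r, s). q powi (hq r s + (r + s)) * (iq (M - r) * iq (N - s)) * SA (int (n - Suc j)) (r, s)) p) has_sum
      c * (q powi (- 1) * SA (int (n - j)) (M, N))) UNIV"
      unfolding nj by (intro has_sum_cmult_right step_A)
    moreover have "c * (\<lambda>(r, s). q powi (hq r s + (r + s)) * (iq (M - r) * iq (N - s)) * SA (int (n - Suc j)) (r, s)) p
       = (\<lambda>(r, s). wt1 i (Suc j) (r, s) * (iq (M - r) * iq (N - s)) * st1 n i (Suc j) (r, s)) p" for p
      using 1 by (cases p) (simp add: wt1_def st1_def c_def mult_ac)
    moreover have "c * (q powi (- 1) * SA (int (n - j)) (M, N)) = st1 n i j (M, N)"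
    proof -
      have "2 - int (n - j) = (2 - int (n - Suc j)) + - 1" unfolding nj by simp
      hence "q powi (2 - int (n - j)) = c * q powi (- 1)" unfolding c_def by (simp only: qpi_add)
      thus ?thesis using 1 by (simp only: st1_def if_True mult.assoc)
    qed
    ultimately show ?thesis by simp
  next
    \<comment> \<open>This variable carries 1 - q^(r + s + 1), which converts \<open>SA\<close> into
      \<open>SB\<close> at m = 1 before the step is taken.\<close>
    case 2
    define c where "c = q powi (2 - int (n - Suc j))"
    have "((\<lambda>p. c * (\<lambda>(r, s). q powi (hq r s) * (iq (M - r) * iq (N - s)) * SB (int (n - Suc j)) 1 (r, s)) p) has_sum
      c * (q * SB (int (n - j)) 2 (M, N))) UNIV"
      unfolding nj using has_sum_cmult_right[OF step_B[of M N "int (n - Suc j)" 1]] by simp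
    moreover have "c * (\<lambda>(r, s). q powi (hq r s) * (iq (M - r) * iq (N - s)) * SB (int (n - Suc j)) 1 (r, s)) p
       = (\<lambda>(r, s). wt1 i (Suc j) (r, s) * (iq (M - r) * iq (N - s)) * st1 n i (Suc j) (r, s)) p" for p
    proof -
      obtain r s where p: "p = (r, s)" by (cases p)
      have "SB (int (n - Suc j)) 1 (r, s) = (1 - q powi (r + s + 1)) * SA (int (n - Suc j)) (r, s)"
        using SA_SB[of "(r, s)"] by simp
      moreover have "st1 n i (Suc j) (r, s) = c * SA (int (n - Suc j)) (r, s)" using 2 by (simp add: st1_def c_def)
      moreover have "wt1 i (Suc j) (r, s) = q powi hq r s * (1 - q powi (r + s + 1))" using 2 by (simp add: wt1_def)
      ultimately show ?thesis unfolding p split by (simp only: mult_ac)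
    qed
    moreover have "c * (q * SB (int (n - j)) 2 (M, N)) = st1 n i j (M, N)"
    proof -
      have "2 - int (n + 1 - i) + int (i - 1 - j) = (2 - int (n - Suc j)) + 1" using 2 i j by simp
      hence "q powi (2 - int (n + 1 - i) + int (i - 1 - j)) = c * q" unfolding c_def by (simp only: qpi_add power_int_1_right)
      moreover have "\<not> i \<le> Suc j" "int (i - j) = 2" using 2 by auto
      ultimately show ?thesis by (simp only: st1_def if_False mult.assoc)
    qed
    ultimately show ?thesis by simp
  next
    case 3
    define c where "c = q powi (2 - int (n + 1 - i) + int (i - 1 - Suc j))"
    have ij: "int (i - j) = int (i - Suc j) + 1" using 3 by simp
    have "((\<lambda>p. c * (\<lambda>(r, s). q powi (hq r s) * (iq (M - r) * iq (N - s)) * SB (int (n - Suc j)) (int (i - Suc j)) (r, s)) p) has_sum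
      c * (q * SB (int (n - j)) (int (i - j)) (M, N))) UNIV"
      unfolding nj ij by (intro has_sum_cmult_right step_B)
    moreover have "c * (\<lambda>(r, s). q powi (hq r s) * (iq (M - r) * iq (N - s)) * SB (int (n - Suc j)) (int (i - Suc j)) (r, s)) p
       = (\<lambda>(r, s). wt1 i (Suc j) (r, s) * (iq (M - r) * iq (N - s)) * st1 n i (Suc j) (r, s)) p" for p
      using 3 by (cases p) (simp add: wt1_def st1_def c_def mult_ac)
    moreover have "c * (q * SB (int (n - j)) (int (i - j)) (M, N)) = st1 n i j (M, N)"
    proof -
      have "2 - int (n + 1 - i) + int (i - 1 - j) = (2 - int (n + 1 - i) + int (i - 1 - Suc j)) + 1" using 3 by simp
      hence "q powi (2 - int (n + 1 - i) + int (i - 1 - j)) = c * q" unfolding c_def by (simp only: qpi_add power_int_1_right)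
      moreover have "\<not> i \<le> Suc j" using 3 by auto
      ultimately show ?thesis by (simp only: st1_def if_False mult.assoc)
    qed
    ultimately show ?thesis by simp
  qed
qed

text \<open>At j = 0 the accumulated power is q^(2 i - n), the inverse of the power in
  \<open>cw_macdonald\<close> at A = B = i. For i = 1 the sum never left the form \<open>SA\<close>,
  which has the same limit.\<close>

lemma st1_lim:
  assumes i: "1 \<le> i" "i \<le> n + 1" and S: "((\<lambda>(\<xi>, \<eta>). cw (int n) \<xi> \<eta> * q powi (int i * \<xi> + int i * \<eta>)) has_sum S) UNIV"
  shows "(\<lambda>m. st1 n i 0 (int m, int m)) \<longlonglongrightarrow> q powi (2 * int i - int n) * (S / qpinf q q ^ 5)"
proof (cases "i = 1")
  case True
  have "(\<lambda>m. \<Sum>\<^sub>\<infinity>(\<xi>, \<eta>). cw (int n) \<xi> \<eta> * q powi (\<xi> + \<eta>) * K (int m + 1) (int m + 1) \<xi> (\<eta> - \<xi>) (- \<eta>)) \<longlonglongrightarrow> (\<Sum>\<^sub>\<infinity>(\<xi>, \<eta>). cw (int n) \<xi> \<eta> * q powi (\<xi> + \<eta>)) / qpinf q q ^ 5"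
    by (rule kernel_sum_lim) (use has_sum_imp_summable[OF S] True in simp)
  hence "(\<lambda>m. q powi (2 - int n) * SA (int n) (int m, int m)) \<longlonglongrightarrow> q powi (2 - int n) * (S / qpinf q q ^ 5)"
    using infsumI[OF S] True by (intro tendsto_mult tendsto_const) (simp add: SA_def)
  thus ?thesis using True by (simp add: st1_def)
next
  case False
  have "(\<lambda>m. \<Sum>\<^sub>\<infinity>(\<xi>, \<eta>). cw (int n) \<xi> \<eta> * q powi (int i * (\<xi> + \<eta>)) * K (int m + 0) (int m + 0) (\<xi> + 1) (\<eta> - \<xi>) (- \<eta> - 1)) \<longlonglongrightarrow> (\<Sum>\<^sub>\<infinity>(\<xi>, \<eta>). cw (int n) \<xi> \<eta> * q powi (int i * (\<xi> + \<eta>))) / qpinf q q ^ 5"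
    by (rule kernel_sum_lim) (use has_sum_imp_summable[OF S] in \<open>simp add: distrib_left\<close>)
  hence "(\<lambda>m. q powi (2 * int i - int n) * SB (int n) (int i) (int m, int m)) \<longlonglongrightarrow> q powi (2 * int i - int n) * (S / qpinf q q ^ 5)"
    using infsumI[OF S] by (intro tendsto_mult tendsto_const) (simp add: SB_def distrib_left)
  moreover have "2 - int (n + 1 - i) + int (i - 1 - 0) = 2 * int i - int n" using i by simp
  ultimately show ?thesis using False i by (simp add: st1_def)
qed

lemma wt1_bound:
  assumes "0 \<le> x" "0 \<le> y" shows "norm (wt1 i j (x, y)) \<le> 2 * sqrt (norm q) ^ nat (x + y)"
proof -
  have 1: "norm (q powi (hq x y + (if i \<le> j then x + y else 0))) \<le> sqrt (norm q) ^ nat (x + y)"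
    using assms by (intro norm_q_powi_hq) auto
  have "norm (1 - q powi (x + y + 1)) \<le> norm (1 :: complex) + norm (q powi (x + y + 1))" by (rule norm_triangle_ineq4)
  also have "\<dots> \<le> 2" using norm_q_powi_le1[of "x + y + 1"] assms by simp
  finally have 2: "norm (if i = Suc j then 1 - q powi (x + y + 1) else 1) \<le> 2" by simp
  show ?thesis unfolding wt1_def split norm_mult
    using mult_mono[OF 1 2] by (simp add: mult.commute)
qed

lemma q_powi_sum: "q powi (\<Sum>j\<in>A. f j) = (\<Prod>j\<in>A. q powi f j)"
  by (induction A rule: infinite_finite_induct) (auto simp: qpi_add)

lemma summand1_chain:
  assumes i: "1 \<le> i" "i \<le> n + 1" and n: "n \<ge> 1"
  shows "summand1 q (n + 1) i = chain n (wt1 i) (beta 0)"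
proof
  fix r
  have 1: "(\<Sum>j=i..n. absv (r j)) = (\<Sum>j=1..n. if i \<le> j then absv (r j) else 0)"
    by (rule sum.mono_neutral_cong_left) (use i in auto)
  define F where "F = (\<lambda>j. if i = Suc j then 1 - q powi (absv (r j) + 1) else 1)"
  have 2: "(if i = 1 then 1 else 1 - q powi (absv (r (i - 1)) + 1)) = (\<Prod>j=1..n. F j)"
  proof -
    have "(\<Prod>j=1..n. F j) = (\<Prod>j=1..n. if j = i - 1 then 1 - q powi (absv (r j) + 1) else 1)"
      unfolding F_def using i by (intro prod.cong) auto
    moreover have "i - 1 \<in> {1..n}" if "i \<noteq> 1" using that i by auto
    ultimately show ?thesis by (cases "i = 1") (simp_all add: prod.delta)
  qed
  have 3: "wt1 i j (r j) = q powi (halfvCv (r j)) * q powi (if i \<le> j then absv (r j) else 0) * F j" for j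
    unfolding F_def qpi_add[symmetric] by (simp add: wt1_def case_prod_unfold halfvCv_def hq_def absv_def)
  have "q powi ((\<Sum>j=1..n. halfvCv (r j)) + (\<Sum>j=i..n. absv (r j)) + 2 * fst (r n) * snd (r n))
    * (if i = 1 then 1 else 1 - q powi (absv (r (i - 1)) + 1))
    = (\<Prod>j=1..n. wt1 i j (r j)) * q powi (2 * fst (r n) * snd (r n))"
    unfolding 1 2 3 prod.distrib unfolding qpi_add q_powi_sum by (simp only: mult_ac)
  thus "summand1 q (n + 1) i r = chain n (wt1 i) (beta 0) r"
    unfolding summand1_def recden_def chain_def beta_def by (simp add: case_prod_unfold absv_def mult_ac)
qed

theorem first_family:
  assumes i: "1 \<le> i" "i \<le> n + 1" and n: "n \<ge> 1"
  defines "p \<equiv> q ^ (3 * n + 2)"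
  shows "(summand1 q (n + 1) i has_sum
      (qpinf p p ^ 2 * (qpinf (q ^ i) p * qpinf (q ^ (3 * n + 2 - i)) p *
      (qpinf (q ^ i) p * qpinf (q ^ (3 * n + 2 - i)) p) * (qpinf (q ^ (i + i)) p * qpinf (q ^ (3 * n + 2 - (i + i))) p)))
      / qpinf q q ^ 3) (PiE {1..n} (\<lambda>_. UNIV))"
proof -
  define R where "R = qpinf p p ^ 2 * (qpinf (q ^ i) p * qpinf (q ^ (3 * n + 2 - i)) p *
      (qpinf (q ^ i) p * qpinf (q ^ (3 * n + 2 - i)) p) * (qpinf (q ^ (i + i)) p * qpinf (q ^ (3 * n + 2 - (i + i))) p))"
  have S: "((\<lambda>(\<xi>, \<eta>). cw (int n) \<xi> \<eta> * q powi (int i * \<xi> + int i * \<eta>)) has_sum q powi (int n - int i - int i) * R) UNIV"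
    unfolding R_def p_def by (rule cw_macdonald) (use i n in auto)
  obtain b where b: "\<And>e x y. e \<ge> 0 \<Longrightarrow> norm (q powi (2 * x * y + e * y) * iq x * iq y * iq (x + y + 1)) \<le> b"
    using beta_bound by blast
  have "chain n (wt1 i) (st1 n i n) summable_on PiE {1..n} (\<lambda>_. UNIV)"
    unfolding st1_last[OF i(2)]
  proof (rule chain_summable)
    show "norm (beta 0 v) \<le> b" for v using b[of 0 "fst v" "snd v"] by (simp add: beta_def case_prod_unfold)
  qed ((rule wt1_bound; assumption) | (rule beta_nonneg; assumption))+
  from chain_limit[OF n this st1_step[OF i] st1_lim[OF i S]]
  have "(chain n (wt1 i) (beta 0) has_sum q powi (2 * int i - int n) * (q powi (int n - int i - int i) * R / qpinf q q ^ 5) * qpinf q q ^ 2) (PiE {1..n} (\<lambda>_. UNIV))"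
    unfolding st1_last[OF i(2)] .
  moreover have "q powi (2 * int i - int n) * (q powi (int n - int i - int i) * R / qpinf q q ^ 5) * qpinf q q ^ 2 = R / qpinf q q ^ 3"
  proof -
    have "q powi (2 * int i - int n) * q powi (int n - int i - int i) = 1" by (simp add: qpi_add[symmetric])
    hence "q powi (2 * int i - int n) * (q powi (int n - int i - int i) * R / qpinf q q ^ 5) * qpinf q q ^ 2 = R / qpinf q q ^ 5 * qpinf q q ^ 2"
      by (simp add: mult.assoc[symmetric])
    thus ?thesis using qpinf_nz by (simp add: field_simps power_numeral_reduce)
  qed
  ultimately show ?thesis unfolding summand1_chain[OF i n] R_def by simp
qed

section \<open>The second family\<close>

definition wt2 :: "nat \<Rightarrow> int \<times> int \<Rightarrow> complex" where
  "wt2 j = (\<lambda>(x, y). q powi (hq x y + x))"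

text \<open>The sign is that of \<open>SU_0\<close>, and \<sigma> enters only through the starting
  value 1 - \<sigma> of the parameter m and the power q^(2 - \<sigma>).\<close>

definition st2 :: "nat \<Rightarrow> int \<Rightarrow> nat \<Rightarrow> int \<times> int \<Rightarrow> complex" where
  "st2 n \<sigma> j v = - (q powi (2 - \<sigma>) * SU (int (n - j)) (int (n - j) + 1 - \<sigma>) v)"

lemma st2_last: assumes "\<sigma> = 0 \<or> \<sigma> = 1" shows "st2 n \<sigma> n = beta \<sigma>"
proof
  fix v :: "int \<times> int"
  obtain x y where v: "v = (x, y)" by (cases v)
  have 0: "q powi (2 - 0) * q powi (2 * x * y - 2) = q powi (2 * x * y + 0 * y)" by (simp only: qpi_add[symmetric]) simp
  have 1: "q powi (2 - 1) * (q powi (y + 1) * q powi (2 * x * y - 2)) = q powi (2 * x * y + 1 * y)" by (simp only: qpi_add[symmetric]) (simp add: add_ac)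
  from assms show "st2 n \<sigma> n v = beta \<sigma> v"
  proof
    assume s: "\<sigma> = 0"
    have "st2 n \<sigma> n v = (q powi (2 - 0) * q powi (2 * x * y - 2)) * iq x * iq y * iq (x + y + 1)"
      by (simp add: st2_def s SU_0 SA_0 v)
    thus ?thesis unfolding 0 s beta_def v split .
  next
    assume s: "\<sigma> = 1"
    have "st2 n \<sigma> n v = (q powi (2 - 1) * (q powi (y + 1) * q powi (2 * x * y - 2))) * iq x * iq y * iq (x + y + 1)"
      by (simp add: st2_def s SU_0 SA_0 v)
    thus ?thesis unfolding 1 s beta_def v split .
  qed
qed

lemma st2_step:
  assumes j: "j < n"
  shows "((\<lambda>(r, s). wt2 (Suc j) (r, s) * (iq (M - r) * iq (N - s)) * st2 n \<sigma> (Suc j) (r, s)) has_sum st2 n \<sigma> j (M, N)) UNIV"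
proof -
  have nj: "int (n - j) = int (n - Suc j) + 1" using j by simp
  have ns: "int (n - j) + 1 - \<sigma> = (int (n - Suc j) + 1 - \<sigma>) + 1" unfolding nj by simp
  have "((\<lambda>p. - (q powi (2 - \<sigma>)) * (\<lambda>(r, s). q powi (hq r s + r) * (iq (M - r) * iq (N - s)) * SU (int (n - Suc j)) (int (n - Suc j) + 1 - \<sigma>) (r, s)) p) has_sum
      - (q powi (2 - \<sigma>)) * SU (int (n - j)) (int (n - j) + 1 - \<sigma>) (M, N)) UNIV"
    unfolding ns unfolding nj by (intro has_sum_cmult_right step_U)
  moreover have "- (q powi (2 - \<sigma>)) * (\<lambda>(r, s). q powi (hq r s + r) * (iq (M - r) * iq (N - s)) * SU (int (n - Suc j)) (int (n - Suc j) + 1 - \<sigma>) (r, s)) p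
     = (\<lambda>(r, s). wt2 (Suc j) (r, s) * (iq (M - r) * iq (N - s)) * st2 n \<sigma> (Suc j) (r, s)) p" for p
    by (cases p) (simp only: wt2_def st2_def split mult_ac mult_minus_left mult_minus_right)
  ultimately show ?thesis unfolding st2_def[of n \<sigma> j] by simp
qed

text \<open>Exchanging the first and third coordinates of the lattice vector makes the exponents
  nonnegative, as \<open>cw_macdonald\<close> needs, and its sign cancels the one in
  \<open>st2\<close>.\<close>

lemma st2_lim:
  assumes S: "((\<lambda>(\<xi>, \<eta>). cw (int n) \<xi> \<eta> * q powi (A * \<xi> + 1 * \<eta>)) has_sum S) UNIV" and A: "A = int n + 1 - \<sigma>"
  shows "(\<lambda>m. st2 n \<sigma> 0 (int m, int m)) \<longlonglongrightarrow> q powi (2 - \<sigma>) * (S / qpinf q q ^ 5)"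
proof -
  have bij: "bij (\<lambda>(\<xi>, \<eta>). (- \<eta>, - \<xi>) :: int \<times> int)"
    by (rule bij_betw_byWitness[where f' = "\<lambda>(\<xi>, \<eta>). (- \<eta>, - \<xi>)"]) auto
  have "cw (int n) (- \<eta>) (- \<xi>) = - cw (int n) \<xi> \<eta>" for \<xi> \<eta>
  proof -
    have "hq (- \<eta>) (- \<xi>) = hq \<xi> \<eta>" by (simp add: hq_def)
    moreover have "chi (- \<eta> + - \<xi>) = - chi (\<xi> + \<eta>)"
      unfolding chi_minus[symmetric] by (simp add: add.commute)
    ultimately show ?thesis unfolding cw_def gq_def by simp
  qed
  hence e: "(-1) * (\<lambda>(\<xi>, \<eta>). cw (int n) \<xi> \<eta> * q powi (A * \<xi> + 1 * \<eta>)) ((\<lambda>(\<xi>, \<eta>). (- \<eta>, - \<xi>)) p)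
     = (\<lambda>(\<xi>, \<eta>). cw (int n) \<xi> \<eta> * q powi (- \<xi> - A * \<eta>)) p" for p
    by (cases p) (simp add: algebra_simps)
  have "((\<lambda>p. (-1) * (\<lambda>(\<xi>, \<eta>). cw (int n) \<xi> \<eta> * q powi (A * \<xi> + 1 * \<eta>)) ((\<lambda>(\<xi>, \<eta>). (- \<eta>, - \<xi>)) p)) has_sum (-1) * S) UNIV"
    by (intro has_sum_cmult_right has_sum_bij[OF bij] S)
  hence S': "((\<lambda>(\<xi>, \<eta>). cw (int n) \<xi> \<eta> * q powi (- \<xi> - A * \<eta>)) has_sum - S) UNIV"
    unfolding e by simp
  have "(\<lambda>m. \<Sum>\<^sub>\<infinity>(\<xi>, \<eta>). cw (int n) \<xi> \<eta> * q powi (- \<xi> - A * \<eta>) * K (int m + 1) (int m + 0) \<xi> (\<eta> - \<xi>) (- \<eta> + 1)) \<longlonglongrightarrow> (\<Sum>\<^sub>\<infinity>(\<xi>, \<eta>). cw (int n) \<xi> \<eta> * q powi (- \<xi> - A * \<eta>)) / qpinf q q ^ 5"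
    by (rule kernel_sum_lim) (rule has_sum_imp_summable[OF S'])
  hence "(\<lambda>m. - (q powi (2 - \<sigma>)) * SU (int n) A (int m, int m)) \<longlonglongrightarrow> - (q powi (2 - \<sigma>)) * (- S / qpinf q q ^ 5)"
    unfolding infsumI[OF S'] by (intro tendsto_mult tendsto_const) (simp add: SU_def)
  thus ?thesis by (simp add: st2_def A)
qed

lemma summand2_chain:
  assumes "n \<ge> 1" shows "summand2 q (n + 1) \<sigma> = chain n wt2 (beta (int \<sigma>))"
proof
  fix r
  have w: "wt2 j (r j) = q powi (halfvCv (r j) + fst (r j))" for j
    by (simp add: wt2_def case_prod_unfold halfvCv_def hq_def)
  have "q powi ((\<Sum>j=1..n. halfvCv (r j) + fst (r j)) + 2 * fst (r n) * snd (r n) + int \<sigma> * snd (r n))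
    = (\<Prod>j=1..n. wt2 j (r j)) * q powi (2 * fst (r n) * snd (r n) + int \<sigma> * snd (r n))"
    unfolding w q_powi_sum[symmetric] qpi_add[symmetric] by (simp only: add.assoc)
  thus "summand2 q (n + 1) \<sigma> r = chain n wt2 (beta (int \<sigma>)) r"
    unfolding summand2_def recden_def chain_def beta_def by (simp add: case_prod_unfold absv_def mult_ac)
qed

theorem second_family:
  assumes n: "n \<ge> 1" and s: "\<sigma> = 0 \<or> \<sigma> = 1"
  defines "p \<equiv> q ^ (3 * n + 2)" and "A \<equiv> n + 1 - \<sigma>"
  shows "(summand2 q (n + 1) \<sigma> has_sum
      (qpinf p p ^ 2 * (qpinf (q ^ A) p * qpinf (q ^ (3 * n + 2 - A)) p *
      (qpinf (q ^ 1) p * qpinf (q ^ (3 * n + 2 - 1)) p) * (qpinf (q ^ (A + 1)) p * qpinf (q ^ (3 * n + 2 - (A + 1))) p)))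
      / qpinf q q ^ 3) (PiE {1..n} (\<lambda>_. UNIV))"
proof -
  define R where "R = qpinf p p ^ 2 * (qpinf (q ^ A) p * qpinf (q ^ (3 * n + 2 - A)) p *
      (qpinf (q ^ 1) p * qpinf (q ^ (3 * n + 2 - 1)) p) * (qpinf (q ^ (A + 1)) p * qpinf (q ^ (3 * n + 2 - (A + 1))) p))"
  have s': "int \<sigma> = 0 \<or> int \<sigma> = 1" using s by auto
  have A: "int A = int n + 1 - int \<sigma>" using s n by (auto simp: A_def)
  have S: "((\<lambda>(\<xi>, \<eta>). cw (int n) \<xi> \<eta> * q powi (int A * \<xi> + int 1 * \<eta>)) has_sum q powi (int n - int A - int 1) * R) UNIV"
    unfolding R_def p_def by (rule cw_macdonald) (use n in \<open>auto simp: A_def\<close>)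
  obtain b where b: "\<And>e x y. e \<ge> 0 \<Longrightarrow> norm (q powi (2 * x * y + e * y) * iq x * iq y * iq (x + y + 1)) \<le> b"
    using beta_bound by blast
  have "chain n wt2 (st2 n (int \<sigma>) n) summable_on PiE {1..n} (\<lambda>_. UNIV)"
    unfolding st2_last[OF s']
  proof (rule chain_summable)
    fix j and x y :: int assume x: "0 \<le> x" "0 \<le> y"
    have "norm (wt2 j (x, y)) \<le> 1 * sqrt (norm q) ^ nat (x + y)"
      using norm_q_powi_hq[of x y x] x by (simp add: wt2_def)
    also have "\<dots> \<le> 2 * sqrt (norm q) ^ nat (x + y)" by (rule mult_right_mono) auto
    finally show "norm (wt2 j (x, y)) \<le> 2 * sqrt (norm q) ^ nat (x + y)" .
  next
    show "norm (beta (int \<sigma>) v) \<le> b" for v using b[of "int \<sigma>" "fst v" "snd v"] by (simp add: beta_def case_prod_unfold)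
  qed (rule beta_nonneg)
  from chain_limit[OF n this st2_step st2_lim[OF S[unfolded of_nat_1] A]]
  have "(chain n wt2 (beta (int \<sigma>)) has_sum q powi (2 - int \<sigma>) * (q powi (int n - int A - 1) * R / qpinf q q ^ 5) * qpinf q q ^ 2) (PiE {1..n} (\<lambda>_. UNIV))"
    unfolding st2_last[OF s'] .
  moreover have "q powi (2 - int \<sigma>) * (q powi (int n - int A - 1) * R / qpinf q q ^ 5) * qpinf q q ^ 2 = R / qpinf q q ^ 3"
  proof -
    have "q powi (2 - int \<sigma>) * q powi (int n - int A - 1) = 1" unfolding A by (simp add: qpi_add[symmetric])
    hence "q powi (2 - int \<sigma>) * (q powi (int n - int A - 1) * R / qpinf q q ^ 5) * qpinf q q ^ 2 = R / qpinf q q ^ 5 * qpinf q q ^ 2"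
      by (simp add: mult.assoc[symmetric])
    thus ?thesis using qpinf_nz by (simp add: field_simps power_numeral_reduce)
  qed
  ultimately show ?thesis unfolding summand2_chain[OF n] R_def by simp
qed

end

section \<open>The degenerate value q = 0 and the conclusion\<close>

lemma recden_nonneg:
  assumes "recden q k r \<noteq> 0" "k \<ge> 2" and j: "1 \<le> j" "j \<le> k - 1"
  shows "0 \<le> fst (r j) \<and> 0 \<le> snd (r j)"
  using j(2,1)
proof (induction j rule: inc_induct)
  case base
  thus ?case using assms(1) by (auto simp: recden_def qinv_def split: if_splits)
next
  case (step j)
  have "j \<in> {1..k-2}" using step by auto
  hence "qinv q (fst (r j) - fst (r (j+1))) * qinv q (snd (r j) - snd (r (j+1))) \<noteq> 0"
    using assms(1) by (auto simp: recden_def)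
  hence "fst (r j) - fst (r (j+1)) \<ge> 0" "snd (r j) - snd (r (j+1)) \<ge> 0"
    by (auto simp: qinv_def split: if_splits)
  thus ?case using step by auto
qed

lemma halfvCv_nonneg: "halfvCv v \<ge> 0" "halfvCv v = 0 \<Longrightarrow> v = (0, 0)"
proof -
  have e: "2 * halfvCv v = (fst v)^2 + (snd v)^2 + (fst v - snd v)^2"
    by (simp add: halfvCv_def power2_eq_square algebra_simps)
  show "halfvCv v \<ge> 0" using e by (smt (verit) zero_le_power2)
  assume "halfvCv v = 0"
  hence "(fst v)^2 + (snd v)^2 + (fst v - snd v)^2 = 0" using e by simp
  hence "fst v = 0" "snd v = 0" by (smt (verit) zero_le_power2 power2_less_eq_zero_iff)+
  thus "v = (0, 0)" by (cases v) simp
qed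

lemma qpinf_0: "qpinf 0 0 = 1"
  by (simp add: qpinf_def)

text \<open>Every nonzero integer power of 0 is 0, negative ones included, so a term survives only
  if its exponent is 0. With nonnegative entries both parts of the exponent then vanish, and
  positive definiteness leaves the zero tuple.\<close>

lemma has_sum_q0:
  fixes f :: "(nat \<Rightarrow> int \<times> int) \<Rightarrow> complex" and e :: "(nat \<Rightarrow> int \<times> int) \<Rightarrow> int" and k :: nat
  assumes k: "k \<ge> 2"
    and f: "\<And>r. f r = 0 powi ((\<Sum>j=1..k-1. halfvCv (r j)) + e r) * g r * recden 0 k r"
    and e: "\<And>r. (\<And>j. j \<in> {1..k-1} \<Longrightarrow> 0 \<le> fst (r j) \<and> 0 \<le> snd (r j)) \<Longrightarrow> 0 \<le> e r"
    and z: "\<And>r. (\<And>j. j \<in> {1..k-1} \<Longrightarrow> r j = (0, 0)) \<Longrightarrow> e r = 0 \<and> g r = 1"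
  shows "(f has_sum 1) (PiE {1..k-1} (\<lambda>_. UNIV))"
proof -
  define r0 where "r0 = (\<lambda>j. if j \<in> {1..k-1} then (0 :: int, 0 :: int) else undefined)"
  have r0: "r0 j = (0, 0)" if "j \<in> {1..k-1}" for j using that by (auto simp: r0_def)
  have q: "qinv 0 0 = 1" "qinv 0 1 = 1" by (simp_all add: qinv_def qpoch_def)
  have rec: "recden 0 k r0 = 1"
  proof -
    have "(\<Prod>j\<in>{1..k-2}. qinv 0 (fst (r0 j) - fst (r0 (j+1))) * qinv 0 (snd (r0 j) - snd (r0 (j+1)))) = 1"
      by (rule prod.neutral) (use k in \<open>auto simp: r0 q\<close>)
    moreover have "r0 (k - 1) = (0, 0)" using k by (intro r0) auto
    ultimately show ?thesis by (simp add: recden_def absv_def q)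
  qed
  have f0: "f r0 = 1" using z[of r0] r0 rec unfolding f by (simp add: halfvCv_def)
  have "(f has_sum sum f {r0}) (PiE {1..k-1} (\<lambda>_. UNIV))"
  proof (rule has_sum_finite_neutralI)
    show "{r0} \<subseteq> PiE {1..k-1} (\<lambda>_. UNIV)" by (auto simp: r0_def PiE_def extensional_def)
    fix r assume r: "r \<in> PiE {1..k-1} (\<lambda>_. UNIV) - {r0}"
    show "f r = 0"
    proof (rule ccontr)
      assume n: "f r \<noteq> 0"
      hence "recden 0 k r \<noteq> 0" by (auto simp: f)
      hence "0 \<le> e r" using recden_nonneg[OF _ k] by (intro e) auto
      moreover have "(\<Sum>j=1..k-1. halfvCv (r j)) + e r = 0" using n by (auto simp: f)
      moreover have "(\<Sum>j=1..k-1. halfvCv (r j)) \<ge> 0" by (intro sum_nonneg halfvCv_nonneg)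
      ultimately have "(\<Sum>j=1..k-1. halfvCv (r j)) = 0" by linarith
      hence "\<forall>j\<in>{1..k-1}. halfvCv (r j) = 0" by (subst (asm) sum_nonneg_eq_0_iff) (auto intro: halfvCv_nonneg)
      hence "\<forall>j\<in>{1..k-1}. r j = (0, 0)" using halfvCv_nonneg(2) by blast
      hence "r = r0" using r by (auto simp: r0_def fun_eq_iff PiE_def extensional_def)
      thus False using r by simp
    qed
  qed auto
  thus ?thesis by (simp add: f0)
qed

theorem theorem5p7:
  fixes q :: complex and k :: nat
  assumes "norm q < 1" and "k \<ge> 2"
  shows "(\<forall>i\<in>{1..k}.
           (summand1 q k i has_sum
              (qpinf (q^i) (q^(3*k-1)) * qpinf (q^i) (q^(3*k-1)) * qpinf (q^(2*i)) (q^(3*k-1))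
               * qpinf (q^(3*k-2*i-1)) (q^(3*k-1)) * qpinf (q^(3*k-i-1)) (q^(3*k-1))
               * qpinf (q^(3*k-i-1)) (q^(3*k-1)) * qpinf (q^(3*k-1)) (q^(3*k-1))
               * qpinf (q^(3*k-1)) (q^(3*k-1)) / qpinf q q ^ 3))
           (PiE {1..k-1} (\<lambda>_. UNIV)))
       \<and> (\<forall>\<sigma>\<in>{0::nat, 1}.
           (summand2 q k \<sigma> has_sum
              (qpinf q (q^(3*k-1)) * qpinf (q^(k-\<sigma>)) (q^(3*k-1)) * qpinf (q^(k+1-\<sigma>)) (q^(3*k-1))
               * qpinf (q^(2*k-2+\<sigma>)) (q^(3*k-1)) * qpinf (q^(2*k-1+\<sigma>)) (q^(3*k-1))
               * qpinf (q^(3*k-2)) (q^(3*k-1)) * qpinf (q^(3*k-1)) (q^(3*k-1))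
               * qpinf (q^(3*k-1)) (q^(3*k-1)) / qpinf q q ^ 3))
           (PiE {1..k-1} (\<lambda>_. UNIV)))"
proof (cases "q = 0")
  case False
  interpret qbase q using False assms(1) by unfold_locales
  obtain n where n: "k = n + 1" "n \<ge> 1" using assms(2) by (intro that[of "k - 1"]) auto
  have K: "3 * k - 1 = 3 * n + 2" "k - 1 = n" using n by auto
  show ?thesis unfolding K
  proof (intro conjI ballI)
    fix i assume "i \<in> {1..k}"
    hence i: "1 \<le> i" "i \<le> n + 1" using n by auto
    have e: "3 * k - 2 * i - 1 = 3 * n + 2 - (i + i)" "3 * k - i - 1 = 3 * n + 2 - i" "2 * i = i + i" using n by auto
    show "(summand1 q k i has_sum
              (qpinf (q^i) (q^(3*n+2)) * qpinf (q^i) (q^(3*n+2)) * qpinf (q^(2*i)) (q^(3*n+2))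
               * qpinf (q^(3*k-2*i-1)) (q^(3*n+2)) * qpinf (q^(3*k-i-1)) (q^(3*n+2))
               * qpinf (q^(3*k-i-1)) (q^(3*n+2)) * qpinf (q^(3*n+2)) (q^(3*n+2))
               * qpinf (q^(3*n+2)) (q^(3*n+2)) / qpinf q q ^ 3)) (PiE {1..n} (\<lambda>_. UNIV))"
      using first_family[OF i n(2)] unfolding e(1,2) unfolding e(3) n(1)[symmetric] by (simp only: power2_eq_square mult_ac)
  next
    fix \<sigma> :: nat assume "\<sigma> \<in> {0, 1}"
    hence s: "\<sigma> = 0 \<or> \<sigma> = 1" by simp
    have e: "k - \<sigma> = n + 1 - \<sigma>" "k + 1 - \<sigma> = n + 1 - \<sigma> + 1" "2 * k - 2 + \<sigma> = 3 * n + 2 - (n + 1 - \<sigma> + 1)"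
      "2 * k - 1 + \<sigma> = 3 * n + 2 - (n + 1 - \<sigma>)" "3 * k - 2 = 3 * n + 2 - 1" using n s by auto
    show "(summand2 q k \<sigma> has_sum
              (qpinf q (q^(3*n+2)) * qpinf (q^(k-\<sigma>)) (q^(3*n+2)) * qpinf (q^(k+1-\<sigma>)) (q^(3*n+2))
               * qpinf (q^(2*k-2+\<sigma>)) (q^(3*n+2)) * qpinf (q^(2*k-1+\<sigma>)) (q^(3*n+2))
               * qpinf (q^(3*k-2)) (q^(3*n+2)) * qpinf (q^(3*n+2)) (q^(3*n+2))
               * qpinf (q^(3*n+2)) (q^(3*n+2)) / qpinf q q ^ 3)) (PiE {1..n} (\<lambda>_. UNIV))"
      unfolding e using second_family[OF n(2) s] unfolding n(1)[symmetric] by (simp only: power2_eq_square power_one_right mult_ac)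
  qed
next
  \<comment> \<open>The locale divides by powers of q, so q = 0 is treated apart. All exponents on
    the right are positive, hence every factor there is \<open>qpinf 0 0\<close> = 1.\<close>
  case True
  show ?thesis
  proof (intro conjI ballI)
    fix i assume i: "i \<in> {1..k}"
    have "(summand1 0 k i has_sum 1) (PiE {1..k-1} (\<lambda>_. UNIV))"
    proof (rule has_sum_q0[OF assms(2)])
      fix r
      show "summand1 0 k i r = 0 powi ((\<Sum>j=1..k-1. halfvCv (r j)) + ((\<Sum>j=i..k-1. absv (r j)) + 2 * fst (r (k-1)) * snd (r (k-1))))
        * (if i = 1 then 1 else 1 - 0 powi (absv (r (i - 1)) + 1)) * recden 0 k r"
        by (simp only: summand1_def add.assoc)
    next
      fix r :: "nat \<Rightarrow> int \<times> int"
      assume "\<And>j. j \<in> {1..k-1} \<Longrightarrow> 0 \<le> fst (r j) \<and> 0 \<le> snd (r j)"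
      thus "0 \<le> (\<Sum>j=i..k-1. absv (r j)) + 2 * fst (r (k-1)) * snd (r (k-1))"
        using i assms(2) by (intro add_nonneg_nonneg sum_nonneg) (auto simp: absv_def)
    next
      fix r :: "nat \<Rightarrow> int \<times> int"
      assume r: "\<And>j. j \<in> {1..k-1} \<Longrightarrow> r j = (0, 0)"
      have "(\<Sum>j=i..k-1. absv (r j)) = 0" using i by (intro sum.neutral) (auto simp: r absv_def)
      moreover have "r (k - 1) = (0, 0)" using assms(2) by (intro r) auto
      moreover have "r (i - 1) = (0, 0)" if "i \<noteq> 1" using that i by (intro r) auto
      ultimately show "(\<Sum>j=i..k-1. absv (r j)) + 2 * fst (r (k-1)) * snd (r (k-1)) = 0
        \<and> (if i = 1 then 1 else 1 - 0 powi (absv (r (i - 1)) + 1)) = (1 :: complex)"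
        by (auto simp: absv_def)
    qed
    moreover have "3 * k - 2 * i - 1 > 0" "3 * k - i - 1 > 0" "3 * k - 1 > 0" "i > 0" using i assms(2) by auto
    ultimately show "(summand1 q k i has_sum
              (qpinf (q^i) (q^(3*k-1)) * qpinf (q^i) (q^(3*k-1)) * qpinf (q^(2*i)) (q^(3*k-1))
               * qpinf (q^(3*k-2*i-1)) (q^(3*k-1)) * qpinf (q^(3*k-i-1)) (q^(3*k-1))
               * qpinf (q^(3*k-i-1)) (q^(3*k-1)) * qpinf (q^(3*k-1)) (q^(3*k-1))
               * qpinf (q^(3*k-1)) (q^(3*k-1)) / qpinf q q ^ 3)) (PiE {1..k-1} (\<lambda>_. UNIV))"
      unfolding True by (simp add: qpinf_0 zero_power)
  next
    fix \<sigma> :: nat assume s: "\<sigma> \<in> {0, 1}"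
    have "(summand2 0 k \<sigma> has_sum 1) (PiE {1..k-1} (\<lambda>_. UNIV))"
    proof (rule has_sum_q0[OF assms(2)])
      fix r
      show "summand2 0 k \<sigma> r = 0 powi ((\<Sum>j=1..k-1. halfvCv (r j)) + ((\<Sum>j=1..k-1. fst (r j)) + 2 * fst (r (k-1)) * snd (r (k-1)) + int \<sigma> * snd (r (k-1))))
        * 1 * recden 0 k r"
        by (simp only: summand2_def sum.distrib add.assoc mult_1_right)
    next
      fix r :: "nat \<Rightarrow> int \<times> int"
      assume "\<And>j. j \<in> {1..k-1} \<Longrightarrow> 0 \<le> fst (r j) \<and> 0 \<le> snd (r j)"
      thus "0 \<le> (\<Sum>j=1..k-1. fst (r j)) + 2 * fst (r (k-1)) * snd (r (k-1)) + int \<sigma> * snd (r (k-1))"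
        using assms(2) by (intro add_nonneg_nonneg sum_nonneg) auto
    next
      fix r :: "nat \<Rightarrow> int \<times> int"
      assume r: "\<And>j. j \<in> {1..k-1} \<Longrightarrow> r j = (0, 0)"
      have "(\<Sum>j=1..k-1. fst (r j)) = 0" by (intro sum.neutral) (auto simp: r)
      moreover have "r (k - 1) = (0, 0)" using assms(2) by (intro r) auto
      ultimately show "(\<Sum>j=1..k-1. fst (r j)) + 2 * fst (r (k-1)) * snd (r (k-1)) + int \<sigma> * snd (r (k-1)) = 0 \<and> 1 = (1 :: complex)"
        by simp
    qed
    moreover have "k - \<sigma> > 0" "k + 1 - \<sigma> > 0" "2 * k - 2 + \<sigma> > 0" "2 * k - 1 + \<sigma> > 0" "3 * k - 2 > 0" "3 * k - 1 > 0"
      using s assms(2) by auto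
    ultimately show "(summand2 q k \<sigma> has_sum
              (qpinf q (q^(3*k-1)) * qpinf (q^(k-\<sigma>)) (q^(3*k-1)) * qpinf (q^(k+1-\<sigma>)) (q^(3*k-1))
               * qpinf (q^(2*k-2+\<sigma>)) (q^(3*k-1)) * qpinf (q^(2*k-1+\<sigma>)) (q^(3*k-1))
               * qpinf (q^(3*k-2)) (q^(3*k-1)) * qpinf (q^(3*k-1)) (q^(3*k-1))
               * qpinf (q^(3*k-1)) (q^(3*k-1)) / qpinf q q ^ 3)) (PiE {1..k-1} (\<lambda>_. UNIV))"
      unfolding True by (simp add: qpinf_0 zero_power)
  qed
qed

end
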